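(* Let $n\ge1$ be an integer and let $\mathcal L$ be a linear operator generating an analytic semigroup $\{e^{-t\mathcal L}\}_{t>0}$ on $L^2(\mathbb R^n)$ whose kernel $p_t(x,y)$ satisfies a Gaussian upper bound: there are constants $C_1,A>0$ with $|p_t(x,y)|\le C_1\,t^{-n/2}e^{-A|x-y|^2/t}$ for all $x,y\in\mathbb R^n$ and $t>0$. Let $0<\gamma<n$, $1<p\le\alpha<s\le\infty$ and $\mu\in\Delta_2$. Let $(w,\nu)$ be a pair of weights such that for some $r>1$ and some constant $C_0<\infty$, for all cubes $Q$ in $\mathbb R^n$, $$|Q|^{\gamma/n}\cdot\left(\frac{1}{|Q|}\int_Q w(x)^r\,dx\right)^{1/(rp)}\left(\frac{1}{|Q|}\int_Q \nu(x)^{-p'/p}\,dx\right)^{1/p'}\le C_0 .$$ If $w\in\Delta_2$, then both the fractional maximal operator $M_\gamma$ and the generalized fractional integral $\mathcal L^{-\gamma/2}$ are bounded from $(L^p,L^s)^{\alpha}(\nu,w;\mu)$ into $(WL^p,L^s)^{\alpha}(w;\mu)$; that is, for $T=M_\gamma$ and for $T=\mathcal L^{-\gamma/2}$ there is a constant $C>0$ independent of $f$ such that $\|Tf\|_{(WL^p,L^s)^{\alpha}(w;\mu)}\le C\|f\|_{(L^p,L^s)^{\alpha}(\nu,w;\mu)}$ for all $f\in(L^p,L^s)^{\alpha}(\nu,w;\mu)$.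
   Context: A weight is a non-negative locally integrable function on $\mathbb R^n$; for a weight $w$ and measurable $E$, $w(E)=\int_E w(x)\,dx$. $B(y,r)$ is the open Euclidean ball with center $y$ and radius $r$; $p'=p/(p-1)$. All cubes have sides parallel to the coordinate axes. Fractional maximal operator: $M_\gamma f(x)=\sup_{B\ni x}\frac1{|B|^{1-\gamma/n}}\int_B|f(y)|\,dy$, the supremum over all balls $B$ containing $x$. The semigroup acts by $e^{-t\mathcal L}f(x)=\int_{\mathbb R^n}p_t(x,y)f(y)\,dy$. Generalized fractional integral: $\mathcal L^{-\gamma/2}f(x)=\frac1{\Gamma(\gamma/2)}\int_0^\infty e^{-t\mathcal L}f(x)\,t^{\gamma/2-1}\,dt$, i.e. the integral operator with kernel $\mathcal K_\gamma(x,y)=\frac1{\Gamma(\gamma/2)}\int_0^\infty p_t(x,y)t^{\gamma/2-1}\,dt$. A weight $\mu$ is in $\Delta_2$ if there is $C>0$ with $\mu(2B)\le C\mu(B)$ for every ball $B$ ($2B$ is the concentric ball with twice the radius). Weighted amalgam spaces: for $1\le p\le\alpha\le s\le\infty$ and weights $\nu,w,\mu$, the space $(L^p,L^s)^{\alpha}(\nu,w;\mu)$ consists of all locally integrable $f$ with $$\|f\|_{(L^p,L^s)^{\alpha}(\nu,w;\mu)}:=\sup_{r>0}\Big\|w(B(y,r))^{1/\alpha-1/p-1/s}\,\|f\chi_{B(y,r)}\|_{L^p(\nu)}\Big\|_{L^s(\mu)}<\infty,$$ where the $L^s(\mu)$-norm (norm with respect to $\mu(y)\,dy$, usual modification when $s=\infty$)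 is taken in $y$, and $\|g\|_{L^p(\nu)}=(\int|g|^p\nu\,dx)^{1/p}$. The weak space $(WL^p,L^s)^{\alpha}(w;\mu)$ consists of all measurable $f$ with $$\|f\|_{(WL^p,L^s)^{\alpha}(w;\mu)}:=\sup_{r>0}\Big\|w(B(y,r))^{1/\alpha-1/p-1/s}\,\|f\chi_{B(y,r)}\|_{WL^p(w)}\Big\|_{L^s(\mu)}<\infty,$$ where $\|g\|_{WL^p(w)}=\sup_{\lambda>0}\lambda\,[w(\{x:|g(x)|>\lambda\})]^{1/p}$. By convention these notions may equivalently be defined with cubes $Q(y,\ell)$ (center $y$, side length $\ell$) in place of balls $B(y,r)$. *)

theory Defs
  imports "HOL-Analysis.Analysis" "HOL-Probability.Essential_Supremum"
begin

section \<open>Weights and averages\<close>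

text \<open>Real powers on \<open>[0,\<infinity>]\<close>, with \<open>0\<^sup>a = \<infinity>\<close> and \<open>\<infinity>\<^sup>a = 0\<close> for \<open>a < 0\<close>. This differs from
  \<open>powr\<close> on the reals, where \<open>0 powr a = 0\<close>; negative powers of weights need the value \<open>\<infinity>\<close>.
  The product convention \<open>0 * \<infinity> = 0\<close> is that of \<^typ>\<open>ennreal\<close>.\<close>

definition enn_powr :: "ennreal \<Rightarrow> real \<Rightarrow> ennreal" where
  "enn_powr x a =
     (if a = 0 then 1
      else if x = 0 then (if a > 0 then 0 else \<infinity>)
      else if x = \<infinity> then (if a > 0 then \<infinity> else 0)
      else ennreal (enn2real x powr a))"

definition locally_integrable :: "(real^'n \<Rightarrow> 'b::{banach, second_countable_topology}) \<Rightarrow> bool" where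
  "locally_integrable f \<longleftrightarrow> (\<forall>K. compact K \<longrightarrow> set_integrable lebesgue K f)"

definition weight :: "(real^'n \<Rightarrow> real) \<Rightarrow> bool" where
  "weight w \<longleftrightarrow> (\<forall>x. 0 \<le> w x) \<and> locally_integrable w"

text \<open>The measure \<open>w(x) dx\<close>, so that \<open>w(E)\<close> is \<open>emeasure (wmeasure w) E\<close>.\<close>

definition wmeasure :: "(real^'n \<Rightarrow> real) \<Rightarrow> (real^'n) measure" where
  "wmeasure w = density lebesgue (\<lambda>x. ennreal (w x))"

definition Delta2 :: "(real^'n \<Rightarrow> real) \<Rightarrow> bool" where
  "Delta2 w \<longleftrightarrow> (\<exists>C>0. \<forall>y. \<forall>r>0.
     emeasure (wmeasure w) (ball y (2 * r)) \<le> ennreal C * emeasure (wmeasure w) (ball y r))"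

definition cube :: "real^'n \<Rightarrow> real \<Rightarrow> (real^'n) set" where
  "cube y l = cbox (\<chi> i. y $ i - l / 2) (\<chi> i. y $ i + l / 2)"

definition avg :: "(real^'n) set \<Rightarrow> (real^'n \<Rightarrow> ennreal) \<Rightarrow> ennreal" where
  "avg Q g = (\<integral>\<^sup>+x\<in>Q. g x \<partial>lebesgue) / emeasure lebesgue Q"

definition bump_condition ::
  "real \<Rightarrow> real \<Rightarrow> real \<Rightarrow> real \<Rightarrow> (real^'n \<Rightarrow> real) \<Rightarrow> (real^'n \<Rightarrow> real) \<Rightarrow> bool" where
  "bump_condition \<gamma> p r C\<^sub>0 w \<nu> \<longleftrightarrow>
     (let p' = p / (p - 1) in \<forall>y. \<forall>l>0.
        ennreal (measure lebesgue (cube y l) powr (\<gamma> / real CARD('n)))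
        * enn_powr (avg (cube y l) (\<lambda>x. enn_powr (ennreal (w x)) r)) (1 / (r * p))
        * enn_powr (avg (cube y l) (\<lambda>x. enn_powr (ennreal (\<nu> x)) (- p' / p))) (1 / p')
        \<le> ennreal C\<^sub>0)"

section \<open>Weighted amalgam spaces\<close>

text \<open>The norms are functions of the modulus \<open>F = |f|\<close>, with values in \<open>[0,\<infinity>]\<close>, so that they apply
  both to complex functions and to maximal functions, which may take the value \<open>\<infinity>\<close>.\<close>

definition modulus :: "('a \<Rightarrow> complex) \<Rightarrow> 'a \<Rightarrow> ennreal" where
  "modulus f x = ennreal (cmod (f x))"

definition Lnorm :: "ennreal \<Rightarrow> 'a measure \<Rightarrow> ('a \<Rightarrow> ennreal) \<Rightarrow> ennreal" where
  "Lnorm s M F =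
     (if s = \<infinity> then esssup M F
      else enn_powr (\<integral>\<^sup>+x. enn_powr (F x) (enn2real s) \<partial>M) (enn2real (1 / s)))"

definition WLnorm :: "real \<Rightarrow> 'a measure \<Rightarrow> ('a \<Rightarrow> ennreal) \<Rightarrow> ennreal" where
  "WLnorm p M F =
     (SUP c\<in>{0<..}. ennreal c * enn_powr (emeasure M {x \<in> space M. F x > ennreal c}) (1 / p))"

text \<open>In the exponents below, \<open>enn2real (1 / s)\<close> is \<open>1/s\<close>, equal to \<open>0\<close> for \<open>s = \<infinity>\<close>. Only finite
  \<open>p\<close> and \<open>\<alpha>\<close> are covered.\<close>

definition amalgam_norm ::
  "real \<Rightarrow> ennreal \<Rightarrow> real \<Rightarrow> (real^'n \<Rightarrow> real) \<Rightarrow> (real^'n \<Rightarrow> real) \<Rightarrow> (real^'n \<Rightarrow> real)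
   \<Rightarrow> (real^'n \<Rightarrow> ennreal) \<Rightarrow> ennreal" where
  "amalgam_norm p s \<alpha> \<nu> w \<mu> F =
     (SUP r\<in>{0<..}. Lnorm s (wmeasure \<mu>) (\<lambda>y.
        enn_powr (emeasure (wmeasure w) (ball y r)) (1 / \<alpha> - 1 / p - enn2real (1 / s))
        * Lnorm (ennreal p) (wmeasure \<nu>) (\<lambda>x. F x * indicator (ball y r) x)))"

definition amalgam ::
  "real \<Rightarrow> ennreal \<Rightarrow> real \<Rightarrow> (real^'n \<Rightarrow> real) \<Rightarrow> (real^'n \<Rightarrow> real) \<Rightarrow> (real^'n \<Rightarrow> real)
   \<Rightarrow> (real^'n \<Rightarrow> complex) set" where
  "amalgam p s \<alpha> \<nu> w \<mu> =
     {f. locally_integrable f \<and> amalgam_norm p s \<alpha> \<nu> w \<mu> (modulus f) < \<infinity>}"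

definition weak_amalgam_norm ::
  "real \<Rightarrow> ennreal \<Rightarrow> real \<Rightarrow> (real^'n \<Rightarrow> real) \<Rightarrow> (real^'n \<Rightarrow> real)
   \<Rightarrow> (real^'n \<Rightarrow> ennreal) \<Rightarrow> ennreal" where
  "weak_amalgam_norm p s \<alpha> w \<mu> F =
     (SUP r\<in>{0<..}. Lnorm s (wmeasure \<mu>) (\<lambda>y.
        enn_powr (emeasure (wmeasure w) (ball y r)) (1 / \<alpha> - 1 / p - enn2real (1 / s))
        * WLnorm p (wmeasure w) (\<lambda>x. F x * indicator (ball y r) x)))"

section \<open>Analytic semigroups on \<open>L\<^sup>2\<close> of Euclidean space\<close>

text \<open>Elements of \<open>L\<^sup>2\<close> are represented by functions; operators respect equality almost everywhere,
  and identities between elements of \<open>L\<^sup>2\<close> hold almost everywhere.\<close>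

definition L2 :: "(real^'n \<Rightarrow> complex) set" where
  "L2 = {f \<in> borel_measurable lebesgue. integrable lebesgue (\<lambda>x. (cmod (f x))\<^sup>2)}"

definition L2norm :: "(real^'n \<Rightarrow> complex) \<Rightarrow> real" where
  "L2norm f = sqrt (\<integral>x. (cmod (f x))\<^sup>2 \<partial>lebesgue)"

definition L2_linear ::
  "(real^'n \<Rightarrow> complex) set \<Rightarrow> ((real^'n \<Rightarrow> complex) \<Rightarrow> real^'n \<Rightarrow> complex) \<Rightarrow> bool" where
  "L2_linear D S \<longleftrightarrow>
     D \<subseteq> L2 \<and> S ` D \<subseteq> L2 \<and> (\<lambda>_. 0) \<in> D \<and>
     (\<forall>f\<in>D. \<forall>g\<in>D. \<forall>a b. (\<lambda>x. a * f x + b * g x) \<in> D \<and>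
        (AE x in lebesgue. S (\<lambda>x. a * f x + b * g x) x = a * S f x + b * S g x)) \<and>
     (\<forall>f\<in>D. \<forall>g\<in>L2. (AE x in lebesgue. f x = g x) \<longrightarrow>
        g \<in> D \<and> (AE x in lebesgue. S f x = S g x))"

definition L2_bounded_operator ::
  "((real^'n \<Rightarrow> complex) \<Rightarrow> real^'n \<Rightarrow> complex) \<Rightarrow> bool" where
  "L2_bounded_operator S \<longleftrightarrow> L2_linear L2 S \<and> (\<exists>C. \<forall>f\<in>L2. L2norm (S f) \<le> C * L2norm f)"

definition sector :: "real \<Rightarrow> complex set" where
  "sector \<theta> = {z. z \<noteq> 0 \<and> \<bar>Arg z\<bar> < \<theta>}"

definition analytic_semigroup ::
  "(complex \<Rightarrow> (real^'n \<Rightarrow> complex) \<Rightarrow> real^'n \<Rightarrow> complex) \<Rightarrow> bool" where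
  "analytic_semigroup T \<longleftrightarrow> (\<exists>\<theta>. 0 < \<theta> \<and> \<theta> \<le> pi / 2 \<and>
     (\<forall>z\<in>sector \<theta>. L2_bounded_operator (T z)) \<and>
     (\<forall>z\<in>sector \<theta>. \<forall>z'\<in>sector \<theta>. \<forall>f\<in>L2.
        AE x in lebesgue. T (z + z') f x = T z (T z' f) x) \<and>
     (\<forall>f\<in>L2. ((\<lambda>z. L2norm (\<lambda>x. T z f x - f x)) \<longlongrightarrow> 0) (at 0 within sector \<theta>)) \<and>
     (\<forall>f\<in>L2. \<forall>z\<in>sector \<theta>. \<exists>g\<in>L2.
        ((\<lambda>h. L2norm (\<lambda>x. (T (z + h) f x - T z f x) / h - g x)) \<longlongrightarrow> 0) (at 0)))"

text \<open>The operator \<open>L\<close> with domain \<open>D\<close> generates \<open>T t = exp (- t L)\<close>: in the sign convention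
  of semigroup theory, the infinitesimal generator of \<open>T\<close> is \<open>- L\<close>.\<close>

definition generates_semigroup ::
  "(real^'n \<Rightarrow> complex) set \<Rightarrow> ((real^'n \<Rightarrow> complex) \<Rightarrow> real^'n \<Rightarrow> complex)
   \<Rightarrow> (complex \<Rightarrow> (real^'n \<Rightarrow> complex) \<Rightarrow> real^'n \<Rightarrow> complex) \<Rightarrow> bool" where
  "generates_semigroup D L T \<longleftrightarrow>
     D = {f \<in> L2. \<exists>g\<in>L2. ((\<lambda>t. L2norm (\<lambda>x.
            (f x - T (complex_of_real t) f x) / complex_of_real t - g x)) \<longlongrightarrow> 0) (at_right 0)} \<and>
     (\<forall>f\<in>D. ((\<lambda>t. L2norm (\<lambda>x.
            (f x - T (complex_of_real t) f x) / complex_of_real t - L f x)) \<longlongrightarrow> 0) (at_right 0))"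

text \<open>Joint measurability in \<open>(t, x, y)\<close> is what gives a meaning to the integrals over \<open>t\<close> that
  define the fractional powers.\<close>

definition semigroup_kernel ::
  "(complex \<Rightarrow> (real^'n \<Rightarrow> complex) \<Rightarrow> real^'n \<Rightarrow> complex)
   \<Rightarrow> (real \<Rightarrow> real^'n \<Rightarrow> real^'n \<Rightarrow> complex) \<Rightarrow> bool" where
  "semigroup_kernel T k \<longleftrightarrow>
     set_borel_measurable lebesgue ({0<..} \<times> UNIV) (\<lambda>(t, x, y). k t x y) \<and>
     (\<forall>t>0. \<forall>f\<in>L2. AE x in lebesgue.
        integrable lebesgue (\<lambda>y. k t x y * f y) \<and>
        T (complex_of_real t) f x = (\<integral>y. k t x y * f y \<partial>lebesgue))"

definition gaussian_bound :: "(real \<Rightarrow> real^'n \<Rightarrow> real^'n \<Rightarrow> complex) \<Rightarrow> bool" where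
  "gaussian_bound k \<longleftrightarrow> (\<exists>C\<^sub>1>0. \<exists>A>0. \<forall>t>0. \<forall>x y.
     cmod (k t x y) \<le> C\<^sub>1 * t powr (- real CARD('n) / 2) * exp (- A * (norm (x - y))\<^sup>2 / t))"

section \<open>The operators\<close>

definition fractional_maximal ::
  "real \<Rightarrow> (real^'n \<Rightarrow> complex) \<Rightarrow> real^'n \<Rightarrow> ennreal" where
  "fractional_maximal \<gamma> f x =
     (SUP (y, r)\<in>{(y, r). 0 < r \<and> x \<in> ball y r}.
        ennreal (1 / measure lebesgue (ball y r) powr (1 - \<gamma> / real CARD('n)))
        * (\<integral>\<^sup>+z\<in>ball y r. modulus f z \<partial>lebesgue))"

definition semigroup_action ::
  "(real \<Rightarrow> real^'n \<Rightarrow> real^'n \<Rightarrow> complex) \<Rightarrow> real \<Rightarrow> (real^'n \<Rightarrow> complex) \<Rightarrow> real^'n \<Rightarrow> complex" where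
  "semigroup_action k t f x = (\<integral>y. k t x y * f y \<partial>lebesgue)"

definition fractional_integral ::
  "(real \<Rightarrow> real^'n \<Rightarrow> real^'n \<Rightarrow> complex) \<Rightarrow> real \<Rightarrow> (real^'n \<Rightarrow> complex) \<Rightarrow> real^'n \<Rightarrow> complex" where
  "fractional_integral k \<gamma> f x =
     complex_of_real (1 / Gamma (\<gamma> / 2)) *
     (LINT t:{0<..}|lebesgue. semigroup_action k t f x * complex_of_real (t powr (\<gamma> / 2 - 1)))"

text \<open>Absolute convergence of the double integral in \<open>(t, y)\<close>. By Fubini's theorem, where it holds
  the iterated integral above agrees with integration of \<open>f\<close> against the kernel
  \<open>1 / Gamma (\<gamma> / 2) * \<integral> k t x y * t powr (\<gamma> / 2 - 1) dt\<close>; elsewhere a divergent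
  Bochner integral would silently be \<open>0\<close>.\<close>

definition fractional_integral_converges ::
  "(real \<Rightarrow> real^'n \<Rightarrow> real^'n \<Rightarrow> complex) \<Rightarrow> real \<Rightarrow> (real^'n \<Rightarrow> complex) \<Rightarrow> real^'n \<Rightarrow> bool" where
  "fractional_integral_converges k \<gamma> f x \<longleftrightarrow>
     set_integrable lebesgue ({0<..} \<times> UNIV)
       (\<lambda>(t, y). k t x y * f y * complex_of_real (t powr (\<gamma> / 2 - 1)))"

end

theory Submission
  imports Defs
begin

text \<open>Both operators are dominated by the Riesz potential of \<open>|f|\<close>: the fractional maximal operator
  pointwise, the fractional integral because \<open>t powr (\<gamma> / 2 - 1)\<close> times the Gaussian bound integrates
  in \<open>t\<close> to a multiple of \<open>|x - y| powr (\<gamma> - n)\<close>.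

  The core is the two-weight weak type \<open>(p, p)\<close> inequality for the Riesz potential, which is proved
  directly, without duality and without any \<open>A\<^sub>\<infinity>\<close> property. The potential is a sum over the scales
  of averages \<open>a\<^sub>j(x)\<close> over dyadic cells. If this sum exceeds \<open>t\<close> at \<open>x\<close>, then for some \<open>i\<close> the terms
  whose running maximum is about \<open>t / 2 ^ i\<close> sum to more than \<open>t / 4 * (3 / 4) ^ i\<close>. As such terms
  are capped, all moments of their sum are controlled, so this happens only on a small proportion of
  the cells on which \<open>a\<^sub>j\<close> first exceeds \<open>t / 2 ^ (i + 1)\<close>; there Hoelder's inequality and the bump on
  \<open>w\<close> turn small Lebesgue density into small \<open>w\<close>-measure, with a gain that beats the loss \<open>2 ^ (i p)\<close>.

  For the amalgam norms, \<open>f\<close> is split at the double of a ball. The part of \<open>f\<close> outside is summed over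
  dilated balls, and reverse doubling of \<open>w\<close> makes the coefficients decay geometrically because
  \<open>1 / \<alpha> > 1 / s\<close>.\<close>

section \<open>Powers on the extended half-line\<close>

text \<open>With no A_infinity property, smallness in Lebesgue measure passes to \<open>w\<close>
  only through Hoelder's inequality: \<open>w(E)\<close> is at most \<open>I powr (1 / r)\<close>
  times \<open>|E| powr (1 - 1 / r)\<close>, where \<open>I\<close> is the integral of
  \<open>w powr r\<close> over a cube. This \<open>I\<close> is not comparable to the
  \<open>w\<close>-mass of the cube. The bump condition removes it by bounding
  \<open>I powr (1 / (r * p))\<close> times the integral of \<open>g\<close>, but that helps only on
  a cube where the average of \<open>g\<close> is bounded below. Every exceptional set must
  therefore be localised to cells on which some term is large. A sum of many small terms offers no
  such cell at level \<open>t\<close>, so the lower levels \<open>t / 2 ^ (i + 1)\<close> are used,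
  at the cost \<open>2 powr (p * (i + 1))\<close>. The thresholds \<open>t / 4 * (3 / 4) ^ i\<close>
  add up to \<open>t\<close>, yet decay more slowly than the caps \<open>t / 2 ^ i\<close>. The
  ratio of cap to threshold is \<open>4 * (2 / 3) ^ i\<close>, and a moment of order
  \<open>q\<close> raises it to the power \<open>q\<close>, which is free.\<close>

lemma enn_powr_ennreal:
  "0 \<le> x \<Longrightarrow> enn_powr (ennreal x) a =
    (if a = 0 then 1 else if x = 0 then (if a > 0 then 0 else \<infinity>) else ennreal (x powr a))"
  by (simp add: enn_powr_def)

lemma enn_powr_0_exp [simp]: "enn_powr x 0 = 1"
  by (simp add: enn_powr_def)

lemma enn_powr_zero [simp]: "0 < a \<Longrightarrow> enn_powr 0 a = 0"
  by (simp add: enn_powr_def)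

lemma enn_powr_top [simp]: "0 < a \<Longrightarrow> enn_powr top a = top"
  by (simp add: enn_powr_def)

lemma enn_powr_one [simp]: "enn_powr x 1 = x"
  by (cases x) (auto simp: enn_powr_def)

lemma enn_powr_pos: "0 < x \<Longrightarrow> enn_powr (ennreal x) a = ennreal (x powr a)"
  by (simp add: enn_powr_ennreal)

lemma enn_powr_mono: "0 \<le> a \<Longrightarrow> x \<le> y \<Longrightarrow> enn_powr x a \<le> enn_powr y a"
proof (cases y)
  case (real r)
  moreover assume "0 \<le> a" "x \<le> y"
  moreover from calculation obtain q where "x = ennreal q" "0 \<le> q" by (cases x) (auto simp: top_unique)
  ultimately show ?thesis by (auto simp: enn_powr_ennreal powr_mono2 intro!: ennreal_leI)
qed (cases "a = 0"; simp)

lemma enn_powr_antimono: "a \<le> 0 \<Longrightarrow> x \<le> y \<Longrightarrow> enn_powr y a \<le> enn_powr x a"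
proof (cases y)
  case (real r)
  moreover assume "a \<le> 0" "x \<le> y"
  moreover from calculation obtain q where "x = ennreal q" "0 \<le> q" by (cases x) (auto simp: top_unique)
  ultimately show ?thesis by (auto simp: enn_powr_ennreal powr_mono2' intro!: ennreal_leI)
qed (cases "a = 0"; simp add: enn_powr_def[of top])

text \<open>Restricted to \<open>0 \<le> a\<close>: for a negative exponent the factors
  \<open>0\<close> and \<open>top\<close> give infinity on the left but \<open>top * 0 = 0\<close>
  on the right.\<close>

lemma enn_powr_mult: "0 \<le> a \<Longrightarrow> enn_powr (x * y) a = enn_powr x a * enn_powr y a"
  by (cases x; cases y; cases "a = 0")
    (auto simp: enn_powr_ennreal enn_powr_def[of \<infinity>] enn_powr_def[of top] ennreal_mult[symmetric] powr_mult
      ennreal_mult_top ennreal_top_mult)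

text \<open>A negative exponent swaps \<open>0\<close> and \<open>top\<close>, and a second one
  swaps them back, so the law survives at the endpoints for all real exponents. With
  \<open>b = 1 / a\<close> it extracts roots.\<close>

lemma enn_powr_powr: "enn_powr (enn_powr x a) b = enn_powr x (a * b)"
proof (cases x)
  case (real r)
  then show ?thesis
    by (cases "r = 0"; cases "a = 0"; cases "b = 0"; cases "a > 0"; cases "b > 0")
      (auto simp: enn_powr_ennreal enn_powr_def[of \<infinity>] enn_powr_def[of top] enn_powr_def[of 0] enn_powr_def[of 1] powr_powr
          zero_less_mult_iff)
next
  case top
  then show ?thesis
    by (cases "a = 0"; cases "b = 0"; cases "a > 0"; cases "b > 0")
      (auto simp: enn_powr_ennreal enn_powr_def[of \<infinity>] enn_powr_def[of top] enn_powr_def[of 0] enn_powr_def[of 1] powr_powr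
          zero_less_mult_iff)
qed

text \<open>The endpoints are excluded because at \<open>0\<close> or infinity exponents of opposite
  sign give \<open>0 * top = 0\<close>, whatever the sum of the exponents.\<close>

lemma enn_powr_add: "0 < x \<Longrightarrow> x < \<infinity> \<Longrightarrow> enn_powr x (a + b) = enn_powr x a * enn_powr x b"
proof (cases x)
  case (real r)
  moreover assume "0 < x"
  ultimately have "0 < r" "x = ennreal r" by auto
  then show ?thesis by (simp only: enn_powr_pos powr_add ennreal_mult[symmetric] powr_ge_zero)
qed simp

lemma enn_powr_gt0: "0 < x \<Longrightarrow> x < \<infinity> \<Longrightarrow> 0 < enn_powr x a \<and> enn_powr x a < \<infinity>"
  by (cases x) (auto simp: enn_powr_ennreal)

lemma enn_powr_inverse: "0 < x \<Longrightarrow> x < \<infinity> \<Longrightarrow> enn_powr x a * enn_powr x (- a) = 1"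
  using enn_powr_add[of x a "- a"] by simp

lemma enn_powr_le_iff:
  assumes a: "0 < a"
  shows "enn_powr x a \<le> enn_powr y a \<longleftrightarrow> x \<le> y"
proof
  have root: "enn_powr (enn_powr z a) (1/a) = z" for z
    by (subst enn_powr_powr) (use a in simp)
  assume le: "enn_powr x a \<le> enn_powr y a"
  have "enn_powr (enn_powr x a) (1/a) \<le> enn_powr (enn_powr y a) (1/a)"
    by (rule enn_powr_mono[OF _ le]) (use a in simp)
  then show "x \<le> y" by (simp only: root)
qed (use a in \<open>simp add: enn_powr_mono\<close>)

lemma enn_powr_eq_0_iff: "0 < a \<Longrightarrow> enn_powr x a = 0 \<longleftrightarrow> x = 0"
  by (cases x) (auto simp: enn_powr_ennreal enn_powr_def[of top])

lemma enn_powr_eq_top_iff: "0 < a \<Longrightarrow> enn_powr x a = \<infinity> \<longleftrightarrow> x = \<infinity>"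
  by (cases x) (auto simp: enn_powr_ennreal enn_powr_def[of top])

lemma measurable_enn_powr [measurable (raw)]:
  assumes [measurable]: "f \<in> borel_measurable M"
  shows "(\<lambda>x. enn_powr (f x) a) \<in> borel_measurable M"
  unfolding enn_powr_def by measurable

lemma enn_Young:
  assumes pq: "0 < p" "0 < q" "1/p + 1/q = (1::real)"
  shows "x * y \<le> ennreal (1/p) * enn_powr x p + ennreal (1/q) * enn_powr y q"
proof (cases "x = \<infinity> \<or> y = \<infinity>")
  case True
  then show ?thesis
  proof
    assume "x = \<infinity>"
    then have "enn_powr x p = top" using pq by simp
    moreover have "ennreal (1/p) \<noteq> 0" using pq by simp
    ultimately have "ennreal (1/p) * enn_powr x p = \<infinity>" by (simp add: ennreal_mult_top)
    then show ?thesis by simp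
  next
    assume "y = \<infinity>"
    then have "enn_powr y q = top" using pq by simp
    moreover have "ennreal (1/q) \<noteq> 0" using pq by simp
    ultimately have "ennreal (1/q) * enn_powr y q = \<infinity>" by (simp add: ennreal_mult_top)
    then show ?thesis by simp
  qed
next
  case False
  then obtain a b where ab: "x = ennreal a" "y = ennreal b" "0 \<le> a" "0 \<le> b"
    by (cases x; cases y) auto
  have "1/p < 1" "1/q < 1" using pq(3) divide_pos_pos[OF zero_less_one pq(1)] divide_pos_pos[OF zero_less_one pq(2)] by linarith+
  then have p1: "1 < p" "1 < q" using pq(1,2) by (simp_all add: divide_less_eq)
  have "a * b \<le> a powr p / p + b powr q / q"
    by (rule Youngs_inequality) (use p1 pq ab in simp_all)
  then have "ennreal (a * b) \<le> ennreal (1/p * a powr p + 1/q * b powr q)"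
    by (intro ennreal_leI) simp
  also have "\<dots> = ennreal (1/p) * ennreal (a powr p) + ennreal (1/q) * ennreal (b powr q)"
    using pq by (subst ennreal_plus; simp add: ennreal_mult[symmetric])
  also have "\<dots> = ennreal (1/p) * enn_powr x p + ennreal (1/q) * enn_powr y q"
    using ab pq by (auto simp: enn_powr_ennreal)
  finally show ?thesis using ab by (simp add: ennreal_mult)
qed

text \<open>Both factors are normalised, Young's inequality is integrated, and the norms are
  multiplied back. This needs both norms strictly between \<open>0\<close> and \<open>top\<close>. A
  vanishing norm is treated first, since by \<open>0 * top = 0\<close> the claim is then that the
  left side vanishes; after that an infinite norm makes the right side infinite.\<close>

lemma nn_integral_Hoelder:
  assumes pq: "0 < p" "0 < q" "1/p + 1/q = (1::real)"
    and [measurable]: "f \<in> borel_measurable M" "g \<in> borel_measurable M"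
  shows "(\<integral>\<^sup>+x. f x * g x \<partial>M) \<le>
    enn_powr (\<integral>\<^sup>+x. enn_powr (f x) p \<partial>M) (1/p) * enn_powr (\<integral>\<^sup>+x. enn_powr (g x) q \<partial>M) (1/q)"
proof -
  define F where "F = (\<integral>\<^sup>+x. enn_powr (f x) p \<partial>M)"
  define G where "G = (\<integral>\<^sup>+x. enn_powr (g x) q \<partial>M)"
  have zero: "(\<integral>\<^sup>+x. f x * g x \<partial>M) = 0" if "F = 0 \<or> G = 0"
  proof -
    have "AE x in M. f x = 0 \<or> g x = 0"
      using that
    proof
      assume "F = 0"
      then have "AE x in M. enn_powr (f x) p = 0" by (simp add: F_def nn_integral_0_iff_AE)
      then show ?thesis by eventually_elim (use pq in \<open>simp add: enn_powr_eq_0_iff\<close>)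
    next
      assume "G = 0"
      then have "AE x in M. enn_powr (g x) q = 0" by (simp add: G_def nn_integral_0_iff_AE)
      then show ?thesis by eventually_elim (use pq in \<open>simp add: enn_powr_eq_0_iff\<close>)
    qed
    then have "AE x in M. f x * g x = 0" by eventually_elim auto
    then show ?thesis by (simp add: nn_integral_0_iff_AE)
  qed
  consider "F = 0 \<or> G = 0" | "F \<noteq> 0" "G \<noteq> 0" "F = \<infinity> \<or> G = \<infinity>" | "0 < F" "F < \<infinity>" "0 < G" "G < \<infinity>"
    by (metis infinity_ennreal_def not_gr_zero top.not_eq_extremum)
  then show ?thesis
  proof cases
    case 1
    then show ?thesis using zero by simp
  next
    case 2
    then have "enn_powr F (1/p) \<noteq> 0" "enn_powr G (1/q) \<noteq> 0" "enn_powr F (1/p) = \<infinity> \<or> enn_powr G (1/q) = \<infinity>"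
      using pq by (simp_all add: enn_powr_eq_0_iff enn_powr_eq_top_iff del: infinity_ennreal_def)
    then have "enn_powr F (1/p) * enn_powr G (1/q) = \<infinity>"
      by (auto simp: ennreal_top_mult ennreal_mult_top)
    then show ?thesis by (simp add: F_def G_def)
  next
    case 3
    define a where "a = enn_powr F (1/p)"
    define b where "b = enn_powr G (1/q)"
    define a' where "a' = enn_powr F (-(1/p))"
    define b' where "b' = enn_powr G (-(1/q))"
    have ab: "a * a' = 1" "b * b' = 1"
      unfolding a_def b_def a'_def b'_def by (rule enn_powr_inverse; use 3 in simp)+
    have "(\<integral>\<^sup>+x. (a' * f x) * (b' * g x) \<partial>M) \<le>
       (\<integral>\<^sup>+x. ennreal (1/p) * enn_powr (a' * f x) p + ennreal (1/q) * enn_powr (b' * g x) q \<partial>M)"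
      by (intro nn_integral_mono enn_Young pq)
    also have "\<dots> = ennreal (1/p) * (enn_powr a' p * F) + ennreal (1/q) * (enn_powr b' q * G)"
      using pq by (simp add: nn_integral_add nn_integral_cmult enn_powr_mult F_def G_def)
    also have "enn_powr a' p * F = 1"
      using enn_powr_inverse[of F "-1"] 3 pq by (simp add: a'_def enn_powr_powr)
    also have "enn_powr b' q * G = 1"
      using enn_powr_inverse[of G "-1"] 3 pq by (simp add: b'_def enn_powr_powr)
    also have "ennreal (1/p) * 1 + ennreal (1/q) * 1 = 1"
      using pq by (simp add: ennreal_plus[symmetric] del: ennreal_plus)
    finally have "(a' * b') * (\<integral>\<^sup>+x. f x * g x \<partial>M) \<le> 1"
      by (subst (asm) mult.assoc[symmetric], subst nn_integral_cmult[symmetric])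
         (auto simp: mult_ac)
    then have "(a * b) * ((a' * b') * (\<integral>\<^sup>+x. f x * g x \<partial>M)) \<le> (a * b) * 1"
      by (intro mult_left_mono) auto
    also have "(a * b) * ((a' * b') * (\<integral>\<^sup>+x. f x * g x \<partial>M)) = (a * a') * (b * b') * (\<integral>\<^sup>+x. f x * g x \<partial>M)"
      by (simp add: mult_ac)
    finally show ?thesis using ab by (simp add: a_def b_def F_def G_def)
  qed
qed

section \<open>Dyadic cells\<close>

definition cell_index :: "real \<Rightarrow> real^'n \<Rightarrow> 'n \<Rightarrow> int" where
  "cell_index h x = (\<lambda>i. \<lfloor>x $ i / h\<rfloor>)"

definition cell :: "real \<Rightarrow> real^'n \<Rightarrow> (real^'n) set" where
  "cell h x = {y. cell_index h y = cell_index h x}"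

text \<open>Averages over a cell together with its neighbours make a single dyadic grid suffice: points at
  distance less than \<open>h\<close> lie in neighbouring cells, yet the average is constant on cells.\<close>

definition neighbours :: "real \<Rightarrow> real^'n \<Rightarrow> (real^'n) set" where
  "neighbours h x = {y. \<forall>i. \<bar>cell_index h y i - cell_index h x i\<bar> \<le> 1}"

lemma neighbours_cong: "cell_index h x = cell_index h x' \<Longrightarrow> neighbours h x = neighbours h x'"
  by (simp add: neighbours_def)

lemma neighbours_sym: "y \<in> neighbours h x \<longleftrightarrow> x \<in> neighbours h y"
  by (simp add: neighbours_def abs_minus_commute)

lemma measurable_cell_index [measurable]:
  "cell_index h \<in> borel \<rightarrow>\<^sub>M count_space (UNIV :: ('n::finite \<Rightarrow> int) set)"
proof -
  have "cell_index h -` {c} \<in> sets borel" for c :: "'n \<Rightarrow> int"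
  proof -
    have [measurable]: "(\<lambda>x::real^'n. x $ i) \<in> borel_measurable borel" for i
      by (intro borel_measurable_continuous_onI continuous_intros)
    have "{x \<in> space borel. \<forall>i. \<lfloor>(x::real^'n) $ i / h\<rfloor> = c i} \<in> sets borel"
      by measurable
    then show ?thesis by (simp add: cell_index_def vimage_def fun_eq_iff)
  qed
  then show ?thesis
    by (subst measurable_count_space_eq2_countable) auto
qed

text \<open>A function constant on cells factors through the cell index, which takes countably many
  values, so it is measurable into any space. The dyadic averages get their measurability from
  this.\<close>

lemma cell_fun_measurable:
  fixes \<phi> :: "real^'n \<Rightarrow> 'a"
  assumes "\<And>x y. cell_index h x = cell_index h y \<Longrightarrow> \<phi> x = \<phi> y"
    and "\<And>x. \<phi> x \<in> space N"
  shows "\<phi> \<in> borel \<rightarrow>\<^sub>M N"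
proof -
  define \<psi> where "\<psi> c = \<phi> (SOME x. cell_index h x = c)" for c
  have "\<phi> x = \<psi> (cell_index h x)" for x
    unfolding \<psi>_def by (rule assms(1), rule someI2[where a=x]) auto
  then have "\<phi> = \<psi> \<circ> cell_index h" by auto
  moreover have "\<psi> \<in> count_space UNIV \<rightarrow>\<^sub>M N"
    using assms(2) by (auto simp: \<psi>_def)
  ultimately show ?thesis
    using measurable_comp[OF measurable_cell_index] by blast
qed

lemma sets_cell [measurable]: "cell h x \<in> sets borel"
proof -
  have "cell h x = cell_index h -` {cell_index h x} \<inter> space borel" by (auto simp: cell_def)
  also have "\<dots> \<in> sets borel" by (rule measurable_sets[OF measurable_cell_index]) simp
  finally show ?thesis .
qed

lemma neighbours_pred_measurable [measurable]:
  "Measurable.pred (borel \<Otimes>\<^sub>M borel) (\<lambda>(x::real^'n, y). y \<in> neighbours h x)"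
proof -
  have [measurable]: "(\<lambda>x. real_of_int (cell_index h x i)) \<in> borel_measurable borel" for i :: 'n
    using measurable_compose[OF measurable_cell_index, of "\<lambda>c. real_of_int (c i)"] by simp
  have eq: "y \<in> neighbours h x \<longleftrightarrow> (\<forall>i. \<bar>real_of_int (cell_index h y i) - real_of_int (cell_index h x i)\<bar> \<le> 1)" for x y :: "real^'n"
    unfolding neighbours_def by (simp flip: of_int_diff of_int_abs)
  show ?thesis unfolding eq by measurable
qed

lemma sets_neighbours [measurable]: "neighbours h x \<in> sets borel"
proof -
  have "neighbours h x = Pair x -` {z \<in> space (borel \<Otimes>\<^sub>M borel). (\<lambda>(x, y). y \<in> neighbours h x) z}"
    by (auto simp: space_pair_measure)
  also have "\<dots> \<in> sets borel"
    by (rule sets_Pair1) (use neighbours_pred_measurable[of h] in \<open>simp only: pred_def\<close>)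
  finally show ?thesis .
qed

lemma prod_const_Basis: "(\<Prod>b\<in>Basis. ((\<chi> i. d) :: real^'n) \<bullet> b) = d ^ CARD('n)"
proof -
  have "(\<Prod>b\<in>Basis. ((\<chi> i. d) :: real^'n) \<bullet> b) = (\<Prod>b\<in>(Basis::(real^'n) set). d)"
    by (rule prod.cong) (auto simp: Basis_vec_def inner_axis)
  then show ?thesis by simp
qed

lemma emeasure_box_const:
  assumes "0 \<le> d"
  shows "emeasure lborel (box (\<chi> i. u i) (\<chi> i. u i + d) :: (real^'n) set) = ennreal (d ^ CARD('n))"
    and "emeasure lborel (cbox (\<chi> i. u i) (\<chi> i. u i + d) :: (real^'n) set) = ennreal (d ^ CARD('n))"
proof -
  have le: "(\<chi> i. u i) \<bullet> b \<le> (\<chi> i. u i + d) \<bullet> b" if "b \<in> Basis" for b :: "real^'n"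
    using that assms by (auto simp: Basis_vec_def inner_axis)
  have diff: "(\<chi> i. u i + d) - (\<chi> i. u i) = ((\<chi> i. d) :: real^'n)"
    by (simp add: vec_eq_iff)
  show "emeasure lborel (box (\<chi> i. u i) (\<chi> i. u i + d) :: (real^'n) set) = ennreal (d ^ CARD('n))"
    using le by (subst emeasure_lborel_box) (auto simp: diff prod_const_Basis)
  show "emeasure lborel (cbox (\<chi> i. u i) (\<chi> i. u i + d) :: (real^'n) set) = ennreal (d ^ CARD('n))"
    using le by (subst emeasure_lborel_cbox) (auto simp: diff prod_const_Basis)
qed

text \<open>The half-open cell lies between an open and a closed box of the same volume.\<close>

lemma emeasure_cell:
  assumes h: "0 < h"
  shows "emeasure lborel (cell h (x :: real^'n)) = ennreal (h ^ CARD('n))"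
proof (rule antisym)
  let ?u = "\<lambda>i. h * \<lfloor>x $ i / h\<rfloor>"
  have eq: "y \<in> cell h x \<longleftrightarrow> (\<forall>i. ?u i \<le> y $ i \<and> y $ i < ?u i + h)" for y
    using h by (auto simp: cell_def cell_index_def fun_eq_iff floor_eq_iff field_simps)
  have "cell h x \<subseteq> cbox (\<chi> i. ?u i) (\<chi> i. ?u i + h)"
    by (auto simp: eq mem_box_cart less_imp_le)
  then have "emeasure lborel (cell h x) \<le> emeasure lborel (cbox (\<chi> i. ?u i) (\<chi> i. ?u i + h))"
    by (intro emeasure_mono) auto
  then show "emeasure lborel (cell h x) \<le> ennreal (h ^ CARD('n))"
    using h by (simp add: emeasure_box_const)
  have "box (\<chi> i. ?u i) (\<chi> i. ?u i + h) \<subseteq> cell h x"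
    by (auto simp: eq mem_box_cart less_imp_le)
  then have "emeasure lborel (box (\<chi> i. ?u i) (\<chi> i. ?u i + h)) \<le> emeasure lborel (cell h x)"
    by (intro emeasure_mono) auto
  then show "ennreal (h ^ CARD('n)) \<le> emeasure lborel (cell h x)"
    using h by (simp add: emeasure_box_const)
qed

lemma emeasure_neighbours:
  assumes h: "0 < h"
  shows "emeasure lborel (neighbours h (x :: real^'n)) \<le> ennreal ((3 * h) ^ CARD('n))"
proof -
  let ?u = "\<lambda>i. h * (\<lfloor>x $ i / h\<rfloor> - 1)"
  have "y \<in> cbox (\<chi> i. ?u i) (\<chi> i. ?u i + 3 * h)" if "y \<in> neighbours h x" for y
    unfolding mem_box_cart
  proof
    fix i
    have "\<bar>\<lfloor>y $ i / h\<rfloor> - \<lfloor>x $ i / h\<rfloor>\<bar> \<le> 1"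
      using that by (auto simp: neighbours_def cell_index_def)
    then have "real_of_int \<lfloor>x $ i / h\<rfloor> - 1 \<le> y $ i / h" "y $ i / h \<le> real_of_int \<lfloor>x $ i / h\<rfloor> + 2"
      by linarith+
    then show "(\<chi> i. ?u i) $ i \<le> y $ i \<and> y $ i \<le> (\<chi> i. ?u i + 3 * h) $ i"
      using h by (simp add: field_simps)
  qed
  then have "emeasure lborel (neighbours h x) \<le> emeasure lborel (cbox (\<chi> i. ?u i) (\<chi> i. ?u i + 3 * h))"
    by (intro emeasure_mono) auto
  then show ?thesis using h by (simp add: emeasure_box_const)
qed

lemma dist_imp_neighbours:
  assumes h: "0 < h" and d: "dist x y < h"
  shows "y \<in> neighbours h (x :: real^'n)"
  unfolding neighbours_def cell_index_def mem_Collect_eq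
proof
  fix i
  have "\<bar>x $ i - y $ i\<bar> < h"
    using component_le_norm_cart[of "x - y" i] d by (simp add: dist_norm)
  then have "\<bar>x $ i / h - y $ i / h\<bar> < 1"
    using h by (simp add: field_simps abs_less_iff)
  then show "\<bar>\<lfloor>y $ i / h\<rfloor> - \<lfloor>x $ i / h\<rfloor>\<bar> \<le> 1" by linarith
qed

lemma neighbours_imp_dist:
  assumes h: "0 < h" and d: "y \<in> neighbours h (x :: real^'n)"
  shows "dist x y \<le> 2 * h * CARD('n)"
proof -
  have "\<bar>(x - y) $ i\<bar> \<le> 2 * h" for i
  proof -
    have "\<bar>\<lfloor>y $ i / h\<rfloor> - \<lfloor>x $ i / h\<rfloor>\<bar> \<le> 1"
      using d by (auto simp: neighbours_def cell_index_def)
    then have "\<bar>x $ i / h - y $ i / h\<bar> \<le> 2" by linarith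
    then show ?thesis using h by (simp add: field_simps abs_le_iff)
  qed
  then have "(\<Sum>i\<in>UNIV. \<bar>(x - y) $ i\<bar>) \<le> of_nat CARD('n) * (2 * h)"
    by (intro sum_bounded_above) auto
  then show ?thesis
    using norm_le_l1_cart[of "x - y"] by (simp add: dist_norm mult_ac)
qed

lemma cell_subset_neighbours: "cell h x \<subseteq> neighbours h x"
  by (auto simp: cell_def neighbours_def)

text \<open>Nesting of the grids: \<open>l / 2 ^ k\<close> is an integer multiple of
  \<open>l / 2 ^ j\<close>, so the coarser index is an integer quotient of the finer one.\<close>

lemma cell_index_coarser:
  assumes "k \<le> j"
  shows "cell_index (l / 2 ^ k) x i = cell_index (l / 2 ^ j) x i div 2 ^ (j - k)"
proof -
  have "(2::real) ^ j = 2 ^ k * 2 ^ (j - k)"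
    using assms by (simp flip: power_add)
  then have "x $ i / (l / 2 ^ k) = x $ i / (l / 2 ^ j) / real_of_int (2 ^ (j - k))"
    by simp
  then show ?thesis
    unfolding cell_index_def by (simp only: floor_divide_real_eq_div zero_le_power zero_le_numeral)
qed

lemma cell_index_eq_coarser:
  "k \<le> j \<Longrightarrow> cell_index (l / 2 ^ j) x = cell_index (l / 2 ^ j) y \<Longrightarrow>
    cell_index (l / 2 ^ k) x = cell_index (l / 2 ^ k) y"
  by (simp add: fun_eq_iff cell_index_coarser)

lemma neighbours_coarser:
  assumes "k \<le> j"
  shows "neighbours (l / 2 ^ j) x \<subseteq> neighbours (l / 2 ^ k) x"
proof -
  \<comment> \<open>From \<open>a \<le> b + 1 \<le> b + m\<close>: division by \<open>m\<close> is
    monotone, and adding \<open>m\<close> to the dividend raises the quotient by exactly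
    one.\<close>
  have div_near: "\<bar>a div m - b div m\<bar> \<le> 1" if "\<bar>a - b\<bar> \<le> 1" "0 < m" for a b m :: int
  proof -
    have "a div m \<le> (b + m) div m" "b div m \<le> (a + m) div m"
      using that by (intro zdiv_mono1; linarith)+
    then show ?thesis using that by simp
  qed
  show ?thesis
    using assms by (auto simp: neighbours_def cell_index_coarser div_near)
qed

text \<open>A conditional expectation argument: \<open>\<phi>\<close> is a countable combination of
  indicators of cells, so only the mean of \<open>f\<close> over each cell where
  \<open>\<phi>\<close> is nonzero enters. In the applications \<open>\<phi>\<close> carries the
  information of scale \<open>h\<close> and \<open>f\<close> that of finer scales.\<close>

lemma nn_integral_cellwise_le:
  fixes f \<phi> :: "real^'n \<Rightarrow> ennreal"
  assumes h: "0 < h" and [measurable]: "f \<in> borel_measurable borel"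
    and const: "\<And>x y. cell_index h x = cell_index h y \<Longrightarrow> \<phi> x = \<phi> y"
    and le: "\<And>x. \<phi> x \<noteq> 0 \<Longrightarrow> (\<integral>\<^sup>+y\<in>cell h x. f y \<partial>lborel) \<le> D * ennreal (h ^ CARD('n))"
  shows "(\<integral>\<^sup>+x. \<phi> x * f x \<partial>lborel) \<le> D * (\<integral>\<^sup>+x. \<phi> x \<partial>lborel)"
proof -
  define \<psi> where "\<psi> c = \<phi> (SOME x. cell_index h x = c)" for c
  have \<psi>: "\<phi> x = \<psi> (cell_index h x)" for x
    unfolding \<psi>_def by (rule const, rule someI2[where a=x]) auto
  define Z where "Z c = cell_index h -` {c}" for c :: "'n \<Rightarrow> int"
  have [measurable]: "Z c \<in> sets borel" for c
    using measurable_sets[OF measurable_cell_index, of "{c}" h] by (simp add: Z_def)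
  have split: "(\<integral>\<^sup>+x. \<phi> x * F x \<partial>lborel) =
      (\<integral>\<^sup>+c. \<psi> c * (\<integral>\<^sup>+x\<in>Z c. F x \<partial>lborel) \<partial>count_space UNIV)"
    if [measurable]: "F \<in> borel_measurable borel" for F
  proof -
    have "\<phi> x * F x = (\<integral>\<^sup>+c. \<psi> c * (F x * indicator (Z c) x) \<partial>count_space UNIV)" for x
      by (subst nn_integral_count_space'[where A="{cell_index h x}"]) (auto simp: Z_def \<psi>)
    then have "(\<integral>\<^sup>+x. \<phi> x * F x \<partial>lborel) =
        (\<integral>\<^sup>+x. \<integral>\<^sup>+c. \<psi> c * (F x * indicator (Z c) x) \<partial>count_space UNIV \<partial>lborel)" by simp
    also have "\<dots> = (\<integral>\<^sup>+c. \<integral>\<^sup>+x. \<psi> c * (F x * indicator (Z c) x) \<partial>lborel \<partial>count_space UNIV)"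
      by (rule nn_integral_count_space_nn_integral) auto
    also have "\<dots> = (\<integral>\<^sup>+c. \<psi> c * (\<integral>\<^sup>+x\<in>Z c. F x \<partial>lborel) \<partial>count_space UNIV)"
      by (simp add: nn_integral_cmult)
    finally show ?thesis .
  qed
  have "\<psi> c * (\<integral>\<^sup>+x\<in>Z c. f x \<partial>lborel) \<le> D * (\<psi> c * (\<integral>\<^sup>+x\<in>Z c. 1 \<partial>lborel))" for c
  proof (cases "Z c = {} \<or> \<psi> c = 0")
    case False
    then obtain x where x: "cell_index h x = c" by (auto simp: Z_def)
    then have Z: "Z c = cell h x" by (auto simp: Z_def cell_def)
    have "(\<integral>\<^sup>+x\<in>Z c. f x \<partial>lborel) \<le> D * (\<integral>\<^sup>+x\<in>Z c. 1 \<partial>lborel)"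
      using le[of x] False x by (simp add: \<psi> Z emeasure_cell[OF h])
    then show ?thesis by (subst mult.left_commute) (rule mult_left_mono, auto)
  qed auto
  then have "(\<integral>\<^sup>+c. \<psi> c * (\<integral>\<^sup>+x\<in>Z c. f x \<partial>lborel) \<partial>count_space UNIV) \<le>
      (\<integral>\<^sup>+c. D * (\<psi> c * (\<integral>\<^sup>+x\<in>Z c. 1 \<partial>lborel)) \<partial>count_space UNIV)"
    by (intro nn_integral_mono)
  also have "\<dots> = D * (\<integral>\<^sup>+c. \<psi> c * (\<integral>\<^sup>+x\<in>Z c. 1 \<partial>lborel) \<partial>count_space UNIV)"
    by (rule nn_integral_cmult) simp
  also have "(\<integral>\<^sup>+c. \<psi> c * (\<integral>\<^sup>+x\<in>Z c. 1 \<partial>lborel) \<partial>count_space UNIV) = (\<integral>\<^sup>+x. \<phi> x \<partial>lborel)"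
    using split[of "\<lambda>_. 1"] by simp
  finally show ?thesis by (simp add: split)
qed

section \<open>Dyadic averages and the moments of their capped sums\<close>

definition dyadic_term :: "real \<Rightarrow> (real^'n \<Rightarrow> ennreal) \<Rightarrow> real \<Rightarrow> real^'n \<Rightarrow> ennreal" where
  "dyadic_term \<gamma> g h x = ennreal (h powr (\<gamma> - CARD('n))) * (\<integral>\<^sup>+y\<in>neighbours h x. g y \<partial>lborel)"

text \<open>The cap is imposed at all scales up to \<open>j\<close>, not only at \<open>j\<close>:
  the term dies as soon as any coarser average exceeds \<open>t\<close>. A nonzero capped term
  therefore certifies the bound \<open>t\<close> on every coarser cell containing the point.\<close>

definition capped_term ::
  "real \<Rightarrow> (real^'n \<Rightarrow> ennreal) \<Rightarrow> real \<Rightarrow> ennreal \<Rightarrow> nat \<Rightarrow> real^'n \<Rightarrow> ennreal" where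
  "capped_term \<gamma> g l t j x =
     (if \<forall>i\<le>j. dyadic_term \<gamma> g (l / 2 ^ i) x \<le> t then dyadic_term \<gamma> g (l / 2 ^ j) x else 0)"

lemma dyadic_term_cong:
  "cell_index h x = cell_index h y \<Longrightarrow> dyadic_term \<gamma> g h x = dyadic_term \<gamma> g h y"
  using neighbours_cong[of h x y] by (simp add: dyadic_term_def)

lemma dyadic_term_cong_coarser:
  "i \<le> j \<Longrightarrow> cell_index (l / 2 ^ j) x = cell_index (l / 2 ^ j) y \<Longrightarrow>
    dyadic_term \<gamma> g (l / 2 ^ i) x = dyadic_term \<gamma> g (l / 2 ^ i) y"
  by (rule dyadic_term_cong, rule cell_index_eq_coarser)

lemma capped_term_cong:
  assumes "cell_index (l / 2 ^ j) x = cell_index (l / 2 ^ j) y"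
  shows "capped_term \<gamma> g l t j x = capped_term \<gamma> g l t j y"
proof -
  have "dyadic_term \<gamma> g (l / 2 ^ i) x = dyadic_term \<gamma> g (l / 2 ^ i) y" if "i \<le> j" for i
    using dyadic_term_cong_coarser[OF that assms] .
  then show ?thesis by (auto simp: capped_term_def)
qed

lemma measurable_dyadic_term [measurable]: "dyadic_term \<gamma> g h \<in> borel_measurable borel"
  by (rule cell_fun_measurable) (erule dyadic_term_cong, simp)

lemma measurable_capped_term [measurable]: "capped_term \<gamma> g l t j \<in> borel_measurable borel"
  by (rule cell_fun_measurable) (erule capped_term_cong, simp)

text \<open>By Tonelli's theorem each \<open>z\<close> is seen from a set of points \<open>y\<close>
  of volume at most \<open>(3 * hj) ^ CARD('n)\<close>, which turns
  \<open>hj powr (\<gamma> - CARD('n))\<close> into a multiple of \<open>hj powr \<gamma>\<close>;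
  hence the geometric decay in \<open>j - k\<close>. All the mass of \<open>g\<close> that is seen
  lies in the neighbours of the coarse cell.\<close>

lemma nn_integral_dyadic_term_le:
  fixes g :: "real^'n \<Rightarrow> ennreal"
  assumes l: "0 < l" and kj: "k \<le> j" and [measurable]: "g \<in> borel_measurable borel"
  shows "(\<integral>\<^sup>+y\<in>cell (l / 2 ^ k) x. dyadic_term \<gamma> g (l / 2 ^ j) y \<partial>lborel) \<le>
    ennreal (3 ^ CARD('n) * (2 powr - \<gamma>) ^ (j - k)) *
      (dyadic_term \<gamma> g (l / 2 ^ k) x * ennreal ((l / 2 ^ k) ^ CARD('n)))"
proof -
  define hj where "hj = l / 2 ^ j"
  define hk where "hk = l / 2 ^ k"
  have hpos: "0 < hj" "0 < hk" using l by (auto simp: hj_def hk_def)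
  have hjk: "hj = hk * (1/2) ^ (j - k)"
    using kj by (simp add: hj_def hk_def field_simps flip: power_add)
  note [measurable] = neighbours_pred_measurable[of hj]
  have [measurable]: "Measurable.pred (borel \<Otimes>\<^sub>M borel) (\<lambda>z. snd z \<in> neighbours hj (fst z))"
    using neighbours_pred_measurable[of hj] by (simp add: case_prod_beta')
  let ?c = "ennreal (hj powr (\<gamma> - CARD('n)))"
  have "(\<integral>\<^sup>+y\<in>cell hk x. dyadic_term \<gamma> g hj y \<partial>lborel) =
    (\<integral>\<^sup>+y. \<integral>\<^sup>+z. ?c * indicator (cell hk x) y * (g z * indicator (neighbours hj y) z) \<partial>lborel \<partial>lborel)"
    unfolding dyadic_term_def
    by (intro nn_integral_cong, subst nn_integral_cmult) (auto simp: mult_ac)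
  also have "\<dots> =
    (\<integral>\<^sup>+z. \<integral>\<^sup>+y. ?c * indicator (cell hk x) y * (g z * indicator (neighbours hj y) z) \<partial>lborel \<partial>lborel)"
    unfolding indicator_def by (rule lborel_pair.Fubini') measurable
  also have "\<dots> \<le> (\<integral>\<^sup>+z. ?c * (g z * indicator (neighbours hk x) z) * ennreal ((3 * hj) ^ CARD('n)) \<partial>lborel)"
  proof (rule nn_integral_mono)
    fix z :: "real^'n"
    have "?c * indicator (cell hk x) y * (g z * indicator (neighbours hj y) z) \<le>
        ?c * (g z * indicator (neighbours hk x) z) * indicator (neighbours hj z) y" for y
    proof (cases "y \<in> cell hk x \<and> z \<in> neighbours hj y")
      case True
      then have "z \<in> neighbours hk y"
        using neighbours_coarser[OF kj, of l y] by (auto simp: hj_def hk_def)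
      then have "z \<in> neighbours hk x"
        using True neighbours_cong[of hk x y] by (simp add: cell_def)
      then show ?thesis using True neighbours_sym[of z hj y] by simp
    next
      case False
      then show ?thesis by auto
    qed
    then have "(\<integral>\<^sup>+y. ?c * indicator (cell hk x) y * (g z * indicator (neighbours hj y) z) \<partial>lborel) \<le>
      (\<integral>\<^sup>+y. ?c * (g z * indicator (neighbours hk x) z) * indicator (neighbours hj z) y \<partial>lborel)"
      by (intro nn_integral_mono)
    also have "\<dots> = ?c * (g z * indicator (neighbours hk x) z) * emeasure lborel (neighbours hj z)"
      by (subst nn_integral_cmult) auto
    also have "\<dots> \<le> ?c * (g z * indicator (neighbours hk x) z) * ennreal ((3 * hj) ^ CARD('n))"
      by (intro mult_left_mono emeasure_neighbours hpos) auto
    finally show "(\<integral>\<^sup>+y. ?c * indicator (cell hk x) y * (g z * indicator (neighbours hj y) z) \<partial>lborel) \<le>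
      ?c * (g z * indicator (neighbours hk x) z) * ennreal ((3 * hj) ^ CARD('n))" .
  qed
  also have "\<dots> = (\<integral>\<^sup>+z. (?c * ennreal ((3 * hj) ^ CARD('n))) * (g z * indicator (neighbours hk x) z) \<partial>lborel)"
    by (simp add: mult_ac)
  also have "\<dots> = (?c * ennreal ((3 * hj) ^ CARD('n))) * (\<integral>\<^sup>+z\<in>neighbours hk x. g z \<partial>lborel)"
    by (rule nn_integral_cmult) simp
  also have "?c * ennreal ((3 * hj) ^ CARD('n)) =
    ennreal (3 ^ CARD('n) * (2 powr - \<gamma>) ^ (j - k)) * (ennreal (hk powr (\<gamma> - CARD('n))) * ennreal (hk ^ CARD('n)))"
  proof -
    have eq: "h powr (\<gamma> - CARD('n)) * h ^ CARD('n) = h powr \<gamma>" if "0 < h" for h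
      using that by (simp add: powr_diff powr_realpow)
    have "(1/2) ^ (j - k) = (2::real) powr - real (j - k)"
      by (simp add: powr_minus powr_realpow power_one_over field_simps)
    then have "hj powr \<gamma> = hk powr \<gamma> * (2 powr - \<gamma>) ^ (j - k)"
      using hpos by (simp add: hjk powr_mult powr_powr mult_ac flip: powr_realpow)
    then have "hj powr (\<gamma> - CARD('n)) * (3 * hj) ^ CARD('n) =
      (3 ^ CARD('n) * (2 powr - \<gamma>) ^ (j - k)) * (hk powr (\<gamma> - CARD('n)) * hk ^ CARD('n))"
      using eq[OF hpos(1)] eq[OF hpos(2)] by (simp add: power_mult_distrib mult_ac)
    then show ?thesis using hpos by (simp add: ennreal_mult[symmetric])
  qed
  also have "ennreal (3 ^ CARD('n) * (2 powr - \<gamma>) ^ (j - k)) * (ennreal (hk powr (\<gamma> - CARD('n))) * ennreal (hk ^ CARD('n))) *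
      (\<integral>\<^sup>+z\<in>neighbours hk x. g z \<partial>lborel) =
    ennreal (3 ^ CARD('n) * (2 powr - \<gamma>) ^ (j - k)) * (dyadic_term \<gamma> g hk x * ennreal (hk ^ CARD('n)))"
    by (simp only: dyadic_term_def mult_ac)
  finally show ?thesis unfolding hj_def hk_def .
qed

text \<open>\<open>3 ^ n\<close> bounds the overlap of the neighbourhoods; the other factor sums the
  geometric series of ratio \<open>2 powr - \<gamma>\<close> over the scales.\<close>

definition moment_const :: "real \<Rightarrow> nat \<Rightarrow> real" where
  "moment_const \<gamma> n = 3 ^ n / (1 - 2 powr - \<gamma>)"

text \<open>A dichotomy on the cell, where the terms of scales up to \<open>k\<close> are constant:
  if one of them exceeds \<open>t\<close>, all the capped terms in the sum vanish there; otherwise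
  the term of scale \<open>k\<close> is at most \<open>t\<close>, and the finer ones decay
  geometrically from it.\<close>

lemma nn_integral_sum_capped_term_le:
  fixes g :: "real^'n \<Rightarrow> ennreal"
  assumes l: "0 < l" and \<gamma>: "0 < \<gamma>" and [measurable]: "g \<in> borel_measurable borel"
  shows "(\<integral>\<^sup>+y\<in>cell (l / 2 ^ k) x. (\<Sum>j=k..N. capped_term \<gamma> g l t j y) \<partial>lborel) \<le>
    ennreal (moment_const \<gamma> CARD('n)) * t * ennreal ((l / 2 ^ k) ^ CARD('n))"
proof (cases "\<forall>i\<le>k. dyadic_term \<gamma> g (l / 2 ^ i) x \<le> t")
  case False
  have "capped_term \<gamma> g l t j y * indicator (cell (l / 2 ^ k) x) y = 0" if kj: "k \<le> j" for y j
  proof (cases "y \<in> cell (l / 2 ^ k) x")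
    case True
    then have "dyadic_term \<gamma> g (l / 2 ^ i) y = dyadic_term \<gamma> g (l / 2 ^ i) x" if "i \<le> k" for i
      using that by (intro dyadic_term_cong_coarser[of i k]) (auto simp: cell_def)
    with False kj have "\<exists>i\<le>j. \<not> dyadic_term \<gamma> g (l / 2 ^ i) y \<le> t" by (metis le_trans)
    then show ?thesis by (auto simp: capped_term_def)
  qed simp
  then have zero: "(\<Sum>j=k..N. capped_term \<gamma> g l t j y) * indicator (cell (l / 2 ^ k) x) y = 0" for y
    unfolding sum_distrib_right by (intro sum.neutral) auto
  show ?thesis unfolding zero by simp
next
  case True
  define q where "q = (2::real) powr - \<gamma>"
  have q: "0 < q" "q < 1" using \<gamma> by (auto simp: q_def powr_less_one)
  let ?V = "dyadic_term \<gamma> g (l / 2 ^ k) x * ennreal ((l / 2 ^ k) ^ CARD('n))"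
  have "(\<integral>\<^sup>+y\<in>cell (l / 2 ^ k) x. (\<Sum>j=k..N. capped_term \<gamma> g l t j y) \<partial>lborel) =
    (\<Sum>j=k..N. \<integral>\<^sup>+y\<in>cell (l / 2 ^ k) x. capped_term \<gamma> g l t j y \<partial>lborel)"
    unfolding sum_distrib_right by (rule nn_integral_sum) simp
  also have "\<dots> \<le> (\<Sum>j=k..N. \<integral>\<^sup>+y\<in>cell (l / 2 ^ k) x. dyadic_term \<gamma> g (l / 2 ^ j) y \<partial>lborel)"
    by (intro sum_mono nn_integral_mono mult_right_mono) (auto simp: capped_term_def)
  also have "\<dots> \<le> (\<Sum>j=k..N. ennreal (3 ^ CARD('n) * q ^ (j - k)) * ?V)"
    unfolding q_def by (intro sum_mono nn_integral_dyadic_term_le l) auto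
  also have "\<dots> = ennreal (\<Sum>j=k..N. 3 ^ CARD('n) * q ^ (j - k)) * ?V"
    unfolding sum_distrib_right[symmetric] using q by (subst sum_ennreal) auto
  also have "\<dots> \<le> ennreal (moment_const \<gamma> CARD('n)) * ?V"
  proof (intro mult_right_mono ennreal_leI)
    have "(\<Sum>j=k..N. q ^ (j - k)) = sum ((^) q) ((\<lambda>j. j - k) ` {k..N})"
      by (subst sum.reindex) (auto simp: inj_on_def)
    also have "\<dots> \<le> (\<Sum>i. q ^ i)"
      using q by (intro sum_le_suminf summable_geometric) auto
    also have "\<dots> = 1 / (1 - q)" using q by (intro suminf_geometric) auto
    finally have "3 ^ CARD('n) * (\<Sum>j=k..N. q ^ (j - k)) \<le> 3 ^ CARD('n) * (1 / (1 - q))"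
      by (intro mult_left_mono) auto
    then show "(\<Sum>j=k..N. 3 ^ CARD('n) * q ^ (j - k)) \<le> moment_const \<gamma> CARD('n)"
      by (simp add: moment_const_def q_def sum_distrib_left)
    show "0 \<le> ?V" by (rule zero_le)
  qed
  also have "\<dots> \<le> ennreal (moment_const \<gamma> CARD('n)) * (t * ennreal ((l / 2 ^ k) ^ CARD('n)))"
    using True by (intro mult_left_mono mult_right_mono) auto
  finally show ?thesis by (simp add: mult_ac)
qed

text \<open>Discrete form of integrating the derivative of the \<open>Suc q\<close>-th power of the
  tail sum. The tail from \<open>j\<close> on involves only scales at least as fine as
  \<open>j\<close>, so a bound for its moment of order \<open>q\<close> can be inserted cell by cell
  at scale \<open>j\<close>.\<close>

lemma sum_power_Suc_le:
  fixes f :: "nat \<Rightarrow> ennreal"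
  shows "(\<Sum>j=k..N. f j) ^ Suc q \<le> of_nat (Suc q) * (\<Sum>j=k..N. f j * (\<Sum>i=j..N. f i) ^ q)"
proof -
  \<comment> \<open>The mean value inequality for powers, written without subtraction because the
    values may be infinite.\<close>
  have step: "(a + s) ^ Suc m \<le> s ^ Suc m + of_nat (Suc m) * (a * (a + s) ^ m)" for a s :: ennreal and m
  proof (induction m)
    case 0
    show ?case by (simp add: add.commute)
  next
    case (Suc m)
    have "(a + s) ^ Suc (Suc m) = a * (a + s) ^ Suc m + s * (a + s) ^ Suc m"
      by (subst power_Suc) (rule distrib_right)
    also have "\<dots> \<le> a * (a + s) ^ Suc m + s * (s ^ Suc m + of_nat (Suc m) * (a * (a + s) ^ m))"
      by (intro add_left_mono mult_left_mono Suc.IH) simp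
    also have "\<dots> = a * (a + s) ^ Suc m + s ^ Suc (Suc m) + of_nat (Suc m) * (a * (s * (a + s) ^ m))"
      by (simp add: algebra_simps)
    also have "\<dots> \<le> a * (a + s) ^ Suc m + s ^ Suc (Suc m) + of_nat (Suc m) * (a * ((a + s) * (a + s) ^ m))"
      by (intro add_left_mono mult_left_mono mult_right_mono) auto
    also have "\<dots> = s ^ Suc (Suc m) + of_nat (Suc (Suc m)) * (a * (a + s) ^ Suc m)"
      by (simp add: algebra_simps)
    finally show ?case .
  qed
  show ?thesis
  proof (induction "Suc N - k" arbitrary: k)
    case 0
    then show ?case by simp
  next
    case (Suc d)
    then have kN: "k \<le> N" and d: "d = Suc N - Suc k" by auto
    have split: "(\<Sum>j=k..N. F j) = F k + (\<Sum>j=Suc k..N. F j)" for F :: "nat \<Rightarrow> ennreal"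
      using kN by (rule sum.atLeast_Suc_atMost)
    have "(\<Sum>j=k..N. f j) ^ Suc q \<le>
      (\<Sum>j=Suc k..N. f j) ^ Suc q + of_nat (Suc q) * (f k * (\<Sum>i=k..N. f i) ^ q)"
      unfolding split[of f] by (rule step)
    also have "\<dots> \<le> of_nat (Suc q) * (\<Sum>j=Suc k..N. f j * (\<Sum>i=j..N. f i) ^ q) +
        of_nat (Suc q) * (f k * (\<Sum>i=k..N. f i) ^ q)"
      by (intro add_right_mono Suc.hyps(1) d)
    also have "\<dots> = of_nat (Suc q) * (\<Sum>j=k..N. f j * (\<Sum>i=j..N. f i) ^ q)"
      unfolding split[of "\<lambda>j. f j * (\<Sum>i=j..N. f i) ^ q"] by (simp only: distrib_left add.commute)
    finally show ?case .
  qed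
qed

text \<open>The capped terms see a measure satisfying a Morrey condition, whose potential has moments
  of all orders.\<close>

lemma nn_integral_capped_moment_le:
  fixes g :: "real^'n \<Rightarrow> ennreal"
  assumes l: "0 < l" and \<gamma>: "0 < \<gamma>" and [measurable]: "g \<in> borel_measurable borel"
  shows "(\<integral>\<^sup>+y\<in>cell (l / 2 ^ k) x. (\<Sum>j=k..N. capped_term \<gamma> g l t j y) ^ q \<partial>lborel) \<le>
    (fact q * ennreal (moment_const \<gamma> CARD('n)) ^ q * t ^ q) * ennreal ((l / 2 ^ k) ^ CARD('n))"
proof (induction q arbitrary: k x)
  case 0
  show ?case using emeasure_cell[of "l / 2 ^ k" x] l by simp
next
  case (Suc q)
  let ?S = "\<lambda>j y. \<Sum>i=j..N. capped_term \<gamma> g l t i y"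
  let ?K = "ennreal (moment_const \<gamma> CARD('n))"
  let ?D = "fact q * ?K ^ q * t ^ q"
  have "(\<integral>\<^sup>+y\<in>cell (l / 2 ^ k) x. ?S k y ^ Suc q \<partial>lborel) \<le>
    (\<integral>\<^sup>+y. of_nat (Suc q) * (\<Sum>j=k..N. capped_term \<gamma> g l t j y * indicator (cell (l / 2 ^ k) x) y * ?S j y ^ q) \<partial>lborel)"
  proof (intro nn_integral_mono)
    fix y
    show "?S k y ^ Suc q * indicator (cell (l / 2 ^ k) x) y \<le>
      of_nat (Suc q) * (\<Sum>j=k..N. capped_term \<gamma> g l t j y * indicator (cell (l / 2 ^ k) x) y * ?S j y ^ q)"
      using sum_power_Suc_le[of "\<lambda>j. capped_term \<gamma> g l t j y" k N q]
      by (cases "y \<in> cell (l / 2 ^ k) x") (simp_all del: power_Suc)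
  qed
  also have "\<dots> = of_nat (Suc q) * (\<Sum>j=k..N.
      \<integral>\<^sup>+y. (capped_term \<gamma> g l t j y * indicator (cell (l / 2 ^ k) x) y) * ?S j y ^ q \<partial>lborel)"
    by (subst nn_integral_cmult, simp, subst nn_integral_sum) auto
  also have "\<dots> \<le> of_nat (Suc q) * (\<Sum>j=k..N.
      ?D * (\<integral>\<^sup>+y. capped_term \<gamma> g l t j y * indicator (cell (l / 2 ^ k) x) y \<partial>lborel))"
  proof (intro mult_left_mono sum_mono)
    \<comment> \<open>The capped term of scale \<open>j\<close> is constant on the cells of that
      scale, and the induction hypothesis bounds the mean of \<open>?S j y ^ q\<close> over each of
      them by \<open>?D\<close>. So the factor \<open>?S j y ^ q\<close> may be replaced by
      \<open>?D\<close>, and a first moment remains.\<close>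
    fix j assume j: "j \<in> {k..N}"
    show "(\<integral>\<^sup>+y. (capped_term \<gamma> g l t j y * indicator (cell (l / 2 ^ k) x) y) * ?S j y ^ q \<partial>lborel) \<le>
      ?D * (\<integral>\<^sup>+y. capped_term \<gamma> g l t j y * indicator (cell (l / 2 ^ k) x) y \<partial>lborel)"
    proof (rule nn_integral_cellwise_le[of "l / 2 ^ j"])
      fix y z :: "real^'n" assume yz: "cell_index (l / 2 ^ j) y = cell_index (l / 2 ^ j) z"
      then have "cell_index (l / 2 ^ k) y = cell_index (l / 2 ^ k) z"
        using j by (intro cell_index_eq_coarser[of k j]) auto
      then show "capped_term \<gamma> g l t j y * indicator (cell (l / 2 ^ k) x) y =
        capped_term \<gamma> g l t j z * indicator (cell (l / 2 ^ k) x) z"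
        using capped_term_cong[OF yz, of \<gamma> g t] by (simp add: indicator_def cell_def)
    next
      show "(\<integral>\<^sup>+z\<in>cell (l / 2 ^ j) y. ?S j z ^ q \<partial>lborel) \<le> ?D * ennreal ((l / 2 ^ j) ^ CARD('n))" for y
        by (rule Suc.IH)
      show "(\<lambda>y. ?S j y ^ q) \<in> borel_measurable borel" by measurable
      show "0 < l / 2 ^ j" using l by simp
    qed
  qed (rule zero_le)
  also have "\<dots> = of_nat (Suc q) * ?D * (\<integral>\<^sup>+y\<in>cell (l / 2 ^ k) x. ?S k y \<partial>lborel)"
    unfolding sum_distrib_right
    by (subst nn_integral_sum, simp) (simp only: sum_distrib_left mult.assoc)
  also have "\<dots> \<le> of_nat (Suc q) * ?D * (?K * t * ennreal ((l / 2 ^ k) ^ CARD('n)))"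
    by (intro mult_left_mono nn_integral_sum_capped_term_le l \<gamma>) auto
  also have "\<dots> = (fact (Suc q) * ?K ^ Suc q * t ^ Suc q) * ennreal ((l / 2 ^ k) ^ CARD('n))"
    by (simp add: mult_ac)
  finally show ?case .
qed

section \<open>The two-weight weak type inequality\<close>

lemma locally_integrable_measurable:
  fixes f :: "real^'n \<Rightarrow> 'b::{banach, second_countable_topology}"
  assumes "locally_integrable f"
  shows "f \<in> borel_measurable lebesgue"
proof (rule borel_measurable_LIMSEQ_metric)
  show "(\<lambda>x. indicator (cball 0 (real n)) x *\<^sub>R f x) \<in> borel_measurable lebesgue" for n
    using assms compact_cball unfolding locally_integrable_def set_integrable_def
    by (blast intro: borel_measurable_integrable)
  fix x :: "real^'n"
  obtain N :: nat where N: "norm x \<le> real N" using real_arch_simple by blast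
  have "eventually (\<lambda>n. indicator (cball 0 (real n)) x *\<^sub>R f x = f x) sequentially"
    using eventually_ge_at_top[of N] by eventually_elim (use N in \<open>auto simp: indicator_def\<close>)
  then show "(\<lambda>n. indicator (cball 0 (real n)) x *\<^sub>R f x) \<longlonglongrightarrow> f x"
    by (rule tendsto_eventually)
qed

lemma weight_measurable: "weight w \<Longrightarrow> w \<in> borel_measurable lebesgue"
  by (simp add: weight_def locally_integrable_measurable)

lemma emeasure_lborel_cube:
  fixes y :: "real^'n"
  assumes "0 \<le> l"
  shows "emeasure lborel (cube y l) = ennreal (l ^ CARD('n))"
proof -
  have "cube y l = cbox (\<chi> i. y $ i - l / 2) (\<chi> i. (y $ i - l / 2) + l)"
    by (simp add: cube_def add.commute)
  then show ?thesis using emeasure_box_const(2)[OF assms, of "\<lambda>i. y $ i - l / 2"] by simp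
qed

lemma sets_cube [measurable]: "cube y l \<in> sets borel"
  by (simp add: cube_def)

lemma sets_lebesgue_cube [measurable]: "cube y l \<in> sets lebesgue"
  by (simp add: cube_def)

lemma emeasure_lebesgue_cube:
  fixes y :: "real^'n"
  shows "0 \<le> l \<Longrightarrow> emeasure lebesgue (cube y l) = ennreal (l ^ CARD('n))"
  by (simp add: emeasure_lborel_cube)

lemma measure_lebesgue_cube:
  fixes y :: "real^'n"
  shows "0 \<le> l \<Longrightarrow> measure lebesgue (cube y l) = l ^ CARD('n)"
  using emeasure_lebesgue_cube[of l y] by (simp add: measure_def)

lemma cball_subset_cube: "2 * d \<le> l \<Longrightarrow> cball y d \<subseteq> cube (y :: real^'n) l"
proof
  fix x assume l: "2 * d \<le> l" and x: "x \<in> cball y d"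
  have "y $ i - l / 2 \<le> x $ i \<and> x $ i \<le> y $ i + l / 2" for i
  proof -
    have "\<bar>y $ i - x $ i\<bar> \<le> l / 2"
      using component_le_norm_cart[of "y - x" i] x l by (simp add: dist_norm)
    then show ?thesis by linarith
  qed
  then show "x \<in> cube y l"
    by (simp add: cube_def mem_box_cart)
qed

lemma enn_powr_indicator_mult:
  "0 < p \<Longrightarrow> enn_powr (c * indicator A x) p = enn_powr c p * indicator A x"
  by (cases "x \<in> A") auto

section \<open>Local estimates from the bump condition\<close>

locale bump_pair =
  fixes \<gamma> p r C\<^sub>0 :: real and w \<nu> :: "real^'n \<Rightarrow> real"
  assumes \<gamma>: "0 < \<gamma>" "\<gamma> < CARD('n)" and p: "1 < p" and r: "1 < r"
    and w: "weight w" and \<nu>: "weight \<nu>" and bump: "bump_condition \<gamma> p r C\<^sub>0 w \<nu>"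
begin

lemmas weights_measurable = weight_measurable[OF w] weight_measurable[OF \<nu>]

abbreviation W :: "(real^'n) set \<Rightarrow> ennreal" where "W A \<equiv> emeasure (wmeasure w) A"

definition energy :: "(real^'n \<Rightarrow> ennreal) \<Rightarrow> (real^'n) set \<Rightarrow> ennreal" where
  "energy g A = (\<integral>\<^sup>+x\<in>A. enn_powr (g x) p * ennreal (\<nu> x) \<partial>lebesgue)"

definition bump_integral :: "real^'n \<Rightarrow> real \<Rightarrow> ennreal" where
  "bump_integral y l = (\<integral>\<^sup>+x\<in>cube y l. enn_powr (ennreal (w x)) r \<partial>lebesgue)"

text \<open>The bump condition with all powers of the side length collected, followed by Hoelder's
  inequality for \<open>g * \<nu> powr (1 / p)\<close> against \<open>\<nu> powr - (1 / p)\<close>.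
  The factor \<open>bump_integral\<close> stays on the left, where it will meet the same factor from
  \<open>wmeasure_le_bump_integral\<close>.\<close>

lemma bump_local:
  assumes l: "0 < l"
    and B: "B \<subseteq> cube y l" and [measurable]: "B \<in> sets lebesgue" "g \<in> borel_measurable lebesgue"
  shows "enn_powr (bump_integral y l) (1 / (r * p)) * (\<integral>\<^sup>+x\<in>B. g x \<partial>lebesgue) \<le>
    ennreal C\<^sub>0 * ennreal (l powr (CARD('n) / (r * p) + CARD('n) * (p - 1) / p - \<gamma>)) *
      enn_powr (energy g B) (1 / p)"
proof -
  note [measurable] = weights_measurable
  define p' where "p' = p / (p - 1)"
  define I where "I = bump_integral y l"
  define S where "S = (\<integral>\<^sup>+x\<in>cube y l. enn_powr (ennreal (\<nu> x)) (- p' / p) \<partial>lebesgue)"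
  define G where "G = energy g B"
  define a where "a = 1 / (r * p)"
  define b where "b = 1 / p'"
  define n where "n = real CARD('n)"
  define V where "V = l ^ CARD('n)"
  have p': "0 < p'" "1 / p + 1 / p' = 1" "- p' / p = - (1 / p) * p'"
    using p by (auto simp: p'_def field_simps)
  have ab: "0 < a" "0 < b" "b = (p - 1) / p" using p r p' by (auto simp: a_def b_def p'_def)
  have V: "0 < V" "V = l powr n" using l by (auto simp: V_def n_def powr_realpow)
  have npos: "0 < n" by (simp add: n_def)
  have avg: "enn_powr (Z / emeasure lebesgue (cube y l)) e = enn_powr Z e * ennreal (l powr (- n * e))"
    if "0 < e" for Z e
  proof -
    have "Z / emeasure lebesgue (cube y l) = Z * ennreal (l powr - n)"
      using l V emeasure_lborel_cube[of l y]
      by (simp add: divide_ennreal_def inverse_ennreal V_def[symmetric] powr_minus)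
    then show ?thesis
      using that l by (simp add: enn_powr_mult enn_powr_pos powr_powr)
  qed
  have "ennreal (V powr (\<gamma> / n)) * enn_powr (I / emeasure lebesgue (cube y l)) a
      * enn_powr (S / emeasure lebesgue (cube y l)) b \<le> ennreal C\<^sub>0"
  proof -
    have "\<forall>y l. 0 < l \<longrightarrow> ennreal (measure lebesgue (cube y l) powr (\<gamma> / n)) *
        enn_powr (avg (cube y l) (\<lambda>x. enn_powr (ennreal (w x)) r)) a *
        enn_powr (avg (cube y l) (\<lambda>x. enn_powr (ennreal (\<nu> x)) (- p' / p))) b \<le> ennreal C\<^sub>0"
      using bump unfolding bump_condition_def Let_def a_def b_def n_def p'_def by simp
    then have "ennreal (measure lebesgue (cube y l) powr (\<gamma> / n)) *
        enn_powr (avg (cube y l) (\<lambda>x. enn_powr (ennreal (w x)) r)) a *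
        enn_powr (avg (cube y l) (\<lambda>x. enn_powr (ennreal (\<nu> x)) (- p' / p))) b \<le> ennreal C\<^sub>0"
      using l by blast
    then show ?thesis
      unfolding measure_lebesgue_cube[OF less_imp_le[OF l]] avg_def I_def bump_integral_def S_def V_def .
  qed
  then have "ennreal (V powr (\<gamma> / n)) * (enn_powr I a * ennreal (l powr (- n * a)))
      * (enn_powr S b * ennreal (l powr (- n * b))) \<le> ennreal C\<^sub>0"
    unfolding avg[OF ab(1)] avg[OF ab(2)] .
  also have "ennreal (V powr (\<gamma> / n)) * (enn_powr I a * ennreal (l powr (- n * a)))
      * (enn_powr S b * ennreal (l powr (- n * b))) =
    (enn_powr I a * enn_powr S b) * (ennreal (V powr (\<gamma> / n)) * (ennreal (l powr (- n * a)) * ennreal (l powr (- n * b))))"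
    by (simp only: mult_ac)
  also have "ennreal (V powr (\<gamma> / n)) * (ennreal (l powr (- n * a)) * ennreal (l powr (- n * b))) =
     ennreal (l powr (\<gamma> - n * a - n * b))"
  proof -
    have "V powr (\<gamma> / n) = l powr \<gamma>" using npos by (simp add: V powr_powr)
    then show ?thesis using l by (simp add: ennreal_mult[symmetric] powr_add[symmetric] algebra_simps)
  qed
  finally have "ennreal (l powr (n * a + n * b - \<gamma>)) * ((enn_powr I a * enn_powr S b) * ennreal (l powr (\<gamma> - n * a - n * b)))
     \<le> ennreal (l powr (n * a + n * b - \<gamma>)) * ennreal C\<^sub>0"
    by (rule mult_left_mono) simp
  moreover have "ennreal (l powr (n * a + n * b - \<gamma>)) * ennreal (l powr (\<gamma> - n * a - n * b)) = 1"
    using l by (simp add: ennreal_mult[symmetric] powr_add[symmetric])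
  moreover have "ennreal (l powr (n * a + n * b - \<gamma>)) * ((enn_powr I a * enn_powr S b) * ennreal (l powr (\<gamma> - n * a - n * b))) =
      (enn_powr I a * enn_powr S b) * (ennreal (l powr (n * a + n * b - \<gamma>)) * ennreal (l powr (\<gamma> - n * a - n * b)))"
    by (simp only: mult_ac)
  ultimately have IS: "enn_powr I a * enn_powr S b \<le> ennreal C\<^sub>0 * ennreal (l powr (n * a + n * b - \<gamma>))"
    by (simp only: mult_1_right mult.commute[of "ennreal C\<^sub>0"])
  have "enn_powr I a * (\<integral>\<^sup>+x\<in>B. g x \<partial>lebesgue) \<le>
    ennreal C\<^sub>0 * ennreal (l powr (n * a + n * b - \<gamma>)) * enn_powr G (1 / p)"
  \<comment> \<open>If \<open>I = 0\<close> the left side is \<open>0\<close>. Otherwise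
    \<open>IS\<close> forces \<open>S\<close> to be finite, hence \<open>\<nu>\<close> to be
    positive almost everywhere on the cube, and only then is \<open>g\<close> the product of the two
    factors fed into Hoelder's inequality.\<close>
  proof (cases "I = 0")
    case True
    then show ?thesis using ab by simp
  next
    case False
    have "S \<noteq> \<infinity>"
    proof
      assume "S = \<infinity>"
      then have "enn_powr I a * enn_powr S b = \<infinity>"
        using False ab(1,2) by (simp add: ennreal_mult_top enn_powr_eq_0_iff)
      with IS show False by (simp add: ennreal_mult[symmetric] top_unique ennreal_mult_eq_top_iff)
    qed
    then have "AE x in lebesgue. enn_powr (ennreal (\<nu> x)) (- p' / p) * indicator (cube y l) x \<noteq> \<infinity>"
      unfolding S_def by (intro nn_integral_PInf_AE) measurable
    then have pos: "AE x in lebesgue. x \<in> B \<longrightarrow> \<nu> x \<noteq> 0"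
    proof eventually_elim
      case (elim x)
      have "- p' / p < 0" using p p' by simp
      then have "enn_powr 0 (- p' / p) = \<infinity>" by (simp only: enn_powr_def) auto
      then show ?case using elim B by (auto simp del: minus_divide_left)
    qed
    have "(\<integral>\<^sup>+x\<in>B. g x \<partial>lebesgue) =
      (\<integral>\<^sup>+x. (g x * enn_powr (ennreal (\<nu> x)) (1 / p) * indicator B x) *
        (enn_powr (ennreal (\<nu> x)) (- (1 / p)) * indicator B x) \<partial>lebesgue)"
    proof (rule nn_integral_cong_AE)
      show "AE x in lebesgue. g x * indicator B x = (g x * enn_powr (ennreal (\<nu> x)) (1 / p) * indicator B x) *
        (enn_powr (ennreal (\<nu> x)) (- (1 / p)) * indicator B x)"
        using pos
      proof eventually_elim
        case (elim x)
        have "enn_powr (ennreal (\<nu> x)) (1 / p) * enn_powr (ennreal (\<nu> x)) (- (1 / p)) = 1" if "x \<in> B"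
          using elim that \<nu> by (intro enn_powr_inverse) (auto simp: weight_def less_le)
        then show ?case
          by (cases "x \<in> B") (auto simp: mult.assoc)
      qed
    qed
    also have "\<dots> \<le> enn_powr (\<integral>\<^sup>+x. enn_powr (g x * enn_powr (ennreal (\<nu> x)) (1 / p) * indicator B x) p \<partial>lebesgue) (1 / p) *
       enn_powr (\<integral>\<^sup>+x. enn_powr (enn_powr (ennreal (\<nu> x)) (- (1 / p)) * indicator B x) p' \<partial>lebesgue) (1 / p')"
      by (rule nn_integral_Hoelder) (use p p' in auto)
    also have "(\<integral>\<^sup>+x. enn_powr (g x * enn_powr (ennreal (\<nu> x)) (1 / p) * indicator B x) p \<partial>lebesgue) = G"
    proof -
      have "enn_powr (g x * enn_powr (ennreal (\<nu> x)) (1 / p) * indicator B x) p =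
          enn_powr (g x) p * ennreal (\<nu> x) * indicator B x" for x
        using p by (subst enn_powr_indicator_mult) (simp_all add: enn_powr_mult enn_powr_powr)
      then show ?thesis by (simp add: G_def energy_def)
    qed
    also have "(\<integral>\<^sup>+x. enn_powr (enn_powr (ennreal (\<nu> x)) (- (1 / p)) * indicator B x) p' \<partial>lebesgue) \<le> S"
      unfolding S_def using p' B
      by (intro nn_integral_mono)
        (auto simp: enn_powr_indicator_mult enn_powr_powr indicator_def)
    finally have "(\<integral>\<^sup>+x\<in>B. g x \<partial>lebesgue) \<le> enn_powr G (1 / p) * enn_powr S b"
      using p' by (simp add: b_def enn_powr_mono mult_left_mono)
    then have "enn_powr I a * (\<integral>\<^sup>+x\<in>B. g x \<partial>lebesgue) \<le> enn_powr I a * (enn_powr G (1 / p) * enn_powr S b)"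
      by (rule mult_left_mono) simp
    also have "\<dots> = (enn_powr I a * enn_powr S b) * enn_powr G (1 / p)" by (simp only: mult_ac)
    also have "\<dots> \<le> ennreal C\<^sub>0 * ennreal (l powr (n * a + n * b - \<gamma>)) * enn_powr G (1 / p)"
      by (intro mult_right_mono IS) simp
    finally show ?thesis .
  qed
  then show ?thesis
    by (simp add: I_def G_def a_def n_def ab(3))
qed

text \<open>Hoelder's inequality with exponents \<open>r\<close> and \<open>1 / (1 - 1 / r)\<close>.
  It plays the part of an A_infinity estimate, with a power of the bump integral where the mass of
  the cube would stand.\<close>

lemma wmeasure_le_bump_integral:
  assumes E [measurable]: "E \<in> sets borel" and sub: "E \<subseteq> cube z L"
  shows "W E \<le> enn_powr (bump_integral z L) (1 / r) * enn_powr (emeasure lborel E) (1 - 1 / r)"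
proof -
  note [measurable] = weights_measurable
  have [measurable]: "E \<in> sets lebesgue" using E by simp
  define \<delta> where "\<delta> = 1 - 1 / r"
  have \<delta>: "0 < \<delta>" using r by (simp add: \<delta>_def)
  have "W E = (\<integral>\<^sup>+x. (ennreal (w x) * indicator (cube z L) x) * indicator E x \<partial>lebesgue)"
    using sub by (auto simp: wmeasure_def emeasure_density indicator_def intro!: nn_integral_cong)
  also have "\<dots> \<le> enn_powr (\<integral>\<^sup>+x. enn_powr (ennreal (w x) * indicator (cube z L) x) r \<partial>lebesgue) (1 / r) *
      enn_powr (\<integral>\<^sup>+x. enn_powr (indicator E x) (1 / \<delta>) \<partial>lebesgue) (1 / (1 / \<delta>))"
    by (rule nn_integral_Hoelder) (use r \<delta> in \<open>auto simp: \<delta>_def\<close>)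
  also have "(\<integral>\<^sup>+x. enn_powr (ennreal (w x) * indicator (cube z L) x) r \<partial>lebesgue) = bump_integral z L"
    using r by (simp add: enn_powr_indicator_mult bump_integral_def)
  also have "(\<integral>\<^sup>+x. enn_powr (indicator E x) (1 / \<delta>) \<partial>lebesgue) = emeasure lborel E"
    using \<delta> enn_powr_indicator_mult[of "1 / \<delta>" 1 E] by (simp add: enn_powr_def[of 1])
  finally show ?thesis by (simp add: \<delta>_def)
qed

text \<open>\<open>20 * h * CARD('n)\<close> is the side of a cube containing the fivefold dilate of
  a ball of radius \<open>2 * h * CARD('n)\<close>, as the covering argument produces it;
  \<open>(20 * CARD('n)) powr (CARD('n) - \<gamma>)\<close> is what this side leaves after
  cancelling \<open>h powr (\<gamma> - CARD('n))\<close>. \<open>max 1\<close> keeps the constant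
  positive for every \<open>C\<^sub>0\<close>.\<close>

definition level_const :: real where
  "level_const = (max 1 C\<^sub>0 * (20 * real CARD('n)) powr (real CARD('n) - \<gamma>)) powr p"

text \<open>\<open>t\<close> is bounded through \<open>bump_local\<close> and \<open>W E\<close>
  through \<open>wmeasure_le_bump_integral\<close>; the bump integral occurs in both and is
  eliminated. The energy is taken over the small ball although \<open>E\<close> may spread over the
  whole cube, because only the small balls of the later covering are disjoint.\<close>

lemma ball_estimate:
  assumes h: "0 < h" and t: "0 < t" and \<epsilon>: "0 \<le> \<epsilon>"
    and [measurable]: "g \<in> borel_measurable borel" "E \<in> sets borel"
    and large: "ennreal t \<le> dyadic_term \<gamma> g h z"
    and E: "E \<subseteq> cube z (20 * h * CARD('n))"
    and small: "emeasure lborel E \<le> ennreal \<epsilon> * ennreal ((20 * h * CARD('n)) ^ CARD('n))"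
  shows "ennreal (t powr p) * W E \<le>
    ennreal (level_const * \<epsilon> powr (1 - 1 / r)) *
      energy g (cball z (2 * h * CARD('n)))"
proof -
  note [measurable] = weights_measurable
  have [measurable]: "g \<in> borel_measurable lebesgue" "E \<in> sets lebesgue"
    by (auto intro: measurable_completion)
  define n where "n = real CARD('n)"
  define L where "L = 20 * h * n"
  define B where "B = cball z (2 * h * n)"
  define I where "I = bump_integral z L"
  define G where "G = energy g B"
  define C where "C = max 1 C\<^sub>0"
  define \<delta> where "\<delta> = 1 - 1 / r"
  define e where "e = n / (r * p) + n * (p - 1) / p - \<gamma>"
  have pos: "0 < n" "0 < L" "0 < C" "0 < \<delta>" using h r by (auto simp: n_def L_def C_def \<delta>_def)
  have "W E \<le> enn_powr I (1 / r) * enn_powr (emeasure lborel E) \<delta>"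
    unfolding I_def \<delta>_def by (rule wmeasure_le_bump_integral) (use E in \<open>auto simp: L_def n_def\<close>)
  also have "enn_powr (emeasure lborel E) \<delta> \<le> enn_powr (ennreal \<epsilon> * ennreal (L powr n)) \<delta>"
    using small pos by (simp add: enn_powr_mono L_def n_def powr_realpow)
  also have "enn_powr (ennreal \<epsilon> * ennreal (L powr n)) \<delta> = ennreal (\<epsilon> powr \<delta> * L powr (n * \<delta>))"
    using pos \<epsilon> by (cases "\<epsilon> = 0") (simp_all add: enn_powr_mult enn_powr_pos powr_powr ennreal_mult)
  finally have wE: "W E \<le> enn_powr I (1 / r) * ennreal (\<epsilon> powr \<delta> * L powr (n * \<delta>))"
    by (simp add: mult_left_mono)
  have "ennreal t \<le> ennreal (h powr (\<gamma> - n)) * (\<integral>\<^sup>+y\<in>neighbours h z. g y \<partial>lborel)"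
    using large by (simp add: dyadic_term_def n_def)
  also have "\<dots> \<le> ennreal (h powr (\<gamma> - n)) * (\<integral>\<^sup>+y\<in>B. g y \<partial>lborel)"
    using neighbours_imp_dist[OF h, of _ z]
    by (intro mult_left_mono nn_integral_mono) (auto simp: B_def n_def indicator_def)
  finally have "enn_powr I (1 / (r * p)) * ennreal t \<le>
      enn_powr I (1 / (r * p)) * (ennreal (h powr (\<gamma> - n)) * (\<integral>\<^sup>+y\<in>B. g y \<partial>lborel))"
    by (rule mult_left_mono) simp
  also have "\<dots> = ennreal (h powr (\<gamma> - n)) * (enn_powr I (1 / (r * p)) * (\<integral>\<^sup>+y\<in>B. g y \<partial>lebesgue))"
    by (simp add: mult_ac nn_integral_completion)
  also have "\<dots> \<le> ennreal (h powr (\<gamma> - n)) * (ennreal C\<^sub>0 * ennreal (L powr e) * enn_powr G (1 / p))"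
    unfolding I_def G_def e_def n_def
  proof (intro mult_left_mono bump_local)
    show "B \<subseteq> cube z L"
      unfolding B_def by (rule cball_subset_cube) (use h pos in \<open>simp add: L_def\<close>)
  qed (use pos in \<open>auto simp: B_def\<close>)
  also have "\<dots> \<le> ennreal (h powr (\<gamma> - n)) * (ennreal C * ennreal (L powr e) * enn_powr G (1 / p))"
    by (intro mult_left_mono mult_right_mono ennreal_leI) (auto simp: C_def)
  also have "\<dots> = ennreal (h powr (\<gamma> - n) * C * L powr e) * enn_powr G (1 / p)"
    using pos by (simp add: ennreal_mult mult_ac)
  \<comment> \<open>The power \<open>p\<close> turns the exponent \<open>1 / (r * p)\<close> of
    \<open>I\<close> into \<open>1 / r\<close>, the one in the bound for \<open>W E\<close>.\<close>
  finally have "enn_powr (enn_powr I (1 / (r * p)) * ennreal t) p \<le>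
      enn_powr (ennreal (h powr (\<gamma> - n) * C * L powr e) * enn_powr G (1 / p)) p"
    using p by (intro enn_powr_mono) auto
  moreover have "enn_powr (enn_powr I (1 / (r * p)) * ennreal t) p = enn_powr I (1 / r) * ennreal (t powr p)"
    using p t by (simp add: enn_powr_mult enn_powr_powr enn_powr_pos)
  moreover have "enn_powr (ennreal (h powr (\<gamma> - n) * C * L powr e) * enn_powr G (1 / p)) p =
      ennreal ((h powr (\<gamma> - n) * C * L powr e) powr p) * G"
    using p pos h by (simp add: enn_powr_mult enn_powr_powr enn_powr_pos)
  ultimately have tI: "enn_powr I (1 / r) * ennreal (t powr p) \<le> ennreal ((h powr (\<gamma> - n) * C * L powr e) powr p) * G"
    by simp
  have "ennreal (t powr p) * W E \<le>
    ennreal (t powr p) * (enn_powr I (1 / r) * ennreal (\<epsilon> powr \<delta> * L powr (n * \<delta>)))"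
    by (intro mult_left_mono wE) simp
  also have "\<dots> = (enn_powr I (1 / r) * ennreal (t powr p)) * ennreal (\<epsilon> powr \<delta> * L powr (n * \<delta>))"
    by (simp only: mult_ac)
  also have "\<dots> \<le> (ennreal ((h powr (\<gamma> - n) * C * L powr e) powr p) * G) * ennreal (\<epsilon> powr \<delta> * L powr (n * \<delta>))"
    by (intro mult_right_mono tI) simp
  also have "\<dots> = ennreal ((h powr (\<gamma> - n) * C * L powr e) powr p * (\<epsilon> powr \<delta> * L powr (n * \<delta>))) * G"
    using pos by (simp add: ennreal_mult mult_ac)
  also have "(h powr (\<gamma> - n) * C * L powr e) powr p * (\<epsilon> powr \<delta> * L powr (n * \<delta>)) =
    level_const * \<epsilon> powr \<delta>"
  proof -
    \<comment> \<open>Scaling: all powers of \<open>L\<close> combine to exactly the one that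
      cancels \<open>h powr (\<gamma> - n)\<close>, so the constant is independent of
      \<open>h\<close>.\<close>
    have "e * p + n * \<delta> = (n - \<gamma>) * p"
      using p r by (simp add: e_def \<delta>_def field_simps)
    then have "(L powr e) powr p * L powr (n * \<delta>) = (L powr (n - \<gamma>)) powr p"
      using pos by (simp add: powr_powr powr_add[symmetric])
    moreover have "h powr (\<gamma> - n) * L powr (n - \<gamma>) = (20 * n) powr (n - \<gamma>)"
      using h pos by (simp add: L_def powr_mult powr_diff field_simps)
    moreover have "(h powr (\<gamma> - n) * C * L powr e) powr p * L powr (n * \<delta>) =
        (h powr (\<gamma> - n) * C) powr p * ((L powr e) powr p * L powr (n * \<delta>))"
      using pos by (subst powr_mult) (simp_all add: mult.assoc)
    moreover have "(h powr (\<gamma> - n) * C) powr p * (L powr (n - \<gamma>)) powr p =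
        (C * (h powr (\<gamma> - n) * L powr (n - \<gamma>))) powr p"
      using pos by (subst powr_mult[symmetric]) (simp_all add: mult_ac)
    ultimately have "(h powr (\<gamma> - n) * C * L powr e) powr p * L powr (n * \<delta>) = (C * (20 * n) powr (n - \<gamma>)) powr p"
      by simp
    then show ?thesis by (simp add: level_const_def C_def n_def mult_ac)
  qed
  finally show ?thesis by (simp add: G_def B_def n_def \<delta>_def)
qed

end

section \<open>Level sets, stopping cells and the Vitali covering\<close>

context bump_pair
begin

text \<open>A set of density \<open>\<epsilon>\<close> in the cells where the terms first exceed \<open>t\<close> gains \<open>\<epsilon> powr (1 - 1 / r)\<close>.
  The Vitali covering lemma makes up for the overlap of the neighbourhoods of disjoint cells.\<close>

lemma level_set_estimate:
  fixes g :: "real^'n \<Rightarrow> ennreal"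
  assumes l: "0 < l" and t: "0 < t" and \<epsilon>: "0 \<le> \<epsilon>"
    and g [measurable]: "g \<in> borel_measurable borel" and X [measurable]: "X \<in> sets borel"
    and ex: "\<And>x. x \<in> X \<Longrightarrow> \<exists>k\<le>N. ennreal t < dyadic_term \<gamma> g (l / 2 ^ k) x"
    and small: "\<And>x k. x \<in> X \<Longrightarrow> ennreal t < dyadic_term \<gamma> g (l / 2 ^ k) x \<Longrightarrow>
      (\<And>i. i < k \<Longrightarrow> dyadic_term \<gamma> g (l / 2 ^ i) x \<le> ennreal t) \<Longrightarrow>
      emeasure lborel (X \<inter> cell (l / 2 ^ k) x) \<le> ennreal \<epsilon> * ennreal ((l / 2 ^ k) ^ CARD('n))"
  shows "ennreal (t powr p) * W X \<le>
    ennreal (level_const * \<epsilon> powr (1 - 1 / r)) *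
      energy g UNIV"
proof -
  note [measurable] = weights_measurable
  have [measurable]: "g \<in> borel_measurable lebesgue" "X \<in> sets lebesgue"
    by (auto intro: measurable_completion)
  define D where "D k x = dyadic_term \<gamma> g (l / 2 ^ k) x" for k x
  \<comment> \<open>A stopping time: the first scale at which the threshold is exceeded.
    \<open>h x\<close> is the side of the stopping cell, and \<open>\<rho> x\<close> is a radius
    large enough for the ball around \<open>x\<close> to contain that cell and all its
    neighbours.\<close>
  define \<kappa> where "\<kappa> x = (LEAST k. ennreal t < D k x)" for x
  define h where "h x = l / 2 ^ \<kappa> x" for x
  define \<rho> where "\<rho> x = 2 * h x * CARD('n)" for x
  define G where "G x = enn_powr (g x) p * ennreal (\<nu> x)" for x
  have [measurable]: "G \<in> borel_measurable lebesgue" unfolding G_def by measurable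
  have h: "0 < h x" "h x \<le> l" for x
    using l mult_left_mono[of 1 "2 ^ \<kappa> x" l] by (auto simp: h_def divide_le_eq)
  then have \<rho>: "0 < \<rho> x" "\<rho> x \<le> 2 * l * CARD('n)" for x
    by (auto simp: \<rho>_def)
  have \<kappa>: "ennreal t < D (\<kappa> x) x" "\<kappa> x \<le> N" if "x \<in> X" for x
  proof -
    obtain k where k: "k \<le> N" "ennreal t < D k x" using ex[OF \<open>x \<in> X\<close>] by (auto simp: D_def)
    from k(2) show "ennreal t < D (\<kappa> x) x" unfolding \<kappa>_def by (rule LeastI)
    show "\<kappa> x \<le> N" using k Least_le[of "\<lambda>k. ennreal t < D k x" k] by (simp add: \<kappa>_def)
  qed
  have below: "D i x \<le> ennreal t" if "i < \<kappa> x" for i x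
    using not_less_Least[of i "\<lambda>k. ennreal t < D k x"] that by (auto simp: \<kappa>_def)
  \<comment> \<open>Stopping is decided by the terms of scales up to \<open>\<kappa> x\<close>, and
    these are constant on the stopping cell.\<close>
  have \<kappa>_cell: "\<kappa> y = \<kappa> x" if "x \<in> X" "y \<in> cell (h x) x" for x y
  proof -
    have eq: "D i y = D i x" if "i \<le> \<kappa> x" for i
      unfolding D_def using that \<open>y \<in> _\<close>
      by (intro dyadic_term_cong_coarser[of i "\<kappa> x"]) (auto simp: cell_def h_def)
    show ?thesis
      unfolding \<kappa>_def[of y]
    proof (rule Least_equality)
      show "ennreal t < D (\<kappa> x) y" using \<kappa>[OF \<open>x \<in> X\<close>] eq by simp
      show "\<kappa> x \<le> i" if "ennreal t < D i y" for i
      proof (rule ccontr)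
        assume "\<not> \<kappa> x \<le> i"
        then show False using below[of i x] eq[of i] that by auto
      qed
    qed
  qed
  \<comment> \<open>Vitali's lemma asks for bounded radii; they are bounded because the coarsest
    scale is \<open>l\<close>.\<close>
  obtain C where C: "countable C" "C \<subseteq> X"
    and disj: "pairwise (\<lambda>x y. disjnt (cball x (\<rho> x)) (cball y (\<rho> y))) C"
    and cov: "\<And>x. x \<in> X \<Longrightarrow> \<exists>z. z \<in> C \<and> \<not> disjnt (cball x (\<rho> x)) (cball z (\<rho> z)) \<and>
                        cball x (\<rho> x) \<subseteq> ball z (5 * \<rho> z)"
    by (rule Vitali_covering_lemma_cballs_balls[of X \<rho> "2 * l * CARD('n)" "\<lambda>x. x"]) (use \<rho> in auto)
  \<comment> \<open>The stopping cells of scale \<open>k\<close> assigned to the centre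
    \<open>z\<close>. Whole cells are collected, not only their parts in \<open>X\<close>, so that
    the indicator is constant on cells and the density hypothesis can be applied to it.\<close>
  define Y where "Y z k = (\<Union>x\<in>{x\<in>X. \<kappa> x = k \<and> cball x (\<rho> x) \<subseteq> ball z (5 * \<rho> z)}. cell (h x) x)" for z k
  have Y_cong: "y \<in> Y z k \<longleftrightarrow> y' \<in> Y z k" if "cell_index (l / 2 ^ k) y = cell_index (l / 2 ^ k) y'" for y y' z k
    using that by (auto simp: Y_def cell_def h_def)
  have Y_meas [measurable]: "Y z k \<in> sets borel" for z k
  proof -
    have "(\<lambda>y. indicator (Y z k) y :: ennreal) \<in> borel_measurable borel"
    proof (rule cell_fun_measurable)
      fix y y' :: "real^'n" assume "cell_index (l / 2 ^ k) y = cell_index (l / 2 ^ k) y'"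
      from Y_cong[OF this, of z] show "indicator (Y z k) y = (indicator (Y z k) y' :: ennreal)"
        by (simp add: indicator_def)
    qed simp
    then show ?thesis by (simp add: borel_measurable_indicator_iff)
  qed
  have Y_\<kappa>: "\<kappa> y = k" if "y \<in> Y z k" for y z k
    using that \<kappa>_cell by (auto simp: Y_def)
  have cell_ball: "cell (h x) x \<subseteq> cball x (\<rho> x)" for x
    using cell_subset_neighbours[of "h x" x] neighbours_imp_dist[OF h(1)[of x], of _ x] by (auto simp: \<rho>_def)
  have Y_ball: "Y z k \<subseteq> ball z (5 * \<rho> z)" for z k
    using cell_ball by (auto simp: Y_def)
  define E where "E z = X \<inter> (\<Union>k\<le>N. Y z k)" for z
  have E_meas [measurable]: "E z \<in> sets borel" for z
    unfolding E_def by measurable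
  have [measurable]: "E z \<in> sets lebesgue" for z
    using E_meas[of z] by simp
  have E_ball: "E z \<subseteq> ball z (5 * \<rho> z)" for z
    using Y_ball by (auto simp: E_def)
  have ball_cube: "ball z (5 * \<rho> z) \<subseteq> cube z (20 * h z * CARD('n))" for z
    using ball_subset_cball cball_subset_cube[of "5 * \<rho> z" "20 * h z * CARD('n)" z] by (force simp: \<rho>_def)
  \<comment> \<open>Density \<open>\<epsilon>\<close> on each stopping cell adds up to density
    \<open>\<epsilon>\<close> on the cube, because the sets \<open>Y z k\<close> are disjoint for
    different \<open>k\<close>: \<open>\<kappa>\<close> takes the value \<open>k\<close> on
    \<open>Y z k\<close>.\<close>
  have E_small: "emeasure lborel (E z) \<le> ennreal \<epsilon> * ennreal ((20 * h z * CARD('n)) ^ CARD('n))" for z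
  proof -
    have "emeasure lborel (E z) \<le> (\<integral>\<^sup>+x. (\<Sum>k\<le>N. indicator (Y z k) x * indicator X x) \<partial>lborel)"
    proof -
      have "indicator (E z) x \<le> (\<Sum>k\<le>N. indicator (Y z k) x * indicator X x :: ennreal)" for x
      proof (cases "x \<in> E z")
        case True
        then obtain k where "k \<le> N" "x \<in> Y z k" "x \<in> X" by (auto simp: E_def)
        then show ?thesis
          using member_le_sum[of k "{..N}" "\<lambda>k. indicator (Y z k) x * indicator X x :: ennreal"] True by simp
      qed simp
      then have "(\<integral>\<^sup>+x. indicator (E z) x \<partial>lborel) \<le> (\<integral>\<^sup>+x. (\<Sum>k\<le>N. indicator (Y z k) x * indicator X x) \<partial>lborel)"
        by (intro nn_integral_mono)
      then show ?thesis by (simp only: nn_integral_indicator sets_lborel E_meas)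
    qed
    also have "\<dots> = (\<Sum>k\<le>N. \<integral>\<^sup>+x. indicator (Y z k) x * indicator X x \<partial>lborel)"
      by (rule nn_integral_sum) measurable
    also have "\<dots> \<le> (\<Sum>k\<le>N. ennreal \<epsilon> * (\<integral>\<^sup>+x. indicator (Y z k) x \<partial>lborel))"
    proof (intro sum_mono nn_integral_cellwise_le)
      fix k :: nat
      show "0 < l / 2 ^ k" using l by simp
      show "indicator (Y z k) y = (indicator (Y z k) y' :: ennreal)"
        if "cell_index (l / 2 ^ k) y = cell_index (l / 2 ^ k) y'" for y y'
        using Y_cong[OF that, of z] by (simp add: indicator_def)
      fix y :: "real^'n" assume "indicator (Y z k) y \<noteq> (0::ennreal)"
      then obtain x where x: "x \<in> X" "\<kappa> x = k" "y \<in> cell (h x) x"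
        by (auto simp: Y_def indicator_def split: if_splits)
      then have eq: "cell (l / 2 ^ k) y = cell (l / 2 ^ k) x" by (auto simp: cell_def h_def)
      have "(\<integral>\<^sup>+u\<in>cell (l / 2 ^ k) y. indicator X u \<partial>lborel) = emeasure lborel (X \<inter> cell (l / 2 ^ k) x)"
        unfolding eq by (simp add: indicator_inter_arith[symmetric])
      also have "\<dots> \<le> ennreal \<epsilon> * ennreal ((l / 2 ^ k) ^ CARD('n))"
        using small[of x k] x \<kappa>[of x] below[of _ x] by (auto simp: D_def)
      finally show "(\<integral>\<^sup>+u\<in>cell (l / 2 ^ k) y. indicator X u \<partial>lborel) \<le>
          ennreal \<epsilon> * ennreal ((l / 2 ^ k) ^ CARD('n))" .
    qed measurable
    also have "\<dots> = ennreal \<epsilon> * (\<integral>\<^sup>+x. (\<Sum>k\<le>N. indicator (Y z k) x) \<partial>lborel)"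
      by (subst nn_integral_sum) (auto simp: sum_distrib_left)
    also have "\<dots> \<le> ennreal \<epsilon> * (\<integral>\<^sup>+x. indicator (cube z (20 * h z * CARD('n))) x \<partial>lborel)"
    proof (intro mult_left_mono nn_integral_mono)
      fix x
      show "(\<Sum>k\<le>N. indicator (Y z k) x) \<le> (indicator (cube z (20 * h z * CARD('n))) x :: ennreal)"
      proof (cases "\<exists>k. x \<in> Y z k")
        case True
        then have x: "x \<in> cube z (20 * h z * CARD('n))" using Y_ball ball_cube by blast
        have "(\<Sum>k\<le>N. indicator (Y z k) x :: ennreal) \<le> (\<Sum>k\<le>N. if k = \<kappa> x then 1 else 0)"
        proof (rule sum_mono)
          fix k
          show "indicator (Y z k) x \<le> (if k = \<kappa> x then 1 else 0 :: ennreal)"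
            using Y_\<kappa>[of x z k] by (cases "x \<in> Y z k") auto
        qed
        also have "\<dots> \<le> 1" by simp
        finally show ?thesis using x by simp
      next
        case False
        then show ?thesis by (simp add: indicator_def)
      qed
    qed simp
    also have "\<dots> = ennreal \<epsilon> * ennreal ((20 * h z * CARD('n)) ^ CARD('n))"
      using h(1)[of z] by (simp add: emeasure_lborel_cube)
    finally show ?thesis .
  qed
  have [measurable]: "cball z (\<rho> z) \<in> sets lebesgue" for z by simp
  have [simp]: "sets (wmeasure w) = sets lebesgue" by (simp add: wmeasure_def)
  have meas_w: "A \<in> sets (wmeasure w)" if "A \<in> sets borel" for A
    using that by simp
  have "W X \<le> (\<integral>\<^sup>+x. (\<integral>\<^sup>+z. indicator (E z) x \<partial>count_space C) \<partial>wmeasure w)"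
  proof -
    have "indicator X x \<le> (\<integral>\<^sup>+z. indicator (E z) x \<partial>count_space C)" for x
    proof (cases "x \<in> X")
      case True
      then obtain z where z: "z \<in> C" "cball x (\<rho> x) \<subseteq> ball z (5 * \<rho> z)" using cov by blast
      have "x \<in> cell (h x) x" by (simp add: cell_def)
      then have "x \<in> E z"
        using True z \<kappa>(2)[OF True] by (auto simp: E_def Y_def)
      then have "1 = (\<integral>\<^sup>+z'. indicator {z} z' * indicator (E z) x \<partial>count_space C)"
        using z by (simp add: nn_integral_count_space'[where A="{z}"])
      also have "\<dots> \<le> (\<integral>\<^sup>+z. indicator (E z) x \<partial>count_space C)"
        by (intro nn_integral_mono) (auto simp: indicator_def)
      finally show ?thesis using True by simp
    qed simp
    then have "(\<integral>\<^sup>+x. indicator X x \<partial>wmeasure w) \<le> (\<integral>\<^sup>+x. (\<integral>\<^sup>+z. indicator (E z) x \<partial>count_space C) \<partial>wmeasure w)"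
      by (intro nn_integral_mono)
    then show ?thesis by (simp only: nn_integral_indicator meas_w X)
  qed
  also have "\<dots> = (\<integral>\<^sup>+z. (\<integral>\<^sup>+x. indicator (E z) x \<partial>wmeasure w) \<partial>count_space C)"
    by (rule nn_integral_count_space_nn_integral[OF C(1)]) (rule borel_measurable_indicator[OF meas_w[OF E_meas]])
  also have "\<dots> = (\<integral>\<^sup>+z. W (E z) \<partial>count_space C)"
    by (intro nn_integral_cong) (simp only: nn_integral_indicator meas_w E_meas)
  finally have "ennreal (t powr p) * W X \<le>
      ennreal (t powr p) * (\<integral>\<^sup>+z. W (E z) \<partial>count_space C)"
    by (rule mult_left_mono) simp
  also have "\<dots> = (\<integral>\<^sup>+z. ennreal (t powr p) * W (E z) \<partial>count_space C)"
    by (rule nn_integral_cmult[symmetric]) simp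
  also have "\<dots> \<le> (\<integral>\<^sup>+z. ennreal (level_const * \<epsilon> powr (1 - 1 / r)) *
       (\<integral>\<^sup>+x\<in>cball z (\<rho> z). G x \<partial>lebesgue) \<partial>count_space C)"
  proof (rule nn_integral_mono)
    fix z assume "z \<in> space (count_space C)"
    then have z: "z \<in> X" using C by auto
    show "ennreal (t powr p) * W (E z) \<le>
      ennreal (level_const * \<epsilon> powr (1 - 1 / r)) * (\<integral>\<^sup>+x\<in>cball z (\<rho> z). G x \<partial>lebesgue)"
      unfolding \<rho>_def G_def energy_def[symmetric]
    proof (rule ball_estimate[OF h(1) t \<epsilon> g E_meas _ _ E_small])
      show "ennreal t \<le> dyadic_term \<gamma> g (h z) z" using \<kappa>(1)[OF z] by (simp add: D_def h_def)
      show "E z \<subseteq> cube z (20 * h z * CARD('n))" using E_ball ball_cube by blast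
    qed
  qed
  also have "\<dots> = ennreal (level_const * \<epsilon> powr (1 - 1 / r)) *
      (\<integral>\<^sup>+z. (\<integral>\<^sup>+x\<in>cball z (\<rho> z). G x \<partial>lebesgue) \<partial>count_space C)"
    by (rule nn_integral_cmult) simp
  also have "(\<integral>\<^sup>+z. (\<integral>\<^sup>+x\<in>cball z (\<rho> z). G x \<partial>lebesgue) \<partial>count_space C) =
      (\<integral>\<^sup>+x. (\<integral>\<^sup>+z. G x * indicator (cball z (\<rho> z)) x \<partial>count_space C) \<partial>lebesgue)"
    by (rule nn_integral_count_space_nn_integral[OF C(1), symmetric]) measurable
  also have "\<dots> \<le> (\<integral>\<^sup>+x. G x \<partial>lebesgue)"
  proof (rule nn_integral_mono)
    fix x
    show "(\<integral>\<^sup>+z. G x * indicator (cball z (\<rho> z)) x \<partial>count_space C) \<le> G x"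
    \<comment> \<open>Each point lies in at most one of the balls kept by the covering lemma, so the
      energies over them add up to at most the total.\<close>
    proof (cases "\<exists>z\<in>C. x \<in> cball z (\<rho> z)")
      case True
      then obtain z where z: "z \<in> C" "x \<in> cball z (\<rho> z)" by blast
      have "x \<notin> cball z' (\<rho> z')" if "z' \<in> C" "z' \<noteq> z" for z'
        using disj z that unfolding pairwise_def disjnt_def by blast
      then show ?thesis
        using z by (subst nn_integral_count_space'[where A="{z}"]) auto
    next
      case False
      then have "(\<integral>\<^sup>+z. G x * indicator (cball z (\<rho> z)) x \<partial>count_space C) = (\<integral>\<^sup>+z. 0 \<partial>count_space C)"
        by (intro nn_integral_cong) (auto simp: indicator_def)
      then show ?thesis by simp
    qed
  qed
  finally show ?thesis by (simp add: G_def energy_def mult_left_mono)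
qed

end

section \<open>Grouping the scales by their running maximum\<close>

lemma sets_wmeasure [simp]: "sets (wmeasure w) = sets lebesgue"
  and space_wmeasure [simp]: "space (wmeasure w) = UNIV"
  by (simp_all add: wmeasure_def)

lemma ennreal_le_suminf:
  fixes f :: "nat \<Rightarrow> ennreal"
  shows "f j \<le> (\<Sum>i. f i)"
  using sum_le_suminf[of f "{j}"] by simp

text \<open>Along the chain of dyadic cells containing \<open>x\<close> the terms are grouped according to the
  dyadic size of their running maximum. If the whole sum exceeds \<open>t\<close> while no term does, then some
  group with running maximum about \<open>t / 2 ^ i\<close> sums to more than \<open>t / 4 * (3 / 4) ^ i\<close>; that happens
  on a set of density \<open>O((2 / 3) ^ (q * i))\<close>, for any \<open>q\<close>, in the cells where a term first exceeds
  \<open>t / 2 ^ (i + 1)\<close>.\<close>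

definition group_sum :: "real \<Rightarrow> (real^'n \<Rightarrow> ennreal) \<Rightarrow> real \<Rightarrow> nat \<Rightarrow> real \<Rightarrow> nat \<Rightarrow> real^'n \<Rightarrow> ennreal" where
  "group_sum \<gamma> g l N t i x = (\<Sum>j\<le>N.
     if (\<forall>m\<le>j. dyadic_term \<gamma> g (l / 2 ^ m) x \<le> ennreal (t / 2 ^ i)) \<and>
        (\<exists>m\<le>j. ennreal (t / 2 ^ Suc i) < dyadic_term \<gamma> g (l / 2 ^ m) x)
     then dyadic_term \<gamma> g (l / 2 ^ j) x else 0)"

lemma measurable_group_sum [measurable]: "group_sum \<gamma> g l N t i \<in> borel_measurable borel"
  unfolding group_sum_def by measurable

text \<open>Pigeonhole: the thresholds sum to \<open>t\<close>, and every nonzero term belongs to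
  the group of the least \<open>i\<close> whose lower level lies below its running maximum. Since no
  term exceeds \<open>t\<close>, the cap of group \<open>0\<close> is respected and the groups
  exhaust the sum.\<close>

lemma group_sum_exceeds:
  assumes t: "0 < t" and le: "\<And>j. j \<le> N \<Longrightarrow> dyadic_term \<gamma> g (l / 2 ^ j) x \<le> ennreal t"
    and sum: "ennreal t < (\<Sum>j\<le>N. dyadic_term \<gamma> g (l / 2 ^ j) x)"
  shows "\<exists>i. ennreal (t / 4 * (3 / 4) ^ i) < group_sum \<gamma> g l N t i x"
proof (rule ccontr)
  define D where "D j = dyadic_term \<gamma> g (l / 2 ^ j) x" for j
  define F where "F i j = (if (\<forall>m\<le>j. D m \<le> ennreal (t / 2 ^ i)) \<and> (\<exists>m\<le>j. ennreal (t / 2 ^ Suc i) < D m)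
     then D j else 0)" for i j
  have gs: "group_sum \<gamma> g l N t i x = (\<Sum>j\<le>N. F i j)" for i
    unfolding group_sum_def F_def D_def by (rule refl)
  assume "\<not> ?thesis"
  then have small: "(\<Sum>j\<le>N. F i j) \<le> ennreal (t / 4 * (3 / 4) ^ i)" for i
    by (auto simp: gs not_less)
  have "D j \<le> (\<Sum>i. F i j)" if j: "j \<le> N" for j
  proof (cases "D j = 0")
    case False
    define P where "P i \<longleftrightarrow> (\<exists>m\<le>j. ennreal (t / 2 ^ Suc i) < D m)" for i
    have "\<exists>i. P i"
    proof -
      have "D j < \<infinity>" using le[OF j] by (auto simp: D_def intro: le_less_trans)
      with False obtain d where d: "D j = ennreal d" "0 < d"
        by (cases "D j") auto
      obtain i where "t / d < 2 ^ i" using real_arch_pow[of 2 "t / d"] by auto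
      then have "t / 2 ^ i < d" using d by (simp add: field_simps)
      moreover have "t / 2 ^ Suc i \<le> t / 2 ^ i" using t by (simp add: field_simps)
      ultimately have "ennreal (t / 2 ^ Suc i) < D j" using d by (simp add: ennreal_less_iff)
      then show ?thesis unfolding P_def by blast
    qed
    define i where "i = (LEAST i. P i)"
    have "P i" unfolding i_def using \<open>\<exists>i. P i\<close> by (rule LeastI_ex)
    moreover have "D m \<le> ennreal (t / 2 ^ i)" if "m \<le> j" for m
    proof (cases i)
      case 0
      then show ?thesis using le[of m] that j by (simp add: D_def)
    next
      case (Suc i')
      then have "\<not> P i'" unfolding i_def using not_less_Least by (metis lessI)
      then show ?thesis using that Suc by (auto simp: P_def not_less)
    qed
    ultimately have "F i j = D j" by (auto simp: F_def P_def)
    then show ?thesis using ennreal_le_suminf[of "\<lambda>i. F i j" i] by simp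
  qed simp
  then have "(\<Sum>j\<le>N. D j) \<le> (\<Sum>j\<le>N. \<Sum>i. F i j)" by (intro sum_mono) auto
  also have "\<dots> = (\<Sum>i. \<Sum>j\<le>N. F i j)" by (rule suminf_sum[symmetric]) simp
  also have "\<dots> \<le> (\<Sum>i. ennreal (t / 4 * (3 / 4) ^ i))"
    by (intro suminf_le small) auto
  also have "\<dots> = ennreal t"
  proof (rule suminf_ennreal_eq)
    have "(\<lambda>i. t / 4 * (3 / 4) ^ i) sums (t / 4 * (1 / (1 - 3 / 4)))"
      by (intro sums_mult geometric_sums) simp
    then show "(\<lambda>i. t / 4 * (3 / 4) ^ i) sums t" by simp
  qed (use t in simp)
  finally show False using sum by (simp add: D_def not_le[symmetric])
qed

text \<open>Chebyshev's inequality with exponent \<open>q\<close> for the terms capped at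
  \<open>t / 2 ^ i\<close>. By the last assumption the running maximum has not passed the lower
  level of the group before scale \<open>k\<close>, so on this cell the group has no term coarser
  than \<open>k\<close>, and the moment bound on a cell of scale \<open>k\<close> applies. The
  factor \<open>4 * (2 / 3) ^ i\<close> is the ratio of cap to threshold.\<close>

lemma group_sum_density:
  fixes g :: "real^'n \<Rightarrow> ennreal"
  assumes l: "0 < l" and t: "0 < t" and \<gamma>: "0 < \<gamma>" and [measurable]: "g \<in> borel_measurable borel"
    and k: "\<And>j. j < k \<Longrightarrow> dyadic_term \<gamma> g (l / 2 ^ j) x \<le> ennreal (t / 2 ^ Suc i)"
  shows "emeasure lborel ({x. ennreal (t / 4 * (3 / 4) ^ i) < group_sum \<gamma> g l N t i x} \<inter> cell (l / 2 ^ k) x) \<le>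
    ennreal (fact q * moment_const \<gamma> CARD('n) ^ q * (4 * (2 / 3) ^ i) ^ q) * ennreal ((l / 2 ^ k) ^ CARD('n))"
proof -
  define u where "u = t / 4 * (3 / 4) ^ i"
  define Z where "Z = {x. ennreal u < group_sum \<gamma> g l N t i x} \<inter> cell (l / 2 ^ k) x"
  define S where "S y = (\<Sum>j=k..N. capped_term \<gamma> g l (ennreal (t / 2 ^ i)) j y)" for y
  have u: "0 < u" using t by (simp add: u_def)
  have "0 < moment_const \<gamma> CARD('n)" using \<gamma> by (simp add: moment_const_def powr_less_one)
  then have K: "0 \<le> moment_const \<gamma> CARD('n)" by (rule less_imp_le)
  have [measurable]: "Z \<in> sets borel" unfolding Z_def by measurable
  have S: "group_sum \<gamma> g l N t i y \<le> S y" if y: "y \<in> cell (l / 2 ^ k) x" for y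
  proof -
    have eq: "dyadic_term \<gamma> g (l / 2 ^ m) y = dyadic_term \<gamma> g (l / 2 ^ m) x" if "m \<le> k" for m
      using y by (intro dyadic_term_cong_coarser[OF that]) (simp add: cell_def)
    have "group_sum \<gamma> g l N t i y \<le> (\<Sum>j\<le>N. if k \<le> j then capped_term \<gamma> g l (ennreal (t / 2 ^ i)) j y else 0)"
      unfolding group_sum_def
    proof (rule sum_mono)
      fix j
      have "dyadic_term \<gamma> g (l / 2 ^ m) y \<le> ennreal (t / 2 ^ Suc i)" if "j < k" "m \<le> j" for m
        using k[of m] eq[of m] that by simp
      then have none: "\<not> (\<exists>m\<le>j. ennreal (t / 2 ^ Suc i) < dyadic_term \<gamma> g (l / 2 ^ m) y)" if "j < k"
        using that by (auto simp: not_less simp del: power_Suc)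
      show "(if (\<forall>m\<le>j. dyadic_term \<gamma> g (l / 2 ^ m) y \<le> ennreal (t / 2 ^ i)) \<and>
            (\<exists>m\<le>j. ennreal (t / 2 ^ Suc i) < dyadic_term \<gamma> g (l / 2 ^ m) y)
          then dyadic_term \<gamma> g (l / 2 ^ j) y else 0)
          \<le> (if k \<le> j then capped_term \<gamma> g l (ennreal (t / 2 ^ i)) j y else 0)"
      proof (cases "k \<le> j")
        case False
        then show ?thesis using none by (auto simp del: power_Suc)
      qed (auto simp: capped_term_def)
    qed
    also have "\<dots> = S y"
      unfolding S_def by (subst sum.inter_filter[symmetric]) (auto intro!: sum.cong)
    finally show ?thesis .
  qed
  have "ennreal (u ^ q) * emeasure lborel Z = (\<integral>\<^sup>+y. ennreal (u ^ q) * indicator Z y \<partial>lborel)"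
    by (simp add: nn_integral_cmult)
  also have "\<dots> \<le> (\<integral>\<^sup>+y\<in>cell (l / 2 ^ k) x. S y ^ q \<partial>lborel)"
  proof (rule nn_integral_mono)
    fix y
    show "ennreal (u ^ q) * indicator Z y \<le> S y ^ q * indicator (cell (l / 2 ^ k) x) y"
    proof (cases "y \<in> Z")
      case True
      then have "ennreal u \<le> S y" using S[of y] by (auto simp: Z_def)
      then have "ennreal u ^ q \<le> S y ^ q" by (rule power_mono) simp
      then show ?thesis using True u by (simp add: Z_def ennreal_power)
    qed simp
  qed
  also have "\<dots> \<le> (fact q * ennreal (moment_const \<gamma> CARD('n)) ^ q * ennreal (t / 2 ^ i) ^ q) * ennreal ((l / 2 ^ k) ^ CARD('n))"
    unfolding S_def by (rule nn_integral_capped_moment_le[OF l \<gamma>]) simp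
  also have "fact q * ennreal (moment_const \<gamma> CARD('n)) ^ q * ennreal (t / 2 ^ i) ^ q =
      ennreal (fact q * moment_const \<gamma> CARD('n) ^ q * (t / 2 ^ i) ^ q)"
  proof -
    have "(fact q :: ennreal) = ennreal (fact q)"
      by (metis ennreal_of_nat_eq_real_of_nat of_nat_fact)
    then show ?thesis using K t by (simp add: ennreal_power ennreal_mult)
  qed
  finally have "ennreal (1 / u ^ q) * (ennreal (u ^ q) * emeasure lborel Z) \<le>
      ennreal (1 / u ^ q) * (ennreal (fact q * moment_const \<gamma> CARD('n) ^ q * (t / 2 ^ i) ^ q) * ennreal ((l / 2 ^ k) ^ CARD('n)))"
    by (rule mult_left_mono) simp
  also have "ennreal (1 / u ^ q) * (ennreal (u ^ q) * emeasure lborel Z) = emeasure lborel Z"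
    using u by (simp add: mult.assoc[symmetric] ennreal_mult[symmetric])
  also have "ennreal (1 / u ^ q) * (ennreal (fact q * moment_const \<gamma> CARD('n) ^ q * (t / 2 ^ i) ^ q) * ennreal ((l / 2 ^ k) ^ CARD('n))) =
      ennreal (1 / u ^ q * (fact q * moment_const \<gamma> CARD('n) ^ q * (t / 2 ^ i) ^ q)) * ennreal ((l / 2 ^ k) ^ CARD('n))"
    using u K t by (simp only: mult.assoc[symmetric]) (subst ennreal_mult[symmetric], auto)
  also have "1 / u ^ q * (fact q * moment_const \<gamma> CARD('n) ^ q * (t / 2 ^ i) ^ q) =
      fact q * moment_const \<gamma> CARD('n) ^ q * (4 * (2 / 3) ^ i) ^ q"
  proof -
    have "t / 2 ^ i / u = 4 * (2 / 3) ^ i"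
      using t by (simp add: u_def field_simps power_mult_distrib[symmetric])
    then have "(4 * (2 / 3) ^ i) ^ q = (t / 2 ^ i) ^ q / u ^ q" by (metis power_divide)
    then show ?thesis by (simp add: field_simps)
  qed
  finally show ?thesis by (simp add: Z_def u_def)
qed

text \<open>Since \<open>0 powr a = 0\<close>, the kernel vanishes on the diagonal.\<close>

definition riesz :: "real \<Rightarrow> (real^'n \<Rightarrow> ennreal) \<Rightarrow> real^'n \<Rightarrow> ennreal" where
  "riesz \<gamma> g x = (\<integral>\<^sup>+y. ennreal (norm (x - y) powr (\<gamma> - CARD('n))) * g y \<partial>lborel)"

lemma measurable_riesz [measurable]:
  assumes [measurable]: "g \<in> borel_measurable borel"
  shows "riesz \<gamma> g \<in> borel_measurable borel"
  unfolding riesz_def by measurable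

text \<open>At a distance between \<open>l / 2 ^ Suc j\<close> and \<open>l / 2 ^ j\<close> the
  summand with index \<open>j\<close> alone dominates; passing from the lower to the upper end of
  this range costs the factor \<open>2 powr (CARD('n) - \<gamma>)\<close>.\<close>

lemma truncated_kernel_le:
  fixes x y :: "real^'n" and \<gamma> :: real
  assumes l: "0 < l" and \<gamma>: "\<gamma> < CARD('n)"
  shows "ennreal (norm (x - y) powr (\<gamma> - CARD('n))) * indicator {y. dist x y < l} y \<le>
    ennreal (2 powr (CARD('n) - \<gamma>)) *
      (\<Sum>j. ennreal ((l / 2 ^ j) powr (\<gamma> - CARD('n))) * indicator (neighbours (l / 2 ^ j) x) y)"
proof (cases "x \<noteq> y \<and> dist x y < l")
  case True
  define d where "d = dist x y"
  have d: "0 < d" "d < l" using True by (auto simp: d_def)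
  have "\<exists>j. l / 2 ^ Suc j \<le> d"
  proof -
    obtain j where "l / d < 2 ^ j" using real_arch_pow[of 2 "l / d"] by auto
    then have "l / 2 ^ j < d" using d by (simp add: field_simps)
    moreover have "l / 2 ^ Suc j \<le> l / 2 ^ j" using l by (simp add: field_simps)
    ultimately show ?thesis by (intro exI[of _ j]) linarith
  qed
  define j where "j = (LEAST j. l / 2 ^ Suc j \<le> d)"
  have j1: "l / 2 ^ Suc j \<le> d" unfolding j_def using \<open>\<exists>j. _ j\<close> by (rule LeastI_ex)
  have j2: "d < l / 2 ^ j"
  proof (cases j)
    case (Suc i)
    then have "\<not> l / 2 ^ Suc i \<le> d" unfolding j_def using not_less_Least by (metis (mono_tags, lifting) lessI)
    then show ?thesis using Suc by simp
  qed (use d in simp)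
  have "d powr (\<gamma> - CARD('n)) \<le> (l / 2 ^ Suc j) powr (\<gamma> - CARD('n))"
    using j1 l \<gamma> by (intro powr_mono2') auto
  also have "(l / 2 ^ Suc j) powr (\<gamma> - CARD('n)) = (l / 2 ^ j / 2) powr (\<gamma> - CARD('n))" by (simp add: mult.commute)
  also have "\<dots> = 2 powr (CARD('n) - \<gamma>) * (l / 2 ^ j) powr (\<gamma> - CARD('n))"
    using l by (subst powr_divide) (auto simp: powr_diff field_simps)
  finally have "ennreal (d powr (\<gamma> - CARD('n))) \<le> ennreal (2 powr (CARD('n) - \<gamma>)) * ennreal ((l / 2 ^ j) powr (\<gamma> - CARD('n)))"
    by (subst ennreal_mult[symmetric]) (auto intro: ennreal_leI)
  also have "\<dots> = ennreal (2 powr (CARD('n) - \<gamma>)) * (ennreal ((l / 2 ^ j) powr (\<gamma> - CARD('n))) * indicator (neighbours (l / 2 ^ j) x) y)"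
    using dist_imp_neighbours[of "l / 2 ^ j" x y] l j2 by (simp add: d_def)
  also have "\<dots> \<le> ennreal (2 powr (CARD('n) - \<gamma>)) *
      (\<Sum>j. ennreal ((l / 2 ^ j) powr (\<gamma> - CARD('n))) * indicator (neighbours (l / 2 ^ j) x) y)"
    by (intro mult_left_mono ennreal_le_suminf[of "\<lambda>j. ennreal ((l / 2 ^ j) powr (\<gamma> - CARD('n))) * indicator (neighbours (l / 2 ^ j) x) y"]) simp
  finally show ?thesis using True by (simp add: d_def dist_norm)
next
  case False
  then have "norm (x - y) powr (\<gamma> - CARD('n)) = 0 \<or> \<not> dist x y < l" by auto
  then show ?thesis by auto
qed

section \<open>Weak type bounds for dyadic sums and for the Riesz potential\<close>

context bump_pair
begin

text \<open>The constant is uniform in the coarsest scale \<open>l\<close> and in the number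
  \<open>N\<close> of scales, so that both can tend to infinity afterwards.\<close>

lemma dyadic_weak_type:
  shows "\<exists>C>0. \<forall>g\<in>borel_measurable borel. \<forall>l>0. \<forall>t>0. \<forall>N.
    ennreal (t powr p) * W {x. ennreal t < (\<Sum>j\<le>N. dyadic_term \<gamma> g (l / 2 ^ j) x)} \<le>
      ennreal C * energy g UNIV"
proof -
  define \<delta> where "\<delta> = 1 - 1 / r"
  have \<delta>: "0 < \<delta>" using r by (simp add: \<delta>_def)
  define A where "A = level_const"
  have A: "0 < A" by (simp add: A_def level_const_def)
  \<comment> \<open>The order of the moment is taken so large that the gain
    \<open>((2 / 3) powr \<delta>) ^ q\<close> beats the factor \<open>2 powr p\<close> lost each
    time the level is halved; this is \<open>\<theta> < 1\<close> below.\<close>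
  obtain q :: nat where q: "p * ln 2 / (\<delta> * ln (3 / 2)) < real q" using reals_Archimedean2 by blast
  define M where "M = fact q * moment_const \<gamma> CARD('n) ^ q"
  have M: "0 < M" using \<gamma> by (simp add: M_def moment_const_def powr_less_one)
  define \<theta> where "\<theta> = 2 powr p * ((2 / 3) powr \<delta>) ^ q"
  have \<theta>: "0 < \<theta>" "\<theta> < 1"
  proof -
    have "p * ln 2 < real q * (\<delta> * ln (3 / 2))" using q \<delta> by (simp add: field_simps)
    moreover have "ln \<theta> = p * ln 2 + real q * (\<delta> * ln (2 / 3))"
      by (simp add: \<theta>_def ln_mult ln_powr ln_realpow)
    moreover have "ln (2 / 3 :: real) = - ln (3 / 2)" by (simp add: ln_div)
    ultimately have "ln \<theta> < 0" by simp
    moreover show "0 < \<theta>" by (simp add: \<theta>_def)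
    ultimately show "\<theta> < 1" by simp
  qed
  \<comment> \<open>Collects what does not depend on \<open>i\<close>: one factor
    \<open>2 powr p\<close> because the level is \<open>t / 2 ^ Suc i\<close>, the level constant,
    and the moment constants raised to the power \<open>\<delta>\<close>.\<close>
  define B where "B = 2 powr p * A * (M * 4 ^ q) powr \<delta>"
  have B: "0 < B" using A M by (simp add: B_def)
  define C where "C = A + B / (1 - \<theta>)"
  have C: "0 < C" using A B \<theta> by (simp add: C_def add_pos_pos)
  show ?thesis
  proof (intro exI[of _ C] conjI C ballI allI impI)
    fix g :: "real^'n \<Rightarrow> ennreal" and l t :: real and N :: nat
    assume g [measurable]: "g \<in> borel_measurable borel" and l: "0 < l" and t: "0 < t"
    define G where "G = energy g UNIV"
    define X where "X = {x. \<exists>j\<le>N. ennreal t < dyadic_term \<gamma> g (l / 2 ^ j) x}"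
    define Y where "Y i = {x. ennreal (t / 4 * (3 / 4) ^ i) < group_sum \<gamma> g l N t i x}" for i
    define T where "T = ennreal (t powr p)"
    have X_meas [measurable]: "X \<in> sets borel" unfolding X_def by measurable
    have Y_meas [measurable]: "Y i \<in> sets borel" for i unfolding Y_def by measurable
    have meas_w: "Z \<in> sets (wmeasure w)" if "Z \<in> sets borel" for Z
      using that by simp
    \<comment> \<open>Where a single term exceeds \<open>t\<close>, no density gain is required:
      with the trivial \<open>\<epsilon> = 1\<close> this is the weak type bound for the maximal
      function of the terms.\<close>
    have "T * W X \<le> ennreal (A * 1 powr \<delta>) * G"
      unfolding T_def A_def \<delta>_def G_def
    proof (rule level_set_estimate[OF l t _ g X_meas])
      fix x k
      show "emeasure lborel (X \<inter> cell (l / 2 ^ k) x) \<le> ennreal 1 * ennreal ((l / 2 ^ k) ^ CARD('n))"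
        using emeasure_mono[of "X \<inter> cell (l / 2 ^ k) x" "cell (l / 2 ^ k) x" lborel] l emeasure_cell[of "l / 2 ^ k" x]
        by simp
    qed (auto simp: X_def)
    then have TX: "T * W X \<le> ennreal A * G" by simp
    have TY: "T * W (Y i) \<le> ennreal (B * \<theta> ^ i) * G" for i
    proof -
      \<comment> \<open>\<open>t / 2 ^ Suc i\<close> is the lower level of group \<open>i\<close>:
        if no term exceeded it the group would be empty, so every point of \<open>Y i\<close> has a
        stopping cell at this level.\<close>
      have "ennreal ((t / 2 ^ Suc i) powr p) * W (Y i) \<le>
          ennreal (A * (M * (4 * (2 / 3) ^ i) ^ q) powr \<delta>) * G"
        unfolding A_def \<delta>_def G_def
      proof (rule level_set_estimate[OF l _ _ g Y_meas])
        fix x assume "x \<in> Y i"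
        then have ne: "group_sum \<gamma> g l N t i x \<noteq> 0" by (auto simp: Y_def)
        show "\<exists>k\<le>N. ennreal (t / 2 ^ Suc i) < dyadic_term \<gamma> g (l / 2 ^ k) x"
        proof (rule ccontr)
          assume "\<not> ?thesis"
          then have "\<not> (\<exists>m\<le>j. ennreal (t / 2 ^ Suc i) < dyadic_term \<gamma> g (l / 2 ^ m) x)" if "j \<le> N" for j
            using that le_trans by blast
          then have "group_sum \<gamma> g l N t i x = 0"
            unfolding group_sum_def by (intro sum.neutral ballI) (auto simp del: power_Suc)
          with ne show False ..
        qed
      next
        fix x k assume "\<And>j. j < k \<Longrightarrow> dyadic_term \<gamma> g (l / 2 ^ j) x \<le> ennreal (t / 2 ^ Suc i)"
        then show "emeasure lborel (Y i \<inter> cell (l / 2 ^ k) x) \<le>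
            ennreal (M * (4 * (2 / 3) ^ i) ^ q) * ennreal ((l / 2 ^ k) ^ CARD('n))"
          unfolding Y_def M_def by (intro group_sum_density l t \<gamma>(1) g) auto
      qed (use t M in auto)
      then have "ennreal (2 powr (p * Suc i)) * (ennreal ((t / 2 ^ Suc i) powr p) * W (Y i)) \<le>
          ennreal (2 powr (p * Suc i)) * (ennreal (A * (M * (4 * (2 / 3) ^ i) ^ q) powr \<delta>) * G)"
        by (rule mult_left_mono) simp
      also have "ennreal (2 powr (p * Suc i)) * (ennreal ((t / 2 ^ Suc i) powr p) * W (Y i)) =
          T * W (Y i)"
      proof -
        have "2 powr (p * Suc i) * (t / 2 ^ Suc i) powr p = t powr p"
        proof -
          have "(2 ^ Suc i :: real) powr p = 2 powr (p * Suc i)"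
            by (subst powr_realpow[symmetric]) (simp_all only: powr_powr zero_less_numeral mult.commute)
          then show ?thesis using t by (subst powr_divide) (auto simp del: power_Suc)
        qed
        then show ?thesis
          unfolding T_def by (subst mult.assoc[symmetric], subst ennreal_mult[symmetric]) auto
      qed
      also have "ennreal (2 powr (p * Suc i)) * (ennreal (A * (M * (4 * (2 / 3) ^ i) ^ q) powr \<delta>) * G) =
          ennreal (B * \<theta> ^ i) * G"
      proof -
        have "(M * (4 * (2 / 3) ^ i) ^ q) powr \<delta> = (M * 4 ^ q) powr \<delta> * (((2 / 3) ^ i) ^ q) powr \<delta>"
          using M by (subst powr_mult[symmetric]) (auto simp: power_mult_distrib mult_ac)
        also have "(((2 / 3 :: real) ^ i) ^ q) powr \<delta> = (((2 / 3) powr \<delta>) ^ q) ^ i"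
          by (simp add: powr_powr mult_ac flip: powr_realpow power_mult)
        finally have e: "(M * (4 * (2 / 3) ^ i) ^ q) powr \<delta> = (M * 4 ^ q) powr \<delta> * (((2 / 3) powr \<delta>) ^ q) ^ i" .
        have "2 powr (p * Suc i) = 2 powr p * (2 powr p) ^ i"
          by (simp add: powr_add powr_powr distrib_left flip: powr_realpow)
        then have "2 powr (p * Suc i) * (A * (M * (4 * (2 / 3) ^ i) ^ q) powr \<delta>) = B * \<theta> ^ i"
          unfolding e by (simp add: B_def \<theta>_def power_mult_distrib)
        then show ?thesis
          using A by (subst mult.assoc[symmetric], subst ennreal_mult[symmetric]) auto
      qed
      finally show ?thesis .
    qed
    have "{x. ennreal t < (\<Sum>j\<le>N. dyadic_term \<gamma> g (l / 2 ^ j) x)} \<subseteq> X \<union> (\<Union>i. Y i)"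
    proof
      fix x assume "x \<in> {x. ennreal t < (\<Sum>j\<le>N. dyadic_term \<gamma> g (l / 2 ^ j) x)}"
      moreover from this group_sum_exceeds[OF t, of N \<gamma> g l x] have "x \<notin> X \<Longrightarrow> x \<in> (\<Union>i. Y i)"
        by (simp add: X_def Y_def not_less)
      ultimately show "x \<in> X \<union> (\<Union>i. Y i)" by blast
    qed
    then have "W {x. ennreal t < (\<Sum>j\<le>N. dyadic_term \<gamma> g (l / 2 ^ j) x)} \<le>
        W (X \<union> (\<Union>i. Y i))"
      by (rule emeasure_mono) (rule meas_w, measurable)
    also have "\<dots> \<le> W X + W (\<Union>i. Y i)"
      by (rule emeasure_subadditive) (rule meas_w, measurable)+
    also have "\<dots> \<le> W X + (\<Sum>i. W (Y i))"
      by (intro add_left_mono emeasure_subadditive_countably) (auto intro: meas_w[OF Y_meas])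
    finally have "T * W {x. ennreal t < (\<Sum>j\<le>N. dyadic_term \<gamma> g (l / 2 ^ j) x)} \<le>
        T * (W X + (\<Sum>i. W (Y i)))"
      by (rule mult_left_mono) simp
    also have "\<dots> = T * W X + (\<Sum>i. T * W (Y i))"
      by (simp add: distrib_left ennreal_suminf_cmult)
    also have "\<dots> \<le> ennreal A * G + (\<Sum>i. ennreal (B * \<theta> ^ i) * G)"
      by (intro add_mono TX suminf_le TY) auto
    also have "(\<Sum>i. ennreal (B * \<theta> ^ i) * G) = (\<Sum>i. ennreal (B * \<theta> ^ i)) * G"
      by (simp add: ennreal_suminf_multc)
    also have "(\<Sum>i. ennreal (B * \<theta> ^ i)) = ennreal (B / (1 - \<theta>))"
    proof (rule suminf_ennreal_eq)
      have "(\<lambda>i. B * \<theta> ^ i) sums (B * (1 / (1 - \<theta>)))"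
        using \<theta> by (intro sums_mult geometric_sums) simp
      then show "(\<lambda>i. B * \<theta> ^ i) sums (B / (1 - \<theta>))" by simp
    qed (use B \<theta> in simp)
    also have "ennreal A * G + ennreal (B / (1 - \<theta>)) * G = ennreal C * G"
      using A B \<theta> by (simp add: C_def distrib_right)
    finally show "ennreal (t powr p) * W {x. ennreal t < (\<Sum>j\<le>N. dyadic_term \<gamma> g (l / 2 ^ j) x)} \<le>
        ennreal C * energy g UNIV"
      by (simp add: T_def G_def)
  qed
qed

text \<open>Two monotone limits: first in the number of scales, then in the truncation radius
  \<open>2 ^ m\<close>, which is also the coarsest scale. As the inequality \<open>t < ...\<close>
  is strict, each superlevel set is the increasing union of those of the approximations.\<close>

lemma riesz_weak_type:
  shows "\<exists>C>0. \<forall>g\<in>borel_measurable borel. \<forall>t>0.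
    ennreal (t powr p) * W {x. ennreal t < riesz \<gamma> g x} \<le>
      ennreal C * energy g UNIV"
proof -
  obtain C where C: "0 < C" and dyadic: "\<And>g l t N. g \<in> borel_measurable borel \<Longrightarrow> 0 < l \<Longrightarrow> 0 < t \<Longrightarrow>
    ennreal (t powr p) * W {x. ennreal t < (\<Sum>j\<le>N. dyadic_term \<gamma> g (l / 2 ^ j) x)} \<le>
      ennreal C * energy g UNIV"
    using dyadic_weak_type by blast
  define c where "c = (2::real) powr (CARD('n) - \<gamma>)"
  have c: "0 < c" by (simp add: c_def)
  show ?thesis
  proof (intro exI[of _ "C * c powr p"] conjI ballI allI impI)
    show "0 < C * c powr p" using C c by simp
    fix g :: "real^'n \<Rightarrow> ennreal" and t :: real
    assume g [measurable]: "g \<in> borel_measurable borel" and t: "0 < t"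
    define G where "G = energy g UNIV"
    define R where "R m x = (\<integral>\<^sup>+y. ennreal (norm (x - y) powr (\<gamma> - CARD('n))) * indicator {y. dist x y < 2 ^ m} y * g y \<partial>lborel)"
      for m :: nat and x
    have [measurable]: "R m \<in> borel_measurable borel" for m
      unfolding R_def indicator_def by measurable
    have R_SUP: "riesz \<gamma> g x = (SUP m. R m x)" for x
      unfolding R_def riesz_def
    proof (subst nn_integral_monotone_convergence_SUP[symmetric])
      show "incseq (\<lambda>m y. ennreal (norm (x - y) powr (\<gamma> - CARD('n))) * indicator {y. dist x y < 2 ^ m} y * g y)"
      proof (rule incseq_SucI, rule le_funI)
        fix m y
        have "dist x y < 2 ^ m \<Longrightarrow> dist x y < 2 ^ Suc m" by (erule less_le_trans) simp
        then show "ennreal (norm (x - y) powr (\<gamma> - CARD('n))) * indicator {y. dist x y < 2 ^ m} y * g y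
          \<le> ennreal (norm (x - y) powr (\<gamma> - CARD('n))) * indicator {y. dist x y < 2 ^ Suc m} y * g y"
          by (intro mult_right_mono mult_left_mono) (auto simp: indicator_def simp del: power_Suc)
      qed
      have "ennreal (norm (x - y) powr (\<gamma> - CARD('n))) * g y =
        (SUP m. ennreal (norm (x - y) powr (\<gamma> - CARD('n))) * indicator {y. dist x y < 2 ^ m} y * g y)" for y
      proof (rule antisym)
        obtain m where "dist x y < 2 ^ m" using real_arch_pow[of 2 "dist x y"] by auto
        then show "ennreal (norm (x - y) powr (\<gamma> - CARD('n))) * g y \<le>
          (SUP m. ennreal (norm (x - y) powr (\<gamma> - CARD('n))) * indicator {y. dist x y < 2 ^ m} y * g y)"
          by (intro SUP_upper2[of m]) auto
      qed (auto intro!: SUP_least simp: indicator_def)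
      then show "(\<integral>\<^sup>+y. ennreal (norm (x - y) powr (\<gamma> - CARD('n))) * g y \<partial>lborel) =
        (\<integral>\<^sup>+y. (SUP m. ennreal (norm (x - y) powr (\<gamma> - CARD('n))) * indicator {y. dist x y < 2 ^ m} y * g y) \<partial>lborel)"
        by simp
    qed (auto simp: indicator_def)
    have R_mono: "R m x \<le> R (Suc m) x" for m x
    proof -
      have "dist x y < 2 ^ m \<Longrightarrow> dist x y < 2 ^ Suc m" for y by (erule less_le_trans) simp
      then show ?thesis unfolding R_def
        by (intro nn_integral_mono mult_right_mono mult_left_mono) (auto simp: indicator_def simp del: power_Suc)
    qed
    have R_le: "R m x \<le> ennreal c * (\<Sum>j. dyadic_term \<gamma> g (2 ^ m / 2 ^ j) x)" for m x
    proof -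
      have "R m x \<le> (\<integral>\<^sup>+y. ennreal c * (\<Sum>j. ennreal ((2 ^ m / 2 ^ j) powr (\<gamma> - CARD('n))) * indicator (neighbours (2 ^ m / 2 ^ j) x) y) * g y \<partial>lborel)"
        unfolding R_def c_def by (intro nn_integral_mono mult_right_mono truncated_kernel_le \<gamma>(2)) auto
      also have "\<dots> = (\<integral>\<^sup>+y. ennreal c * (\<Sum>j. ennreal ((2 ^ m / 2 ^ j) powr (\<gamma> - CARD('n))) * (g y * indicator (neighbours (2 ^ m / 2 ^ j) x) y)) \<partial>lborel)"
        by (intro nn_integral_cong) (simp add: ennreal_suminf_multc[symmetric] mult_ac)
      also have "\<dots> = ennreal c * (\<Sum>j. dyadic_term \<gamma> g (2 ^ m / 2 ^ j) x)"
        unfolding dyadic_term_def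
        by (subst nn_integral_cmult, measurable, subst nn_integral_suminf, measurable, subst nn_integral_cmult, measurable)
      finally show ?thesis .
    qed
    define U where "U m N = {x. ennreal (t / c) < (\<Sum>j\<le>N. dyadic_term \<gamma> g (2 ^ m / 2 ^ j) x)}" for m N
    have [measurable]: "U m N \<in> sets borel" for m N unfolding U_def by measurable
    have meas_w: "Z \<in> sets (wmeasure w)" if "Z \<in> sets borel" for Z
      using that by simp
    have U: "W (U m N) \<le> ennreal ((t / c) powr - p) * (ennreal C * G)" for m N
    proof -
      have "ennreal ((t / c) powr - p) * (ennreal ((t / c) powr p) * W (U m N)) \<le>
          ennreal ((t / c) powr - p) * (ennreal C * G)"
        unfolding U_def G_def by (intro mult_left_mono dyadic g) (use t c in auto)
      moreover have "ennreal ((t / c) powr - p) * ennreal ((t / c) powr p) = 1"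
        using t c by (subst ennreal_mult[symmetric]) (auto simp: powr_add[symmetric])
      ultimately show ?thesis by (simp add: mult.assoc[symmetric])
    qed
    have RU: "W {x. ennreal t < R m x} \<le> ennreal ((t / c) powr - p) * (ennreal C * G)" for m
    proof -
      have "x \<in> (\<Union>N. U m N)" if "ennreal t < R m x" for x
      proof -
        have "ennreal t < ennreal c * (\<Sum>j. dyadic_term \<gamma> g (2 ^ m / 2 ^ j) x)"
          using that R_le[of m x] by (rule less_le_trans)
        then have "ennreal (t / c) < (\<Sum>j. dyadic_term \<gamma> g (2 ^ m / 2 ^ j) x)"
        proof (rule contrapos_pp)
          assume "\<not> ennreal (t / c) < (\<Sum>j. dyadic_term \<gamma> g (2 ^ m / 2 ^ j) x)"
          then have "ennreal c * (\<Sum>j. dyadic_term \<gamma> g (2 ^ m / 2 ^ j) x) \<le> ennreal c * ennreal (t / c)"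
            by (intro mult_left_mono) auto
          also have "\<dots> = ennreal t" using c t by (simp add: ennreal_mult[symmetric])
          finally show "\<not> ennreal t < ennreal c * (\<Sum>j. dyadic_term \<gamma> g (2 ^ m / 2 ^ j) x)" by simp
        qed
        then obtain N where "ennreal (t / c) < (\<Sum>j<N. dyadic_term \<gamma> g (2 ^ m / 2 ^ j) x)"
          by (auto simp: suminf_eq_SUP less_SUP_iff)
        also have "\<dots> \<le> (\<Sum>j\<le>N. dyadic_term \<gamma> g (2 ^ m / 2 ^ j) x)"
          by (intro sum_mono2) auto
        finally show ?thesis by (auto simp: U_def)
      qed
      then have "W {x. ennreal t < R m x} \<le> W (\<Union>N. U m N)"
        by (intro emeasure_mono meas_w) (auto, measurable)
      also have "\<dots> = (SUP N. W (U m N))"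
      proof (rule SUP_emeasure_incseq[symmetric])
        show "range (U m) \<subseteq> sets (wmeasure w)" by (auto intro: meas_w)
        have "(\<Sum>j\<le>N. dyadic_term \<gamma> g (2 ^ m / 2 ^ j) x) \<le> (\<Sum>j\<le>Suc N. dyadic_term \<gamma> g (2 ^ m / 2 ^ j) x)" for N x
          by (intro sum_mono2) auto
        then show "incseq (U m)"
          unfolding U_def by (intro incseq_SucI) (auto intro: less_le_trans simp del: sum.atMost_Suc)
      qed
      also have "\<dots> \<le> ennreal ((t / c) powr - p) * (ennreal C * G)" by (intro SUP_least U)
      finally show ?thesis .
    qed
    have "{x. ennreal t < riesz \<gamma> g x} = (\<Union>m. {x. ennreal t < R m x})"
      by (auto simp: R_SUP less_SUP_iff)
    then have "W {x. ennreal t < riesz \<gamma> g x} = W (\<Union>m. {x. ennreal t < R m x})"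
      by simp
    also have "\<dots> = (SUP m. W {x. ennreal t < R m x})"
    proof (rule SUP_emeasure_incseq[symmetric])
      have "{x. ennreal t < R m x} \<in> sets borel" for m by measurable
      then show "range (\<lambda>m. {x. ennreal t < R m x}) \<subseteq> sets (wmeasure w)" using meas_w by blast
      show "incseq (\<lambda>m. {x. ennreal t < R m x})"
        by (intro incseq_SucI) (auto intro: less_le_trans R_mono)
    qed
    also have "\<dots> \<le> ennreal ((t / c) powr - p) * (ennreal C * G)" by (intro SUP_least RU)
    finally have "ennreal (t powr p) * W {x. ennreal t < riesz \<gamma> g x} \<le>
        ennreal (t powr p) * (ennreal ((t / c) powr - p) * (ennreal C * G))"
      by (rule mult_left_mono) simp
    also have "\<dots> = ennreal (t powr p * (t / c) powr - p * C) * G"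
      using C by (simp add: ennreal_mult mult.assoc)
    also have "t powr p * (t / c) powr - p * C = C * c powr p"
      using t c by (simp add: powr_divide powr_minus field_simps)
    finally show "ennreal (t powr p) * W {x. ennreal t < riesz \<gamma> g x} \<le>
        ennreal (C * c powr p) * energy g UNIV"
      by (simp add: G_def)
  qed
qed

end

section \<open>Amalgam norms and doubling weights\<close>

text \<open>Lower semicontinuity in the centre: an open ball is exhausted by concentric balls of
  radius \<open>\<rho> - 1 / real (Suc n)\<close>, and each of these stays inside
  \<open>ball y' \<rho>\<close> when \<open>y'\<close> is closer to \<open>y\<close> than
  \<open>1 / real (Suc n)\<close>.\<close>

lemma open_emeasure_Int_ball_gt:
  fixes M :: "(real^'n) measure"
  assumes M: "sets M = sets lebesgue" and A: "A \<in> sets M"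
  shows "open {y. a < emeasure M (A \<inter> ball y \<rho>)}"
  unfolding open_dist
proof safe
  fix y assume y: "a < emeasure M (A \<inter> ball y \<rho>)"
  define B where "B n = A \<inter> ball y (\<rho> - 1 / real (Suc n))" for n
  have ball: "ball z e \<in> sets M" for z e using M by simp
  have "A \<inter> ball y \<rho> = (\<Union>n. B n)"
  proof (intro equalityI subsetI)
    fix x assume x: "x \<in> A \<inter> ball y \<rho>"
    then obtain n where "1 / real (Suc n) < \<rho> - dist y x"
      using nat_approx_posE[of "\<rho> - dist y x"] by (auto simp: inverse_eq_divide)
    then show "x \<in> (\<Union>n. B n)" using x by (auto simp: B_def intro!: exI[of _ n])
  next
    fix x assume "x \<in> (\<Union>n. B n)"
    then obtain n where "x \<in> A" "dist y x < \<rho> - 1 / real (Suc n)" by (auto simp: B_def)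
    moreover have "0 < 1 / real (Suc n)" by simp
    ultimately have "x \<in> A" "dist y x < \<rho>" by linarith+
    then show "x \<in> A \<inter> ball y \<rho>" by simp
  qed
  moreover have "(SUP n. emeasure M (B n)) = emeasure M (\<Union>n. B n)"
  proof (rule SUP_emeasure_incseq)
    show "range B \<subseteq> sets M" using A ball by (auto simp: B_def)
    show "incseq B"
      unfolding B_def
    proof (intro incseq_SucI Int_mono subset_refl subset_ball)
      fix n
      show "\<rho> - 1 / real (Suc n) \<le> \<rho> - 1 / real (Suc (Suc n))" by (simp add: frac_le)
    qed
  qed
  ultimately have "a < (SUP n. emeasure M (B n))" using y by simp
  then obtain n where n: "a < emeasure M (B n)" by (auto simp: less_SUP_iff)
  show "\<exists>e>0. \<forall>y'. dist y' y < e \<longrightarrow> y' \<in> {y. a < emeasure M (A \<inter> ball y \<rho>)}"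
  proof (intro exI[of _ "1 / real (Suc n)"] conjI allI impI)
    show "0 < 1 / real (Suc n)" by simp
    fix y' assume y': "dist y' y < 1 / real (Suc n)"
    have "B n \<subseteq> A \<inter> ball y' \<rho>"
    proof
      fix x assume x: "x \<in> B n"
      have "dist y' x \<le> dist y' y + dist y x" by (rule dist_triangle)
      then show "x \<in> A \<inter> ball y' \<rho>" using x y' by (auto simp: B_def)
    qed
    then have "emeasure M (B n) \<le> emeasure M (A \<inter> ball y' \<rho>)"
      using A ball by (intro emeasure_mono) auto
    with n show "y' \<in> {y. a < emeasure M (A \<inter> ball y \<rho>)}" by auto
  qed
qed

lemma measurable_emeasure_ball:
  fixes M :: "(real^'n) measure"
  assumes "sets M = sets lebesgue"
  shows "(\<lambda>y. emeasure M (ball y \<rho>)) \<in> borel_measurable borel"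
proof (rule borel_measurableI_greater)
  fix a
  have "open {y. a < emeasure M (UNIV \<inter> ball y \<rho>)}"
    by (rule open_emeasure_Int_ball_gt[OF assms]) (simp add: assms)
  then show "{y \<in> space borel. a < emeasure M (ball y \<rho>)} \<in> sets borel" by simp
qed

text \<open>The supremum over \<open>c\<close> is uncountable, so measurability does not follow from
  that of its members. Lower semicontinuity does pass to arbitrary suprema: the superlevel set is a
  union of open sets.\<close>

lemma measurable_WLnorm_ball:
  fixes M :: "(real^'n) measure"
  assumes M: "sets M = sets lebesgue" and p: "0 < p" and F: "F \<in> borel_measurable M"
  shows "(\<lambda>y. WLnorm p M (\<lambda>x. F x * indicator (ball y \<rho>) x)) \<in> borel_measurable borel"
proof (rule borel_measurableI_greater)
  fix a :: ennreal
  define A where "A c = {x \<in> space M. ennreal c < F x}" for c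
  have A: "A c \<in> sets M" for c unfolding A_def using F by measurable
  have sp: "space M = UNIV" using sets_eq_imp_space_eq[OF M] by simp
  have set: "{x \<in> space M. F x * indicator (ball y \<rho>) x > ennreal c} = A c \<inter> ball y \<rho>" for y c
    by (auto simp: A_def sp indicator_def split: if_splits)
  have iff: "a < ennreal c * enn_powr z (1 / p) \<longleftrightarrow> ennreal (c powr - p) * enn_powr a p < z" if c: "0 < c" for c z
  proof -
    have inv: "ennreal c * ennreal (1 / c) = 1" using c by (simp add: ennreal_mult[symmetric])
    have "ennreal c * enn_powr z (1 / p) \<le> a \<longleftrightarrow> enn_powr z (1 / p) \<le> ennreal (1 / c) * a"
    proof
      assume "ennreal c * enn_powr z (1 / p) \<le> a"
      then have "ennreal (1 / c) * (ennreal c * enn_powr z (1 / p)) \<le> ennreal (1 / c) * a"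
        by (rule mult_left_mono) simp
      then show "enn_powr z (1 / p) \<le> ennreal (1 / c) * a"
        using inv by (simp add: mult.assoc[symmetric] mult.commute)
    next
      assume "enn_powr z (1 / p) \<le> ennreal (1 / c) * a"
      then have "ennreal c * enn_powr z (1 / p) \<le> ennreal c * (ennreal (1 / c) * a)"
        by (rule mult_left_mono) simp
      then show "ennreal c * enn_powr z (1 / p) \<le> a"
        using inv by (simp add: mult.assoc[symmetric])
    qed
    also have "\<dots> \<longleftrightarrow> enn_powr (enn_powr z (1 / p)) p \<le> enn_powr (ennreal (1 / c) * a) p"
      using p by (simp add: enn_powr_le_iff)
    also have "\<dots> \<longleftrightarrow> z \<le> ennreal (c powr - p) * enn_powr a p"
      using p c by (simp add: enn_powr_powr enn_powr_mult enn_powr_pos powr_minus_divide powr_divide)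
    finally show ?thesis by (simp only: not_le[symmetric])
  qed
  have "{y. a < WLnorm p M (\<lambda>x. F x * indicator (ball y \<rho>) x)} =
    (\<Union>c\<in>{0<..}. {y. ennreal (c powr - p) * enn_powr a p < emeasure M (A c \<inter> ball y \<rho>)})"
    unfolding WLnorm_def set by (auto simp: less_SUP_iff iff)
  also have "open \<dots>"
    by (intro open_UN ballI open_emeasure_Int_ball_gt M A)
  finally show "{y \<in> space borel. a < WLnorm p M (\<lambda>x. F x * indicator (ball y \<rho>) x)} \<in> sets borel" by simp
qed

lemma Lnorm_ennreal:
  assumes "0 < p"
  shows "Lnorm (ennreal p) M F = enn_powr (\<integral>\<^sup>+x. enn_powr (F x) p \<partial>M) (1 / p)"
proof -
  have "1 / ennreal p = ennreal (1 / p)" using assms divide_ennreal[of 1 p] by simp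
  then show ?thesis using assms by (simp add: Lnorm_def)
qed

definition local_norm ::
  "real \<Rightarrow> (real^'n \<Rightarrow> real) \<Rightarrow> (real^'n \<Rightarrow> ennreal) \<Rightarrow> real^'n \<Rightarrow> real \<Rightarrow> ennreal" where
  "local_norm p \<nu> g y \<rho> = enn_powr (\<integral>\<^sup>+x\<in>ball y \<rho>. enn_powr (g x) p * ennreal (\<nu> x) \<partial>lebesgue) (1 / p)"

lemma Lnorm_ball_eq_local_norm:
  assumes p: "0 < p" and \<nu>: "weight \<nu>" and [measurable]: "g \<in> borel_measurable lebesgue"
  shows "Lnorm (ennreal p) (wmeasure \<nu>) (\<lambda>x. g x * indicator (ball y \<rho>) x) = local_norm p \<nu> g y \<rho>"
proof -
  note [measurable] = weight_measurable[OF \<nu>]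
  have [measurable]: "ball y \<rho> \<in> sets lebesgue" by simp
  show ?thesis
    unfolding Lnorm_ennreal[OF p] local_norm_def wmeasure_def
    by (subst nn_integral_density) (auto simp: enn_powr_indicator_mult[OF p] mult_ac)
qed

lemma measurable_local_norm:
  assumes \<nu>: "weight \<nu>" and [measurable]: "g \<in> borel_measurable lebesgue"
  shows "(\<lambda>y. local_norm p \<nu> g y \<rho>) \<in> borel_measurable borel"
proof -
  note [measurable] = weight_measurable[OF \<nu>]
  let ?M = "density lebesgue (\<lambda>x. enn_powr (g x) p * ennreal (\<nu> x))"
  have "(\<lambda>y. emeasure ?M (ball y \<rho>)) \<in> borel_measurable borel"
    by (rule measurable_emeasure_ball) simp
  moreover have "emeasure ?M (ball y \<rho>) = (\<integral>\<^sup>+x\<in>ball y \<rho>. enn_powr (g x) p * ennreal (\<nu> x) \<partial>lebesgue)" for y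
    by (rule emeasure_density) auto
  ultimately show ?thesis unfolding local_norm_def by simp
qed

lemma wmeasure_ball_finite:
  assumes w: "weight w"
  shows "emeasure (wmeasure w) (ball y \<rho>) < \<infinity>"
proof -
  note [measurable] = weight_measurable[OF w]
  have "set_integrable lebesgue (cball y \<rho>) w"
    using w by (auto simp: weight_def locally_integrable_def)
  then have "(\<integral>\<^sup>+x. ennreal (norm (indicator (cball y \<rho>) x *\<^sub>R w x)) \<partial>lebesgue) < \<infinity>"
    unfolding set_integrable_def integrable_iff_bounded by simp
  moreover have "emeasure (wmeasure w) (ball y \<rho>) \<le> (\<integral>\<^sup>+x. ennreal (norm (indicator (cball y \<rho>) x *\<^sub>R w x)) \<partial>lebesgue)"
    using w unfolding wmeasure_def weight_def
    by (subst emeasure_density) (auto intro!: nn_integral_mono simp: indicator_def)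
  ultimately show ?thesis by (rule le_less_trans[rotated])
qed

lemma Delta2_iterate:
  assumes C: "0 < C" "\<And>y r. 0 < r \<Longrightarrow> emeasure (wmeasure w) (ball y (2 * r)) \<le> ennreal C * emeasure (wmeasure w) (ball y r)"
    and r: "0 < r"
  shows "emeasure (wmeasure w) (ball y (2 ^ j * r)) \<le> ennreal (C ^ j) * emeasure (wmeasure w) (ball y r)"
proof (induction j)
  case (Suc j)
  have "emeasure (wmeasure w) (ball y (2 ^ Suc j * r)) \<le> ennreal C * emeasure (wmeasure w) (ball y (2 ^ j * r))"
    using C(2)[of "2 ^ j * r" y] r by (simp add: mult.assoc)
  also have "\<dots> \<le> ennreal C * (ennreal (C ^ j) * emeasure (wmeasure w) (ball y r))"
    by (rule mult_left_mono[OF Suc.IH]) simp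
  finally show ?case using C by (simp add: ennreal_mult mult.assoc)
qed simp

text \<open>A ball of mass zero would, by repeated doubling, make all concentric balls and hence the
  whole space null. Positivity, together with finiteness, lets powers of ball masses obey the usual
  laws for exponents of either sign.\<close>

lemma Delta2_ball_pos:
  fixes w :: "real^'n \<Rightarrow> real"
  assumes w: "weight w" and D: "Delta2 w" and nz: "\<not> (AE x in lebesgue. w x = 0)" and r: "0 < r"
  shows "0 < emeasure (wmeasure w) (ball y r)"
proof (rule ccontr)
  note [measurable] = weight_measurable[OF w]
  obtain C where C: "0 < C" "\<And>y r. 0 < r \<Longrightarrow> emeasure (wmeasure w) (ball y (2 * r)) \<le> ennreal C * emeasure (wmeasure w) (ball y r)"
    using D by (auto simp: Delta2_def)
  assume "\<not> ?thesis"
  then have zero: "emeasure (wmeasure w) (ball y (2 ^ j * r)) = 0" for j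
    using Delta2_iterate[OF C r, of y j] by simp
  have "x \<in> (\<Union>j. ball y (2 ^ j * r))" for x
  proof -
    obtain j where "dist y x / r < 2 ^ j" using real_arch_pow[of 2 "dist y x / r"] by auto
    then show ?thesis using r by (auto simp: field_simps)
  qed
  then have "emeasure (wmeasure w) UNIV = emeasure (wmeasure w) (\<Union>j. ball y (2 ^ j * r))"
    by (metis UNIV_eq_I)
  also have "\<dots> = 0" using zero by (intro emeasure_UN_eq_0) auto
  finally have "(\<integral>\<^sup>+x. ennreal (w x) \<partial>lebesgue) = 0"
    by (simp add: wmeasure_def emeasure_density)
  then have "AE x in lebesgue. ennreal (w x) = 0" by (simp add: nn_integral_0_iff_AE)
  then have "AE x in lebesgue. w x = 0"
    by eventually_elim (use w in \<open>auto simp: weight_def intro: antisym\<close>)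
  with nz show False by simp
qed

text \<open>A ball of radius \<open>r / 2\<close> fits into the annulus between \<open>ball y r\<close> and \<open>ball y (2 * r)\<close>.\<close>

lemma reverse_doubling:
  fixes w :: "real^'n \<Rightarrow> real"
  assumes D: "Delta2 w"
  shows "\<exists>D>1. \<forall>y r j. 0 < r \<longrightarrow>
    ennreal (D ^ j) * emeasure (wmeasure w) (ball y r) \<le> emeasure (wmeasure w) (ball y (2 ^ j * r))"
proof -
  let ?W = "\<lambda>A. emeasure (wmeasure w) A"
  obtain C where C: "0 < C" "\<And>y r. 0 < r \<Longrightarrow> ?W (ball y (2 * r)) \<le> ennreal C * ?W (ball y r)"
    using D by (auto simp: Delta2_def)
  \<comment> \<open>Three doublings take the radius \<open>r / 2\<close> to \<open>4 * r\<close>,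
    enough to cover \<open>ball y r\<close> from the centre \<open>z\<close> chosen below; so the
    ball in the annulus has at least \<open>1 / C ^ 3\<close> times the mass of
    \<open>ball y r\<close>.\<close>
  define D where "D = 1 + 1 / C ^ 3"
  have D: "1 < D" using C by (simp add: D_def)
  have step: "ennreal D * ?W (ball y r) \<le> ?W (ball y (2 * r))" if r: "0 < r" for y :: "real^'n" and r
  proof -
    obtain e :: "real^'n" where e: "norm e = 1" using vector_choose_size[of 1] by auto
    define z where "z = y + (3 / 2 * r) *\<^sub>R e"
    have yz: "dist y z = 3 / 2 * r" using e r by (simp add: z_def dist_norm)
    have sub: "ball y r \<union> ball z (r / 2) \<subseteq> ball y (2 * r)"
    proof (intro Un_least subsetI)
      show "x \<in> ball y (2 * r)" if "x \<in> ball y r" for x using that r by simp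
      show "x \<in> ball y (2 * r)" if "x \<in> ball z (r / 2)" for x
        using that yz dist_triangle[of y x z] by simp
    qed
    have disj: "ball y r \<inter> ball z (r / 2) = {}"
    proof (rule ccontr)
      assume "ball y r \<inter> ball z (r / 2) \<noteq> {}"
      then obtain x where "dist y x < r" "dist z x < r / 2" by auto
      then show False using yz dist_triangle[of y z x] by (simp add: dist_commute)
    qed
    have "ball y r \<subseteq> ball z (2 ^ 3 * (r / 2))"
    proof
      fix x assume "x \<in> ball y r"
      then show "x \<in> ball z (2 ^ 3 * (r / 2))" using yz r dist_triangle[of z x y] by (simp add: dist_commute)
    qed
    then have "?W (ball y r) \<le> ?W (ball z (2 ^ 3 * (r / 2)))" by (intro emeasure_mono) auto
    also have "\<dots> \<le> ennreal (C ^ 3) * ?W (ball z (r / 2))"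
      by (rule Delta2_iterate[OF C]) (use r in auto)
    finally have "ennreal (1 / C ^ 3) * ?W (ball y r) \<le> ennreal (1 / C ^ 3) * (ennreal (C ^ 3) * ?W (ball z (r / 2)))"
      by (rule mult_left_mono) simp
    also have "\<dots> = ?W (ball z (r / 2))"
      using C by (simp add: mult.assoc[symmetric] ennreal_mult[symmetric])
    finally have "?W (ball y r) + ennreal (1 / C ^ 3) * ?W (ball y r) \<le> ?W (ball y r) + ?W (ball z (r / 2))"
      by (rule add_left_mono)
    also have "\<dots> = ?W (ball y r \<union> ball z (r / 2))"
      using disj by (intro plus_emeasure) auto
    also have "\<dots> \<le> ?W (ball y (2 * r))" using sub by (intro emeasure_mono) auto
    also have "?W (ball y r) + ennreal (1 / C ^ 3) * ?W (ball y r) = ennreal D * ?W (ball y r)"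
      using C by (simp add: D_def distrib_right)
    finally show ?thesis .
  qed
  have "ennreal (D ^ j) * ?W (ball y r) \<le> ?W (ball y (2 ^ j * r))" if r: "0 < r" for y r j
  proof (induction j)
    case (Suc j)
    have "ennreal (D ^ Suc j) * ?W (ball y r) = ennreal D * (ennreal (D ^ j) * ?W (ball y r))"
      using D by (simp add: ennreal_mult mult.assoc)
    also have "\<dots> \<le> ennreal D * ?W (ball y (2 ^ j * r))" by (rule mult_left_mono[OF Suc.IH]) simp
    also have "\<dots> \<le> ?W (ball y (2 ^ Suc j * r))"
      using step[of "2 ^ j * r" y] r by (simp add: mult.assoc)
    finally show ?case .
  qed simp
  with D show ?thesis by blast
qed

text \<open>Jensen's inequality for the finite measure with masses \<open>q ^ j\<close>, obtained
  from Hoelder's inequality by splitting \<open>q ^ j\<close> into its powers \<open>1 / S'\<close>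
  and \<open>1 / S\<close>.\<close>

lemma suminf_geometric_powr_le:
  fixes F :: "nat \<Rightarrow> ennreal"
  assumes q: "0 < q" "q < 1" and S: "1 < S"
  shows "enn_powr (\<Sum>j. ennreal (q ^ j) * F j) S \<le>
    ennreal ((1 / (1 - q)) powr (S - 1)) * (\<Sum>j. ennreal (q ^ j) * enn_powr (F j) S)"
proof -
  define S' where "S' = S / (S - 1)"
  have S': "0 < S'" "1 / S' + 1 / S = 1" "S / S' = S - 1" using S by (auto simp: S'_def field_simps)
  have geo: "(\<Sum>j. ennreal (q ^ j)) = ennreal (1 / (1 - q))"
    using q by (intro suminf_ennreal_eq geometric_sums) auto
  have split: "ennreal (q ^ j) = enn_powr (ennreal (q ^ j)) (1 / S') * enn_powr (ennreal (q ^ j)) (1 / S)" for j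
    using q S' enn_powr_add[of "ennreal (q ^ j)" "1 / S'" "1 / S"] by simp
  have "(\<Sum>j. ennreal (q ^ j) * F j) =
      (\<integral>\<^sup>+j. enn_powr (ennreal (q ^ j)) (1 / S') * (enn_powr (ennreal (q ^ j)) (1 / S) * F j) \<partial>count_space UNIV)"
    unfolding nn_integral_count_space_nat by (subst split) (simp only: mult.assoc)
  also have "\<dots> \<le> enn_powr (\<integral>\<^sup>+j. enn_powr (enn_powr (ennreal (q ^ j)) (1 / S')) S' \<partial>count_space UNIV) (1 / S') *
      enn_powr (\<integral>\<^sup>+j. enn_powr (enn_powr (ennreal (q ^ j)) (1 / S) * F j) S \<partial>count_space UNIV) (1 / S)"
    by (rule nn_integral_Hoelder) (use S S' in auto)
  also have "\<dots> = enn_powr (ennreal (1 / (1 - q))) (1 / S') * enn_powr (\<Sum>j. ennreal (q ^ j) * enn_powr (F j) S) (1 / S)"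
    using S S' by (simp add: nn_integral_count_space_nat enn_powr_powr enn_powr_mult geo)
  finally have "enn_powr (\<Sum>j. ennreal (q ^ j) * F j) S \<le>
      enn_powr (enn_powr (ennreal (1 / (1 - q))) (1 / S') * enn_powr (\<Sum>j. ennreal (q ^ j) * enn_powr (F j) S) (1 / S)) S"
    using S by (intro enn_powr_mono) auto
  also have "\<dots> = ennreal ((1 / (1 - q)) powr (S - 1)) * (\<Sum>j. ennreal (q ^ j) * enn_powr (F j) S)"
  proof -
    have "((1 / (1 - q)) powr (1 / S')) powr S = (1 / (1 - q)) powr (S - 1)"
      using S' by (simp add: powr_powr)
    then show ?thesis using S q by (simp add: enn_powr_mult enn_powr_powr enn_powr_pos)
  qed
  finally show ?thesis .
qed

text \<open>Takes the place of Minkowski's inequality: a uniform bound for the norms and geometric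
  weights give \<open>K / (1 - q)\<close>, the constant that the triangle inequality would
  give.\<close>

lemma Lnorm_geometric_le:
  assumes q: "0 < q" "q < 1" and s: "1 < s" and K: "0 \<le> K"
    and [measurable]: "\<And>j. \<Phi> j \<in> borel_measurable M" and F [measurable]: "F \<in> borel_measurable M"
    and \<Phi>: "\<And>j. Lnorm s M (\<Phi> j) \<le> A"
    and le: "\<And>y. y \<in> space M \<Longrightarrow> F y \<le> ennreal K * (\<Sum>j. ennreal (q ^ j) * \<Phi> j y)"
  shows "Lnorm s M F \<le> ennreal (K / (1 - q)) * A"
proof -
  have geo: "(\<Sum>j. ennreal (q ^ j)) = ennreal (1 / (1 - q))"
    using q by (intro suminf_ennreal_eq geometric_sums) auto
  show ?thesis
  proof (cases s)
    case top
    have "AE y in M. \<forall>j. \<Phi> j y \<le> A"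
    proof (subst AE_all_countable, rule allI)
      fix j
      have "esssup M (\<Phi> j) \<le> A" using \<Phi>[of j] top by (simp add: Lnorm_def)
      then show "AE y in M. \<Phi> j y \<le> A" using esssup_AE[of "\<Phi> j" M] by (auto elim: eventually_mono)
    qed
    then have "AE y in M. F y \<le> ennreal (K / (1 - q)) * A"
    proof (rule AE_mp, intro AE_I2 impI)
      fix y assume y: "y \<in> space M" and "\<forall>j. \<Phi> j y \<le> A"
      have "F y \<le> ennreal K * (\<Sum>j. ennreal (q ^ j) * \<Phi> j y)" by (rule le[OF y])
      also have "\<dots> \<le> ennreal K * (\<Sum>j. ennreal (q ^ j) * A)"
        using \<open>\<forall>j. \<Phi> j y \<le> A\<close> by (intro mult_left_mono suminf_le) auto
      also have "\<dots> = ennreal (K / (1 - q)) * A"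
        using K q by (simp add: ennreal_suminf_multc geo mult.assoc[symmetric] ennreal_mult[symmetric])
      finally show "F y \<le> ennreal (K / (1 - q)) * A" .
    qed
    then have "esssup M F \<le> ennreal (K / (1 - q)) * A" by (intro esssup_I) auto
    then show ?thesis using top by (simp add: Lnorm_def)
  next
    case (real S)
    then have S: "1 < S" using s by (metis ennreal_1 ennreal_less_iff zero_le_one)
    have root: "enn_powr (enn_powr z (1 / S)) S = z" for z using S by (simp add: enn_powr_powr)
    have root': "enn_powr (enn_powr z S) (1 / S) = z" for z using S by (simp add: enn_powr_powr)
    have A: "(\<integral>\<^sup>+y. enn_powr (\<Phi> j y) S \<partial>M) \<le> enn_powr A S" for j
    proof -
      have "enn_powr (\<integral>\<^sup>+y. enn_powr (\<Phi> j y) S \<partial>M) (1 / S) \<le> A"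
        using \<Phi>[of j] S real by (simp add: Lnorm_ennreal)
      then have "enn_powr (enn_powr (\<integral>\<^sup>+y. enn_powr (\<Phi> j y) S \<partial>M) (1 / S)) S \<le> enn_powr A S"
        using S by (intro enn_powr_mono) auto
      then show ?thesis by (simp only: root)
    qed
    define c where "c = K powr S * (1 / (1 - q)) powr (S - 1)"
    have KS: "enn_powr (ennreal K) S = ennreal (K powr S)" using K S by (simp add: enn_powr_ennreal)
    have "(\<integral>\<^sup>+y. enn_powr (F y) S \<partial>M) \<le> (\<integral>\<^sup>+y. ennreal c * (\<Sum>j. ennreal (q ^ j) * enn_powr (\<Phi> j y) S) \<partial>M)"
    proof (rule nn_integral_mono)
      fix y assume y: "y \<in> space M"
      have "enn_powr (F y) S \<le> enn_powr (ennreal K * (\<Sum>j. ennreal (q ^ j) * \<Phi> j y)) S"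
        using S le[OF y] by (intro enn_powr_mono) auto
      also have "\<dots> = ennreal (K powr S) * enn_powr (\<Sum>j. ennreal (q ^ j) * \<Phi> j y) S"
        using S by (simp add: enn_powr_mult KS)
      also have "\<dots> \<le> ennreal (K powr S) * (ennreal ((1 / (1 - q)) powr (S - 1)) * (\<Sum>j. ennreal (q ^ j) * enn_powr (\<Phi> j y) S))"
        by (intro mult_left_mono suminf_geometric_powr_le q S) simp
      also have "\<dots> = ennreal c * (\<Sum>j. ennreal (q ^ j) * enn_powr (\<Phi> j y) S)"
        by (simp add: c_def ennreal_mult mult.assoc)
      finally show "enn_powr (F y) S \<le> ennreal c * (\<Sum>j. ennreal (q ^ j) * enn_powr (\<Phi> j y) S)" .
    qed
    also have "\<dots> = ennreal c * (\<Sum>j. ennreal (q ^ j) * (\<integral>\<^sup>+y. enn_powr (\<Phi> j y) S \<partial>M))"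
      by (subst nn_integral_cmult, measurable, subst nn_integral_suminf, measurable, subst nn_integral_cmult, measurable)
    also have "\<dots> \<le> ennreal c * (\<Sum>j. ennreal (q ^ j) * enn_powr A S)"
      by (intro mult_left_mono suminf_le A) auto
    also have "\<dots> = ennreal (c * (1 / (1 - q))) * enn_powr A S"
      using q by (subst ennreal_mult) (auto simp: c_def ennreal_suminf_multc geo mult.assoc)
    also have "c * (1 / (1 - q)) = (K / (1 - q)) powr S"
    proof -
      have "(1 / (1 - q)) powr (S - 1) * (1 / (1 - q)) = (1 / (1 - q)) powr S"
        using q powr_add[of "1 / (1 - q)" "S - 1" 1] by simp
      moreover have "(K / (1 - q)) powr S = K powr S * (1 / (1 - q)) powr S"
        using K q powr_mult[of K "1 / (1 - q)" S] by simp
      ultimately show ?thesis by (simp only: c_def mult.assoc)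
    qed
    also have "ennreal ((K / (1 - q)) powr S) * enn_powr A S = enn_powr (ennreal (K / (1 - q)) * A) S"
      using S K q by (simp add: enn_powr_mult enn_powr_ennreal)
    finally have "enn_powr (\<integral>\<^sup>+y. enn_powr (F y) S \<partial>M) (1 / S) \<le> enn_powr (enn_powr (ennreal (K / (1 - q)) * A) S) (1 / S)"
      using S by (intro enn_powr_mono) auto
    then show ?thesis using S real by (simp only: root') (simp add: Lnorm_ennreal)
  qed
qed

text \<open>The bound is the same for all \<open>x\<close> in the ball, so the far part may be
  treated as a constant there. For \<open>z\<close> in the shell between the radii
  \<open>2 ^ (j + 1) * \<rho>\<close> and \<open>2 ^ (j + 2) * \<rho>\<close> around
  \<open>y\<close>, replacing \<open>y\<close> by \<open>x\<close> loses at most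
  \<open>\<rho>\<close>, and a distance of at least \<open>2 ^ j * \<rho>\<close> remains.\<close>

lemma riesz_far_le:
  fixes g :: "real^'n \<Rightarrow> ennreal" and \<gamma> :: real
  assumes \<rho>: "0 < \<rho>" and \<gamma>: "\<gamma> < CARD('n)" and [measurable]: "g \<in> borel_measurable borel"
    and x: "x \<in> ball y \<rho>"
  shows "riesz \<gamma> (\<lambda>z. g z * indicator (- ball y (2 * \<rho>)) z) x \<le>
    (\<Sum>j. ennreal ((2 ^ j * \<rho>) powr (\<gamma> - CARD('n))) * (\<integral>\<^sup>+z\<in>ball y (2 ^ (j + 2) * \<rho>). g z \<partial>lborel))"
proof -
  have [measurable]: "ball y R \<in> sets borel" for R by simp
  have "ennreal (norm (x - z) powr (\<gamma> - CARD('n))) * (g z * indicator (- ball y (2 * \<rho>)) z) \<le>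
    (\<Sum>j. ennreal ((2 ^ j * \<rho>) powr (\<gamma> - CARD('n))) * (g z * indicator (ball y (2 ^ (j + 2) * \<rho>)) z))" for z
  proof (cases "z \<in> ball y (2 * \<rho>)")
    case False
    then have far: "2 * \<rho> \<le> dist y z" by simp
    define P where "P j \<longleftrightarrow> dist y z < 2 ^ (j + 2) * \<rho>" for j
    have "\<exists>j. P j"
    proof -
      obtain j where "dist y z / \<rho> < 2 ^ j" using real_arch_pow[of 2 "dist y z / \<rho>"] by auto
      then have "dist y z < 2 ^ j * \<rho>" using \<rho> by (simp add: field_simps)
      also have "\<dots> \<le> 2 ^ (j + 2) * \<rho>" using \<rho> by simp
      finally show ?thesis by (auto simp: P_def)
    qed
    define j where "j = (LEAST j. P j)"
    have Pj: "P j" unfolding j_def using \<open>\<exists>j. P j\<close> by (rule LeastI_ex)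
    have lower: "2 ^ (j + 1) * \<rho> \<le> dist y z"
    proof (cases j)
      case 0
      then show ?thesis using far by simp
    next
      case (Suc i)
      then have "\<not> P i" unfolding j_def using not_less_Least by (metis lessI)
      then show ?thesis using Suc by (simp add: P_def not_less)
    qed
    have "2 ^ j * \<rho> \<le> norm (x - z)"
    proof -
      have "dist y z \<le> dist y x + dist x z" by (rule dist_triangle)
      moreover have "dist y x < \<rho>" using x by simp
      moreover have "\<rho> \<le> 2 ^ j * \<rho>" using \<rho> by simp
      ultimately show ?thesis using lower by (simp add: dist_norm)
    qed
    then have "norm (x - z) powr (\<gamma> - CARD('n)) \<le> (2 ^ j * \<rho>) powr (\<gamma> - CARD('n))"
      using \<rho> \<gamma> by (intro powr_mono2') auto
    then have "ennreal (norm (x - z) powr (\<gamma> - CARD('n))) * (g z * indicator (- ball y (2 * \<rho>)) z) \<le>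
        ennreal ((2 ^ j * \<rho>) powr (\<gamma> - CARD('n))) * (g z * indicator (ball y (2 ^ (j + 2) * \<rho>)) z)"
      using False Pj by (simp add: P_def mult_right_mono ennreal_leI)
    also have "\<dots> \<le> (\<Sum>j. ennreal ((2 ^ j * \<rho>) powr (\<gamma> - CARD('n))) * (g z * indicator (ball y (2 ^ (j + 2) * \<rho>)) z))"
      by (rule ennreal_le_suminf[of "\<lambda>j. ennreal ((2 ^ j * \<rho>) powr (\<gamma> - CARD('n))) * (g z * indicator (ball y (2 ^ (j + 2) * \<rho>)) z)" j])
    finally show ?thesis .
  next
    case True
    then show ?thesis by (simp only: indicator_simps Compl_iff not_not mult_zero_right zero_le)
  qed
  then have "riesz \<gamma> (\<lambda>z. g z * indicator (- ball y (2 * \<rho>)) z) x \<le>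
    (\<integral>\<^sup>+z. (\<Sum>j. ennreal ((2 ^ j * \<rho>) powr (\<gamma> - CARD('n))) * (g z * indicator (ball y (2 ^ (j + 2) * \<rho>)) z)) \<partial>lborel)"
    unfolding riesz_def by (rule nn_integral_mono)
  also have "\<dots> = (\<Sum>j. ennreal ((2 ^ j * \<rho>) powr (\<gamma> - CARD('n))) * (\<integral>\<^sup>+z\<in>ball y (2 ^ (j + 2) * \<rho>). g z \<partial>lborel))"
    by (subst nn_integral_suminf, measurable, subst nn_integral_cmult, measurable)
  finally show ?thesis .
qed

lemma riesz_split:
  fixes g :: "real^'n \<Rightarrow> ennreal"
  assumes [measurable]: "g \<in> borel_measurable borel" "A \<in> sets borel"
  shows "riesz \<gamma> g x = riesz \<gamma> (\<lambda>z. g z * indicator A z) x + riesz \<gamma> (\<lambda>z. g z * indicator (- A) z) x"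
proof -
  have "riesz \<gamma> g x = (\<integral>\<^sup>+z. ennreal (norm (x - z) powr (\<gamma> - CARD('n))) * (g z * indicator A z) +
      ennreal (norm (x - z) powr (\<gamma> - CARD('n))) * (g z * indicator (- A) z) \<partial>lborel)"
    unfolding riesz_def by (intro nn_integral_cong) (auto simp: indicator_def)
  also have "\<dots> = riesz \<gamma> (\<lambda>z. g z * indicator A z) x + riesz \<gamma> (\<lambda>z. g z * indicator (- A) z) x"
    unfolding riesz_def by (rule nn_integral_add) measurable
  finally show ?thesis .
qed

lemma suminf_shift_le:
  fixes f :: "nat \<Rightarrow> ennreal"
  shows "(\<Sum>j. f (Suc j)) \<le> (\<Sum>j. f j)"
proof -
  have "(\<Sum>j<n. f (Suc j)) \<le> (\<Sum>j. f j)" for n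
  proof -
    have "(\<Sum>j<n. f (Suc j)) = (\<Sum>j\<in>Suc ` {..<n}. f j)" by (subst sum.reindex) auto
    also have "\<dots> \<le> (\<Sum>j. f j)" by (intro sum_le_suminf) auto
    finally show ?thesis .
  qed
  then show ?thesis by (subst suminf_eq_SUP) (rule SUP_least)
qed

text \<open>Complements \<open>enn_powr_mult\<close>: away from \<open>0\<close> and infinity the
  product rule holds for exponents of either sign, in particular for the exponent
  \<open>e \<le> 0\<close> of the ball masses.\<close>

lemma enn_powr_mult_pos:
  assumes "0 < c" "0 < x" "x < \<infinity>"
  shows "enn_powr (ennreal c * x) a = ennreal (c powr a) * enn_powr x a"
proof -
  obtain b where b: "x = ennreal b" "0 < b" using assms by (cases x) auto
  then have "ennreal c * x = ennreal (c * b)" using assms by (simp add: ennreal_mult)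
  then have "enn_powr (ennreal c * x) a = ennreal ((c * b) powr a)"
    using assms b by (simp only: enn_powr_pos mult_pos_pos)
  also have "(c * b) powr a = c powr a * b powr a" by (rule powr_mult)
  also have "ennreal (c powr a * b powr a) = ennreal (c powr a) * ennreal (b powr a)"
    by (rule ennreal_mult) auto
  finally show ?thesis using b by (simp add: enn_powr_pos)
qed

section \<open>The potential on a single ball: near part and far part\<close>

locale doubling_bump = bump_pair \<gamma> p r C\<^sub>0 w \<nu>
  for \<gamma> p r C\<^sub>0 :: real and w \<nu> :: "real^'n \<Rightarrow> real" +
  fixes e :: real
  assumes doubling: "Delta2 w" and nonzero: "\<not> (AE x in lebesgue. w x = 0)"
    and e: "e \<le> 0" "0 < e + 1 / p"
begin

text \<open>\<open>e\<close> stands for \<open>1 / \<alpha> - 1 / p - 1 / s\<close>; then this is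
  the function of \<open>y\<close> to which the outer norm of the amalgam space is applied at radius
  \<open>\<rho>\<close>. The estimates on balls see \<alpha> and s only through
  \<open>e\<close>.\<close>

definition \<Phi> :: "(real^'n \<Rightarrow> ennreal) \<Rightarrow> real^'n \<Rightarrow> real \<Rightarrow> ennreal" where
  "\<Phi> g y \<rho> = enn_powr (W (ball y \<rho>)) e * local_norm p \<nu> g y \<rho>"

definition far_sum :: "(real^'n \<Rightarrow> ennreal) \<Rightarrow> real^'n \<Rightarrow> real \<Rightarrow> ennreal" where
  "far_sum g y \<rho> = (\<Sum>j. ennreal ((2 ^ j * \<rho>) powr (\<gamma> - CARD('n))) * (\<integral>\<^sup>+z\<in>ball y (2 ^ (j + 2) * \<rho>). g z \<partial>lborel))"

lemma W_ball_pos: "0 < \<rho> \<Longrightarrow> 0 < W (ball y \<rho>)"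
  by (rule Delta2_ball_pos[OF w doubling nonzero])

lemma W_ball_finite: "W (ball y \<rho>) < \<infinity>"
  by (rule wmeasure_ball_finite[OF w])

text \<open>The reasoning of \<open>ball_estimate\<close> for the whole ball instead of a sparse
  subset: up to a power of the radius, the mass of the ball is dominated by the power of the bump
  integral that \<open>bump_local\<close> controls.\<close>

lemma ball_average_le:
  assumes \<rho>: "0 < \<rho>" and [measurable]: "g \<in> borel_measurable borel"
  shows "enn_powr (W (ball y \<rho>)) (1 / p) * (\<integral>\<^sup>+z\<in>ball y \<rho>. g z \<partial>lborel) \<le>
    ennreal (max 1 C\<^sub>0 * (2 * \<rho>) powr (CARD('n) - \<gamma>)) * local_norm p \<nu> g y \<rho>"
proof -
  have g_leb: "g \<in> borel_measurable lebesgue"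
    by (rule measurable_completion) simp
  define n where "n = real CARD('n)"
  define L where "L = 2 * \<rho>"
  define I where "I = bump_integral y L"
  define \<delta> where "\<delta> = 1 - 1 / r"
  define d where "d = n / (r * p) + n * (p - 1) / p - \<gamma>"
  define C where "C = max 1 C\<^sub>0"
  have pos: "0 < \<delta>" "0 < L" "0 < C" using r \<rho> by (auto simp: \<delta>_def L_def C_def)
  have ball_cube: "ball y \<rho> \<subseteq> cube y L"
  proof -
    have "cball y \<rho> \<subseteq> cube y L" by (rule cball_subset_cube) (simp add: L_def)
    then show ?thesis using ball_subset_cball[of y \<rho>] by (rule subset_trans[rotated])
  qed
  have "W (ball y \<rho>) \<le> enn_powr I (1 / r) * enn_powr (emeasure lborel (ball y \<rho>)) \<delta>"
    unfolding I_def \<delta>_def by (rule wmeasure_le_bump_integral[OF _ ball_cube]) simp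
  also have "enn_powr (emeasure lborel (ball y \<rho>)) \<delta> \<le> enn_powr (ennreal (L powr n)) \<delta>"
    using emeasure_mono[OF ball_cube, of lborel] emeasure_lborel_cube[of L y] pos
    by (simp add: enn_powr_mono n_def powr_realpow)
  also have "enn_powr (ennreal (L powr n)) \<delta> = ennreal (L powr (n * \<delta>))"
    using pos by (simp add: enn_powr_pos powr_powr)
  finally have "W (ball y \<rho>) \<le> enn_powr I (1 / r) * ennreal (L powr (n * \<delta>))"
    by (simp add: mult_left_mono)
  then have "enn_powr (W (ball y \<rho>)) (1 / p) \<le> enn_powr (enn_powr I (1 / r) * ennreal (L powr (n * \<delta>))) (1 / p)"
    using p by (intro enn_powr_mono) auto
  also have "\<dots> = enn_powr I (1 / (r * p)) * ennreal (L powr (n * \<delta> / p))"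
    using p pos by (simp add: enn_powr_mult enn_powr_powr enn_powr_pos powr_powr)
  finally have "enn_powr (W (ball y \<rho>)) (1 / p) * (\<integral>\<^sup>+z\<in>ball y \<rho>. g z \<partial>lborel) \<le>
      enn_powr I (1 / (r * p)) * ennreal (L powr (n * \<delta> / p)) * (\<integral>\<^sup>+z\<in>ball y \<rho>. g z \<partial>lborel)"
    by (rule mult_right_mono) simp
  also have "\<dots> = ennreal (L powr (n * \<delta> / p)) * (enn_powr I (1 / (r * p)) * (\<integral>\<^sup>+z\<in>ball y \<rho>. g z \<partial>lebesgue))"
    by (simp add: nn_integral_completion mult_ac)
  also have "\<dots> \<le> ennreal (L powr (n * \<delta> / p)) * (ennreal C\<^sub>0 * ennreal (L powr d) * local_norm p \<nu> g y \<rho>)"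
    unfolding I_def d_def n_def local_norm_def energy_def[symmetric]
    by (intro mult_left_mono bump_local[OF pos(2) ball_cube] g_leb) auto
  also have "\<dots> \<le> ennreal (L powr (n * \<delta> / p)) * (ennreal C * ennreal (L powr d) * local_norm p \<nu> g y \<rho>)"
    by (intro mult_left_mono mult_right_mono ennreal_leI) (auto simp: C_def)
  also have "\<dots> = ennreal (C * (L powr (n * \<delta> / p) * L powr d)) * local_norm p \<nu> g y \<rho>"
    using pos by (simp add: ennreal_mult mult_ac)
  also have "L powr (n * \<delta> / p) * L powr d = L powr (n - \<gamma>)"
  proof -
    have "n * \<delta> / p + d = n - \<gamma>"
      using p r by (simp add: d_def \<delta>_def field_simps)
    then show ?thesis by (simp add: powr_add[symmetric])
  qed
  finally show ?thesis by (simp add: C_def L_def n_def)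
qed

text \<open>As \<open>e + 1 / p > 0\<close>, reverse doubling makes the power of the mass of
  \<open>ball y \<rho>\<close> geometrically small against that of the dilated ball. On the dilated
  ball this power splits into the exponent \<open>e\<close>, which is the weight in
  \<open>\<Phi>\<close>, and \<open>1 / p\<close>, which \<open>ball_average_le\<close>
  consumes.\<close>

lemma far_sum_le:
  "\<exists>K q. 0 < K \<and> 0 < q \<and> q < 1 \<and> (\<forall>g\<in>borel_measurable borel. \<forall>y. \<forall>\<rho>>0.
    enn_powr (W (ball y \<rho>)) (e + 1 / p) * far_sum g y \<rho> \<le> ennreal K * (\<Sum>j. ennreal (q ^ j) * \<Phi> g y (2 ^ (j + 1) * \<rho>)))"
proof -
  obtain D where D: "1 < D" and rev: "\<And>y r j. 0 < r \<Longrightarrow> ennreal (D ^ j) * W (ball y r) \<le> W (ball y (2 ^ j * r))"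
    using reverse_doubling[OF doubling] by blast
  define \<theta> where "\<theta> = e + 1 / p"
  define q where "q = D powr - \<theta>"
  \<comment> \<open>\<open>8\<close> because the cube around a ball of radius
    \<open>2 ^ (j + 2) * \<rho>\<close> has side \<open>8 * (2 ^ j * \<rho>)\<close>, while the
    kernel is evaluated at \<open>2 ^ j * \<rho>\<close>.\<close>
  define K where "K = max 1 C\<^sub>0 * 8 powr (CARD('n) - \<gamma>)"
  have \<theta>: "0 < \<theta>" using e by (simp add: \<theta>_def)
  have q: "0 < q" "q < 1" using D \<theta> by (auto simp: q_def powr_less_one)
  have K: "0 < K" by (simp add: K_def)
  show ?thesis
  proof (rule exI[of _ K], rule exI[of _ q], intro conjI K q ballI allI impI)
    fix g :: "real^'n \<Rightarrow> ennreal" and y and \<rho> :: real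
    assume [measurable]: "g \<in> borel_measurable borel" and \<rho>: "0 < \<rho>"
    have term_le: "enn_powr (W (ball y \<rho>)) \<theta> *
        (ennreal ((2 ^ j * \<rho>) powr (\<gamma> - CARD('n))) * (\<integral>\<^sup>+z\<in>ball y (2 ^ (j + 2) * \<rho>). g z \<partial>lborel)) \<le>
      ennreal K * (ennreal (q ^ Suc j) * \<Phi> g y (2 ^ (Suc j + 1) * \<rho>))" for j
    proof -
      define R where "R = 2 ^ (j + 2) * \<rho>"
      define J where "J = (\<integral>\<^sup>+z\<in>ball y R. g z \<partial>lborel)"
      define c where "c = (2 ^ j * \<rho>) powr (\<gamma> - CARD('n))"
      have R: "0 < R" using \<rho> by (simp add: R_def)
      \<comment> \<open>The dilation by \<open>2 ^ (j + 2)\<close> yields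
        \<open>D ^ (j + 2)\<close>; one factor is given away so that the power of \<open>q\<close>
        carries the index \<open>Suc j\<close> of the radius
        \<open>2 ^ (Suc j + 1) * \<rho>\<close>, and the sum can then be shifted.\<close>
      have "ennreal (D ^ Suc j) * W (ball y \<rho>) \<le> ennreal (D ^ (j + 2)) * W (ball y \<rho>)"
        using D by (intro mult_right_mono ennreal_leI power_increasing) auto
      also have "\<dots> \<le> W (ball y R)" unfolding R_def by (rule rev[OF \<rho>])
      finally have "enn_powr (ennreal (D ^ Suc j) * W (ball y \<rho>)) \<theta> \<le> enn_powr (W (ball y R)) \<theta>"
        using \<theta> by (intro enn_powr_mono) auto
      then have "ennreal ((D ^ Suc j) powr \<theta>) * enn_powr (W (ball y \<rho>)) \<theta> \<le> enn_powr (W (ball y R)) \<theta>"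
        using D W_ball_pos[of \<rho> y] W_ball_finite[of y \<rho>] \<rho> by (simp add: enn_powr_mult_pos del: power_Suc)
      then have "ennreal (q ^ Suc j) * (ennreal ((D ^ Suc j) powr \<theta>) * enn_powr (W (ball y \<rho>)) \<theta>) \<le>
          ennreal (q ^ Suc j) * enn_powr (W (ball y R)) \<theta>"
        by (rule mult_left_mono) simp
      moreover have "ennreal (q ^ Suc j) * ennreal ((D ^ Suc j) powr \<theta>) = 1"
      proof -
        have "q ^ Suc j = D powr (- \<theta> * Suc j)" "(D ^ Suc j) powr \<theta> = D powr (\<theta> * Suc j)"
          using D by (simp_all only: q_def powr_powr powr_realpow[symmetric] powr_gt_zero mult.commute)
        then show ?thesis
          using D by (simp add: ennreal_mult[symmetric] powr_add[symmetric] del: power_Suc)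
      qed
      ultimately have "enn_powr (W (ball y \<rho>)) \<theta> \<le> ennreal (q ^ Suc j) * enn_powr (W (ball y R)) \<theta>"
        by (simp add: mult.assoc[symmetric] del: power_Suc)
      also have "enn_powr (W (ball y R)) \<theta> = enn_powr (W (ball y R)) e * enn_powr (W (ball y R)) (1 / p)"
        unfolding \<theta>_def by (rule enn_powr_add[OF W_ball_pos[OF R] W_ball_finite])
      finally have "enn_powr (W (ball y \<rho>)) \<theta> * (ennreal c * J) \<le>
          ennreal (q ^ Suc j) * (enn_powr (W (ball y R)) e * enn_powr (W (ball y R)) (1 / p)) * (ennreal c * J)"
        by (rule mult_right_mono) simp
      also have "\<dots> = ennreal (q ^ Suc j) * enn_powr (W (ball y R)) e * (ennreal c * (enn_powr (W (ball y R)) (1 / p) * J))"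
        by (simp only: mult_ac)
      also have "\<dots> \<le> ennreal (q ^ Suc j) * enn_powr (W (ball y R)) e *
          (ennreal c * (ennreal (max 1 C\<^sub>0 * (2 * R) powr (CARD('n) - \<gamma>)) * local_norm p \<nu> g y R))"
        unfolding J_def by (intro mult_left_mono ball_average_le R) auto
      also have "\<dots> = (ennreal c * ennreal (max 1 C\<^sub>0 * (2 * R) powr (CARD('n) - \<gamma>))) *
          (ennreal (q ^ Suc j) * (enn_powr (W (ball y R)) e * local_norm p \<nu> g y R))"
        by (simp only: mult_ac)
      also have "ennreal c * ennreal (max 1 C\<^sub>0 * (2 * R) powr (CARD('n) - \<gamma>)) = ennreal K"
      proof -
        have "2 * R = 8 * (2 ^ j * \<rho>)" by (simp add: R_def)
        then have "(2 * R) powr (CARD('n) - \<gamma>) = 8 powr (CARD('n) - \<gamma>) * (2 ^ j * \<rho>) powr (CARD('n) - \<gamma>)"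
          using \<rho> by (simp only:) (subst powr_mult, auto)
        moreover have "c * (2 ^ j * \<rho>) powr (CARD('n) - \<gamma>) = 1"
          using \<rho> by (simp add: c_def powr_add[symmetric])
        ultimately have "c * (max 1 C\<^sub>0 * (2 * R) powr (CARD('n) - \<gamma>)) = K"
          unfolding K_def by (simp add: mult.left_commute)
        then show ?thesis by (subst ennreal_mult[symmetric]) (auto simp: c_def)
      qed
      finally show ?thesis by (simp add: c_def J_def R_def \<Phi>_def mult.assoc)
    qed
    have "enn_powr (W (ball y \<rho>)) (e + 1 / p) * far_sum g y \<rho> = (\<Sum>j. enn_powr (W (ball y \<rho>)) \<theta> *
        (ennreal ((2 ^ j * \<rho>) powr (\<gamma> - CARD('n))) * (\<integral>\<^sup>+z\<in>ball y (2 ^ (j + 2) * \<rho>). g z \<partial>lborel)))"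
      by (simp only: far_sum_def \<theta>_def ennreal_suminf_cmult)
    also have "\<dots> \<le> (\<Sum>j. ennreal K * (ennreal (q ^ Suc j) * \<Phi> g y (2 ^ (Suc j + 1) * \<rho>)))"
      by (intro suminf_le term_le) auto
    also have "\<dots> \<le> (\<Sum>j. ennreal K * (ennreal (q ^ j) * \<Phi> g y (2 ^ (j + 1) * \<rho>)))"
      by (rule suminf_shift_le)
    finally show "enn_powr (W (ball y \<rho>)) (e + 1 / p) * far_sum g y \<rho> \<le>
        ennreal K * (\<Sum>j. ennreal (q ^ j) * \<Phi> g y (2 ^ (j + 1) * \<rho>))"
      by (simp only: ennreal_suminf_cmult)
  qed
qed

lemma WLnorm_riesz_near_le:
  "\<exists>K>0. \<forall>g\<in>borel_measurable borel. \<forall>y \<rho>. \<forall>t>0.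
    ennreal t * enn_powr (W {x. ennreal t < riesz \<gamma> (\<lambda>z. g z * indicator (ball y \<rho>) z) x}) (1 / p) \<le>
      ennreal K * local_norm p \<nu> g y \<rho>"
proof -
  obtain C where C: "0 < C" and weak: "\<And>g t. g \<in> borel_measurable borel \<Longrightarrow> 0 < t \<Longrightarrow>
    ennreal (t powr p) * W {x. ennreal t < riesz \<gamma> g x} \<le>
      ennreal C * energy g UNIV"
    using riesz_weak_type by blast
  show ?thesis
  proof (intro exI[of _ "C powr (1 / p)"] conjI ballI allI impI)
    show "0 < C powr (1 / p)" using C by simp
    fix g :: "real^'n \<Rightarrow> ennreal" and y :: "real^'n" and \<rho> t :: real
    assume [measurable]: "g \<in> borel_measurable borel" and t: "0 < t"
    have [measurable]: "ball y \<rho> \<in> sets borel" by simp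
    let ?Z = "W {x. ennreal t < riesz \<gamma> (\<lambda>z. g z * indicator (ball y \<rho>) z) x}"
    have "ennreal (t powr p) * ?Z \<le> ennreal C * energy (\<lambda>z. g z * indicator (ball y \<rho>) z) UNIV"
      by (rule weak[OF _ t]) measurable
    also have "energy (\<lambda>z. g z * indicator (ball y \<rho>) z) UNIV =
        energy g (ball y \<rho>)"
      unfolding energy_def using p by (intro nn_integral_cong) (simp add: enn_powr_indicator_mult mult_ac)
    finally have "enn_powr (ennreal (t powr p) * ?Z) (1 / p) \<le>
        enn_powr (ennreal C * energy g (ball y \<rho>)) (1 / p)"
      using p by (intro enn_powr_mono) auto
    then show "ennreal t * enn_powr ?Z (1 / p) \<le> ennreal (C powr (1 / p)) * local_norm p \<nu> g y \<rho>"
      using p t C by (simp add: enn_powr_mult enn_powr_pos powr_powr local_norm_def energy_def)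
  qed
qed

text \<open>On the ball the far part is at most the constant \<open>\<tau>\<close>. Levels up to
  \<open>2 * c * \<tau>\<close> are paid for by the full mass of the ball. At higher levels the far
  part supplies at most half of \<open>t\<close>, so the near part exceeds
  \<open>t / (2 * c)\<close>, and the weak type inequality applies to it.\<close>

lemma WLnorm_ball_le:
  assumes c: "0 < c"
  shows "\<exists>K q. 0 < K \<and> 0 < q \<and> q < 1 \<and> (\<forall>g\<in>borel_measurable borel. \<forall>F\<in>borel_measurable lebesgue.
    (AE x in lebesgue. F x \<le> ennreal c * riesz \<gamma> g x) \<longrightarrow> (\<forall>y. \<forall>\<rho>>0.
      enn_powr (W (ball y \<rho>)) e * WLnorm p (wmeasure w) (\<lambda>x. F x * indicator (ball y \<rho>) x) \<le>
        ennreal K * (\<Sum>j. ennreal (q ^ j) * \<Phi> g y (2 ^ (j + 1) * \<rho>))))"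
proof -
  obtain K\<^sub>1 where K\<^sub>1: "0 < K\<^sub>1" and near: "\<And>g y \<rho> t. g \<in> borel_measurable borel \<Longrightarrow> 0 < t \<Longrightarrow>
    ennreal t * enn_powr (W {x. ennreal t < riesz \<gamma> (\<lambda>z. g z * indicator (ball y \<rho>) z) x}) (1 / p) \<le>
      ennreal K\<^sub>1 * local_norm p \<nu> g y \<rho>"
    using WLnorm_riesz_near_le by blast
  obtain K\<^sub>2 q where q: "0 < K\<^sub>2" "0 < q" "q < 1" and far: "\<And>g y \<rho>. g \<in> borel_measurable borel \<Longrightarrow> 0 < \<rho> \<Longrightarrow>
    enn_powr (W (ball y \<rho>)) (e + 1 / p) * far_sum g y \<rho> \<le> ennreal K\<^sub>2 * (\<Sum>j. ennreal (q ^ j) * \<Phi> g y (2 ^ (j + 1) * \<rho>))"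
    using far_sum_le by blast
  obtain C where C: "0 < C" and dbl: "\<And>y r. 0 < r \<Longrightarrow> W (ball y (2 * r)) \<le> ennreal C * W (ball y r)"
    using doubling by (auto simp: Delta2_def)
  define K where "K = 2 * c * K\<^sub>1 * C powr - e + 2 * c * K\<^sub>2"
  have K: "0 < K" using c K\<^sub>1 q C by (simp add: K_def add_pos_pos)
  show ?thesis
  proof (rule exI[of _ K], rule exI[of _ q], intro conjI K q ballI allI impI)
    fix g F :: "real^'n \<Rightarrow> ennreal" and y and \<rho> :: real
    assume g [measurable]: "g \<in> borel_measurable borel" and F [measurable]: "F \<in> borel_measurable lebesgue"
      and F_le: "AE x in lebesgue. F x \<le> ennreal c * riesz \<gamma> g x" and \<rho>: "0 < \<rho>"
    define S where "S = (\<Sum>j. ennreal (q ^ j) * \<Phi> g y (2 ^ (j + 1) * \<rho>))"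
    define \<tau> where "\<tau> = far_sum g y \<rho>"
    define N where "N = local_norm p \<nu> g y (2 * \<rho>)"
    let ?B = "ball y \<rho>"
    have W_AE: "AE x in wmeasure w. F x \<le> ennreal c * riesz \<gamma> g x"
      unfolding wmeasure_def using F_le weight_measurable[OF w]
      by (subst AE_density) (auto elim: eventually_mono)
    have ball_meas [measurable]: "ball y (2 * \<rho>) \<in> sets borel" by simp
    have level: "ennreal t * enn_powr (W {x \<in> space (wmeasure w). F x * indicator ?B x > ennreal t}) (1 / p) \<le>
        ennreal (2 * c * K\<^sub>1) * N + ennreal (2 * c) * (\<tau> * enn_powr (W ?B) (1 / p))" if t: "0 < t" for t
    proof -
      let ?X = "{x \<in> space (wmeasure w). F x * indicator ?B x > ennreal t}"
      have X: "?X \<subseteq> ?B" by (auto simp: indicator_def split: if_splits)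
      show ?thesis
      proof (cases "ennreal t \<le> ennreal (2 * c) * \<tau>")
        case True
        have "enn_powr (W ?X) (1 / p) \<le> enn_powr (W ?B) (1 / p)"
          using p X by (intro enn_powr_mono emeasure_mono) auto
        then have "ennreal t * enn_powr (W ?X) (1 / p) \<le> (ennreal (2 * c) * \<tau>) * enn_powr (W ?B) (1 / p)"
          using True by (intro mult_mono) auto
        then show ?thesis by (simp add: mult.assoc add_increasing)
      next
        case False
        let ?Y = "{x. ennreal (t / (2 * c)) < riesz \<gamma> (\<lambda>z. g z * indicator (ball y (2 * \<rho>)) z) x}"
        have Y_meas: "?Y \<in> sets borel" by measurable
        have "AE x in wmeasure w. x \<in> ?X \<longrightarrow> x \<in> ?Y"
          using W_AE
        proof eventually_elim
          case (elim x)
          show ?case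
          proof
            assume x: "x \<in> ?X"
            then have xB: "x \<in> ?B" and "ennreal t < F x" by (cases "x \<in> ?B"; simp)+
            from this(2) elim have lt: "ennreal t < ennreal c * riesz \<gamma> g x" by (rule less_le_trans)
            define a where "a = riesz \<gamma> (\<lambda>z. g z * indicator (ball y (2 * \<rho>)) z) x"
            have "riesz \<gamma> g x \<le> a + \<tau>"
              using riesz_far_le[OF \<rho> \<gamma>(2) g xB] unfolding a_def \<tau>_def far_sum_def
              by (subst riesz_split[OF g ball_meas]) (rule add_left_mono)
            then have "ennreal c * riesz \<gamma> g x \<le> ennreal c * a + ennreal c * \<tau>"
              by (simp add: distrib_left[symmetric] mult_left_mono)
            then have lt2: "ennreal t < ennreal c * a + ennreal c * \<tau>" using lt by (rule less_le_trans[rotated])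
            show "x \<in> ?Y"
            proof (rule ccontr)
              assume "x \<notin> ?Y"
              then have "a \<le> ennreal (t / (2 * c))" by (simp add: a_def)
              then have "ennreal c * a \<le> ennreal c * ennreal (t / (2 * c))" by (rule mult_left_mono) simp
              also have "\<dots> = ennreal (t / 2)" using c t by (simp add: ennreal_mult[symmetric])
              finally have 1: "ennreal c * a \<le> ennreal (t / 2)" .
              have "ennreal (1 / 2) * (ennreal (2 * c) * \<tau>) \<le> ennreal (1 / 2) * ennreal t"
                using False by (intro mult_left_mono) auto
              also have "ennreal (1 / 2) * (ennreal (2 * c) * \<tau>) = ennreal c * \<tau>"
                using c by (subst mult.assoc[symmetric], subst ennreal_mult[symmetric]) auto
              also have "ennreal (1 / 2) * ennreal t = ennreal (t / 2)"
                using t by (subst ennreal_mult[symmetric]) auto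
              finally have "ennreal c * a + ennreal c * \<tau> \<le> ennreal (t / 2) + ennreal (t / 2)"
                using 1 by (intro add_mono)
              also have "\<dots> = ennreal t" using t by (simp add: ennreal_plus[symmetric] del: ennreal_plus)
              finally show False using lt2 by simp
            qed
          qed
        qed
        then have "W ?X \<le> W ?Y" using Y_meas by (intro emeasure_mono_AE) auto
        then have "ennreal t * enn_powr (W ?X) (1 / p) \<le> ennreal t * enn_powr (W ?Y) (1 / p)"
          using p by (intro mult_left_mono enn_powr_mono) auto
        also have "\<dots> = ennreal (2 * c) * (ennreal (t / (2 * c)) * enn_powr (W ?Y) (1 / p))"
          using c t by (simp add: mult.assoc[symmetric] ennreal_mult[symmetric])
        also have "\<dots> \<le> ennreal (2 * c) * (ennreal K\<^sub>1 * N)"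
          unfolding N_def using c t by (intro mult_left_mono near g) auto
        also have "\<dots> = ennreal (2 * c * K\<^sub>1) * N" using c K\<^sub>1 by (simp add: ennreal_mult mult.assoc)
        finally show ?thesis by (simp add: add_increasing2)
      qed
    qed
    have "WLnorm p (wmeasure w) (\<lambda>x. F x * indicator ?B x) \<le>
        ennreal (2 * c * K\<^sub>1) * N + ennreal (2 * c) * (\<tau> * enn_powr (W ?B) (1 / p))"
      unfolding WLnorm_def by (intro SUP_least level) simp
    then have "enn_powr (W ?B) e * WLnorm p (wmeasure w) (\<lambda>x. F x * indicator ?B x) \<le>
        enn_powr (W ?B) e * (ennreal (2 * c * K\<^sub>1) * N + ennreal (2 * c) * (\<tau> * enn_powr (W ?B) (1 / p)))"
      by (rule mult_left_mono) simp
    also have "\<dots> = ennreal (2 * c * K\<^sub>1) * (enn_powr (W ?B) e * N) +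
        ennreal (2 * c) * ((enn_powr (W ?B) e * enn_powr (W ?B) (1 / p)) * \<tau>)"
      by (simp only: distrib_left mult_ac)
    also have "enn_powr (W ?B) e * enn_powr (W ?B) (1 / p) = enn_powr (W ?B) (e + 1 / p)"
      by (rule enn_powr_add[symmetric, OF W_ball_pos[OF \<rho>] W_ball_finite])
    also have "ennreal (2 * c * K\<^sub>1) * (enn_powr (W ?B) e * N) + ennreal (2 * c) * (enn_powr (W ?B) (e + 1 / p) * \<tau>) \<le>
        ennreal (2 * c * K\<^sub>1) * (ennreal (C powr - e) * S) + ennreal (2 * c) * (ennreal K\<^sub>2 * S)"
    proof (intro add_mono mult_left_mono)
      show "enn_powr (W ?B) (e + 1 / p) * \<tau> \<le> ennreal K\<^sub>2 * S"
        unfolding \<tau>_def S_def by (rule far[OF g \<rho>])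
      \<comment> \<open>The near part is measured on the doubled ball, whose mass must therefore
        replace that of \<open>?B\<close>. Since \<open>e \<le> 0\<close>, the doubling inequality
        turns round under the power \<open>e\<close> and costs \<open>C powr - e\<close>. What
        results is the term \<open>j = 0\<close> of \<open>S\<close>.\<close>
      have "enn_powr (ennreal C * W ?B) e \<le> enn_powr (W (ball y (2 * \<rho>))) e"
        by (rule enn_powr_antimono[OF e(1) dbl[OF \<rho>]])
      then have "ennreal (C powr - e) * enn_powr (ennreal C * W ?B) e \<le> ennreal (C powr - e) * enn_powr (W (ball y (2 * \<rho>))) e"
        by (rule mult_left_mono) simp
      moreover have "ennreal (C powr - e) * enn_powr (ennreal C * W ?B) e = enn_powr (W ?B) e"
        using C W_ball_pos[of \<rho> y] W_ball_finite[of y \<rho>] \<rho>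
        by (simp add: enn_powr_mult_pos mult.assoc[symmetric] ennreal_mult[symmetric] powr_add[symmetric])
      ultimately have "enn_powr (W ?B) e * N \<le> ennreal (C powr - e) * enn_powr (W (ball y (2 * \<rho>))) e * N"
        by (simp add: mult_right_mono)
      also have "\<dots> = ennreal (C powr - e) * (ennreal (q ^ 0) * \<Phi> g y (2 ^ (0 + 1) * \<rho>))"
        by (simp add: \<Phi>_def N_def mult.assoc)
      also have "\<dots> \<le> ennreal (C powr - e) * S"
        unfolding S_def by (intro mult_left_mono ennreal_le_suminf[of "\<lambda>j. ennreal (q ^ j) * \<Phi> g y (2 ^ (j + 1) * \<rho>)" 0]) simp
      finally show "enn_powr (W ?B) e * N \<le> ennreal (C powr - e) * S" .
    qed simp_all
    also have "\<dots> = ennreal K * S"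
      unfolding K_def using c K\<^sub>1 q C
      by (subst ennreal_plus) (auto simp: ennreal_mult distrib_right mult.assoc)
    finally show "enn_powr (W ?B) e * WLnorm p (wmeasure w) (\<lambda>x. F x * indicator ?B x) \<le>
        ennreal K * (\<Sum>j. ennreal (q ^ j) * \<Phi> g y (2 ^ (j + 1) * \<rho>))"
      by (simp add: S_def)
  qed
qed

end

section \<open>Almost everywhere finiteness of the potential\<close>

lemma measurable_wmeasure:
  assumes "f \<in> borel_measurable borel"
  shows "f \<in> borel_measurable (wmeasure \<mu>)"
proof -
  have "f \<in> borel_measurable lebesgue" using assms by (intro measurable_completion) simp
  then show ?thesis by (simp add: measurable_def)
qed

lemma Lnorm_finite_AE:
  assumes s: "0 < s" and [measurable]: "F \<in> borel_measurable M" and fin: "Lnorm s M F < \<infinity>"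
  shows "AE y in M. F y < \<infinity>"
proof (cases s)
  case top
  then have "esssup M F < \<infinity>" using fin by (simp add: Lnorm_def)
  with esssup_AE[of F M] show ?thesis by (auto elim!: eventually_mono)
next
  case (real S)
  then have S: "0 < S" using s by auto
  have "(\<integral>\<^sup>+y. enn_powr (F y) S \<partial>M) \<noteq> \<infinity>"
    using fin S real enn_powr_eq_top_iff[of "1 / S"] by (auto simp: Lnorm_ennreal)
  then have "AE y in M. enn_powr (F y) S \<noteq> \<infinity>" by (intro nn_integral_PInf_AE) auto
  then show ?thesis
  proof eventually_elim
    case (elim y)
    then have "F y \<noteq> \<infinity>" using enn_powr_eq_top_iff[OF S, of "F y"] by blast
    then show ?case by (simp add: less_top[symmetric])
  qed
qed

text \<open>The layer of scale \<open>l / 2 ^ j\<close> contributes at most a multiple of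
  \<open>(l / 2 ^ j) powr \<gamma>\<close>, which is geometric in \<open>j\<close> because
  \<open>\<gamma> > 0\<close>; the bound is uniform in the pole.\<close>

lemma nn_integral_riesz_kernel_finite:
  fixes \<gamma> :: real
  assumes \<gamma>: "0 < \<gamma>" "\<gamma> < CARD('n)" and l: "0 < l"
  shows "\<exists>C. \<forall>x::real^'n.
    (\<integral>\<^sup>+y. ennreal (norm (x - y) powr (\<gamma> - CARD('n))) * indicator {y. dist x y < l} y \<partial>lborel) \<le> ennreal C"
proof (intro exI allI)
  fix x :: "real^'n"
  define c where "c = (2::real) powr (CARD('n) - \<gamma>)"
  define q where "q = (2::real) powr - \<gamma>"
  have q: "0 < q" "q < 1" using \<gamma> by (auto simp: q_def powr_less_one)
  have "(\<integral>\<^sup>+y. ennreal (norm (x - y) powr (\<gamma> - CARD('n))) * indicator {y. dist x y < l} y \<partial>lborel) \<le>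
    (\<integral>\<^sup>+y. ennreal c * (\<Sum>j. ennreal ((l / 2 ^ j) powr (\<gamma> - CARD('n))) * indicator (neighbours (l / 2 ^ j) x) y) \<partial>lborel)"
    unfolding c_def by (intro nn_integral_mono truncated_kernel_le l \<gamma>)
  also have "\<dots> = ennreal c * (\<Sum>j. ennreal ((l / 2 ^ j) powr (\<gamma> - CARD('n))) * emeasure lborel (neighbours (l / 2 ^ j) x))"
    by (subst nn_integral_cmult, measurable, subst nn_integral_suminf, measurable) (simp add: nn_integral_cmult)
  also have "\<dots> \<le> ennreal c * (\<Sum>j. ennreal (3 ^ CARD('n) * l powr \<gamma> * q ^ j))"
  proof (intro mult_left_mono suminf_le)
    fix j :: nat
    define h where "h = l / 2 ^ j"
    have h: "0 < h" using l by (simp add: h_def)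
    have "ennreal (h powr (\<gamma> - CARD('n))) * emeasure lborel (neighbours h x) \<le>
        ennreal (h powr (\<gamma> - CARD('n))) * ennreal ((3 * h) ^ CARD('n))"
      by (intro mult_left_mono emeasure_neighbours h) simp
    also have "\<dots> = ennreal (3 ^ CARD('n) * (h powr (\<gamma> - CARD('n)) * h ^ CARD('n)))"
      using h by (simp add: ennreal_mult[symmetric] power_mult_distrib mult_ac)
    also have "h powr (\<gamma> - CARD('n)) * h ^ CARD('n) = h powr \<gamma>"
      using h by (simp add: powr_diff powr_realpow)
    also have "h powr \<gamma> = l powr \<gamma> * q ^ j"
    proof -
      have "(2 ^ j :: real) powr - \<gamma> = q ^ j"
        by (simp add: q_def powr_powr mult.commute flip: powr_realpow)
      moreover have "h powr \<gamma> = l powr \<gamma> / (2 ^ j) powr \<gamma>"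
        using l unfolding h_def by (subst powr_divide) auto
      ultimately show ?thesis by (simp add: powr_minus divide_inverse)
    qed
    finally show "ennreal ((l / 2 ^ j) powr (\<gamma> - CARD('n))) * emeasure lborel (neighbours (l / 2 ^ j) x) \<le>
        ennreal (3 ^ CARD('n) * l powr \<gamma> * q ^ j)"
      by (simp add: h_def mult.assoc)
  qed auto
  also have "(\<Sum>j. ennreal (3 ^ CARD('n) * l powr \<gamma> * q ^ j)) = ennreal (3 ^ CARD('n) * l powr \<gamma> * (1 / (1 - q)))"
    using q by (intro suminf_ennreal_eq sums_mult geometric_sums) auto
  also have "ennreal c * \<dots> = ennreal (c * (3 ^ CARD('n) * l powr \<gamma> * (1 / (1 - q))))"
    using q by (subst ennreal_mult) (auto simp: c_def)
  finally show "(\<integral>\<^sup>+y. ennreal (norm (x - y) powr (\<gamma> - CARD('n))) * indicator {y. dist x y < l} y \<partial>lborel) \<le>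
    ennreal (2 powr (CARD('n) - \<gamma>) * (3 ^ CARD('n) * l powr \<gamma> * (1 / (1 - 2 powr - \<gamma>))))"
    by (simp add: c_def q_def)
qed

context doubling_bump
begin

lemma measurable_\<Phi>:
  assumes "g \<in> borel_measurable borel"
  shows "(\<lambda>y. \<Phi> g y \<rho>) \<in> borel_measurable borel"
proof -
  have "g \<in> borel_measurable lebesgue" using assms by (intro measurable_completion) simp
  from measurable_local_norm[OF \<nu> this]
  have [measurable]: "(\<lambda>y. local_norm p \<nu> g y \<rho>) \<in> borel_measurable borel" .
  have [measurable]: "(\<lambda>y. W (ball y \<rho>)) \<in> borel_measurable borel"
    by (rule measurable_emeasure_ball) simp
  show ?thesis unfolding \<Phi>_def by measurable
qed

text \<open>Tonelli's theorem over the ball: integrated in \<open>x\<close>, the kernel is bounded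
  uniformly in \<open>z\<close>, so the near potential has a finite integral.
  \<open>3 * \<rho>\<close> bounds the distance between points of \<open>ball y \<rho>\<close> and
  \<open>ball y (2 * \<rho>)\<close>.\<close>

lemma riesz_near_finite_AE:
  fixes g :: "real^'n \<Rightarrow> ennreal"
  assumes [measurable]: "g \<in> borel_measurable borel" and \<rho>: "0 < \<rho>"
    and fin: "(\<integral>\<^sup>+z\<in>ball y (2 * \<rho>). g z \<partial>lborel) < \<infinity>"
  shows "AE x in lborel. x \<in> ball y \<rho> \<longrightarrow> riesz \<gamma> (\<lambda>z. g z * indicator (ball y (2 * \<rho>)) z) x < \<infinity>"
proof -
  have [measurable]: "ball y R \<in> sets borel" for R by simp
  obtain C where C: "\<And>x::real^'n. (\<integral>\<^sup>+y. ennreal (norm (x - y) powr (\<gamma> - CARD('n))) * indicator {y. dist x y < 3 * \<rho>} y \<partial>lborel) \<le> ennreal C"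
    using nn_integral_riesz_kernel_finite[OF \<gamma>, of "3 * \<rho>"] \<rho> by auto
  let ?g = "\<lambda>z. g z * indicator (ball y (2 * \<rho>)) z"
  have "(\<integral>\<^sup>+x. riesz \<gamma> ?g x * indicator (ball y \<rho>) x \<partial>lborel) =
     (\<integral>\<^sup>+x. \<integral>\<^sup>+z. ennreal (norm (x - z) powr (\<gamma> - CARD('n))) * ?g z * indicator (ball y \<rho>) x \<partial>lborel \<partial>lborel)"
    unfolding riesz_def by (intro nn_integral_cong nn_integral_multc[symmetric]) measurable
  also have "\<dots> = (\<integral>\<^sup>+z. \<integral>\<^sup>+x. ennreal (norm (x - z) powr (\<gamma> - CARD('n))) * ?g z * indicator (ball y \<rho>) x \<partial>lborel \<partial>lborel)"
    by (rule lborel_pair.Fubini') measurable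
  also have "\<dots> \<le> (\<integral>\<^sup>+z. ?g z * ennreal C \<partial>lborel)"
  proof (rule nn_integral_mono)
    fix z
    have "(\<integral>\<^sup>+x. ennreal (norm (x - z) powr (\<gamma> - CARD('n))) * ?g z * indicator (ball y \<rho>) x \<partial>lborel) \<le>
      (\<integral>\<^sup>+x. ?g z * (ennreal (norm (z - x) powr (\<gamma> - CARD('n))) * indicator {x. dist z x < 3 * \<rho>} x) \<partial>lborel)"
    proof (rule nn_integral_mono)
      fix x
      show "ennreal (norm (x - z) powr (\<gamma> - CARD('n))) * ?g z * indicator (ball y \<rho>) x \<le>
        ?g z * (ennreal (norm (z - x) powr (\<gamma> - CARD('n))) * indicator {x. dist z x < 3 * \<rho>} x)"
      proof (cases "z \<in> ball y (2 * \<rho>) \<and> x \<in> ball y \<rho>")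
        case True
        then have "dist z x < 3 * \<rho>" using dist_triangle[of z x y] by (simp add: dist_commute)
        then show ?thesis using True by (simp add: norm_minus_commute mult.commute)
      next
        case False
        then have "indicator (ball y (2 * \<rho>)) z = (0::ennreal) \<or> indicator (ball y \<rho>) x = (0::ennreal)"
          by (auto simp: indicator_def)
        then show ?thesis by auto
      qed
    qed
    also have "\<dots> = ?g z * (\<integral>\<^sup>+x. ennreal (norm (z - x) powr (\<gamma> - CARD('n))) * indicator {x. dist z x < 3 * \<rho>} x \<partial>lborel)"
      by (rule nn_integral_cmult) measurable
    also have "\<dots> \<le> ?g z * ennreal C" by (intro mult_left_mono C) simp
    finally show "(\<integral>\<^sup>+x. ennreal (norm (x - z) powr (\<gamma> - CARD('n))) * ?g z * indicator (ball y \<rho>) x \<partial>lborel) \<le> ?g z * ennreal C" .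
  qed
  also have "\<dots> = (\<integral>\<^sup>+z\<in>ball y (2 * \<rho>). g z \<partial>lborel) * ennreal C"
    by (rule nn_integral_multc) measurable
  also have "\<dots> < \<infinity>" using fin by (simp add: ennreal_mult_less_top)
  finally have "(\<integral>\<^sup>+x. riesz \<gamma> ?g x * indicator (ball y \<rho>) x \<partial>lborel) \<noteq> \<infinity>" by simp
  then have "AE x in lborel. riesz \<gamma> ?g x * indicator (ball y \<rho>) x \<noteq> \<infinity>"
    by (intro nn_integral_PInf_AE) measurable
  then show ?thesis
    by eventually_elim (auto simp: less_top)
qed

text \<open>It suffices to have one centre \<open>y\<close> at which all the series
  \<open>H m y\<close> are finite: then the far part is bounded on each ball of radius
  \<open>real (Suc m)\<close> around \<open>y\<close>, and these balls exhaust the space. The norm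
  bound makes almost every \<open>y\<close> with respect to \<mu> such a centre, and as \<mu> is not
  null there is one. This finiteness is what later makes the fractional integral converge.\<close>

lemma riesz_finite_AE:
  fixes g :: "real^'n \<Rightarrow> ennreal"
  assumes g [measurable]: "g \<in> borel_measurable borel"
    and loc: "\<And>y R. (\<integral>\<^sup>+z\<in>ball y R. g z \<partial>lborel) < \<infinity>"
    and \<mu>: "weight \<mu>" "\<not> (AE x in lebesgue. \<mu> x = 0)" and s: "1 < s"
    and A: "A < \<infinity>" "\<And>\<rho>. 0 < \<rho> \<Longrightarrow> Lnorm s (wmeasure \<mu>) (\<lambda>y. \<Phi> g y \<rho>) \<le> A"
  shows "AE x in lborel. riesz \<gamma> g x < \<infinity>"
proof -
  note [measurable] = weight_measurable[OF \<mu>(1)]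
  obtain K q where q: "0 < K" "0 < q" "q < 1" and far: "\<And>g y \<rho>. g \<in> borel_measurable borel \<Longrightarrow> 0 < \<rho> \<Longrightarrow>
    enn_powr (W (ball y \<rho>)) (e + 1 / p) * far_sum g y \<rho> \<le> ennreal K * (\<Sum>j. ennreal (q ^ j) * \<Phi> g y (2 ^ (j + 1) * \<rho>))"
    using far_sum_le by blast
  define H where "H m y = (\<Sum>j. ennreal (q ^ j) * \<Phi> g y (2 ^ (j + 1) * real (Suc m)))" for m y
  have \<Phi>_meas: "(\<lambda>y. \<Phi> g y \<rho>) \<in> borel_measurable (wmeasure \<mu>)" for \<rho>
    by (intro measurable_wmeasure measurable_\<Phi> g)
  have H_meas: "H m \<in> borel_measurable (wmeasure \<mu>)" for m
    unfolding H_def using \<Phi>_meas by measurable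
  have "AE y in wmeasure \<mu>. H m y < \<infinity>" for m
  proof (rule Lnorm_finite_AE[OF _ H_meas])
    show "0 < s" using s by (rule less_trans[rotated]) simp
    have "Lnorm s (wmeasure \<mu>) (H m) \<le> ennreal (1 / (1 - q)) * A"
    proof (rule Lnorm_geometric_le[OF q(2,3) s _ \<Phi>_meas H_meas])
      show "Lnorm s (wmeasure \<mu>) (\<lambda>y. \<Phi> g y (2 ^ (j + 1) * real (Suc m))) \<le> A" for j
        by (rule A(2)) simp
      show "H m y \<le> ennreal 1 * (\<Sum>j. ennreal (q ^ j) * \<Phi> g y (2 ^ (j + 1) * real (Suc m)))" for y
        by (simp add: H_def)
    qed simp
    also have "\<dots> < \<infinity>" using A(1) by (simp add: ennreal_mult_less_top)
    finally show "Lnorm s (wmeasure \<mu>) (H m) < \<infinity>" .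
  qed
  then have all: "AE y in wmeasure \<mu>. \<forall>m. H m y < \<infinity>" by (simp add: AE_all_countable)
  have "\<exists>y. \<forall>m. H m y < \<infinity>"
  proof (rule ccontr)
    assume "\<nexists>y. \<forall>m. H m y < \<infinity>"
    with all have "AE y in wmeasure \<mu>. False" by (auto elim: eventually_mono)
    then have "AE y in lebesgue. \<not> 0 < ennreal (\<mu> y)"
      unfolding wmeasure_def by (subst (asm) AE_density) auto
    then have "AE y in lebesgue. \<mu> y = 0"
      by eventually_elim (use \<mu>(1) in \<open>auto simp: weight_def intro: antisym\<close>)
    with \<mu>(2) show False by simp
  qed
  then obtain y where y: "\<And>m. H m y < \<infinity>" by blast
  have far_fin: "far_sum g y (real (Suc m)) < \<infinity>" for m
  proof (rule ccontr)
    assume "\<not> ?thesis"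
    then have top: "far_sum g y (real (Suc m)) = \<infinity>" by (simp add: less_top[symmetric])
    have "0 < enn_powr (W (ball y (real (Suc m)))) (e + 1 / p)"
      using enn_powr_gt0[OF W_ball_pos W_ball_finite, of "real (Suc m)" y "e + 1 / p"] by simp
    then have "enn_powr (W (ball y (real (Suc m)))) (e + 1 / p) * far_sum g y (real (Suc m)) = \<infinity>"
      unfolding top by (simp add: ennreal_mult_top)
    moreover have "enn_powr (W (ball y (real (Suc m)))) (e + 1 / p) * far_sum g y (real (Suc m)) \<le> ennreal K * H m y"
      unfolding H_def by (rule far[OF g]) simp
    moreover have "ennreal K * H m y < \<infinity>" using y[of m] by (simp add: ennreal_mult_less_top)
    ultimately show False by simp
  qed
  have "AE x in lborel. \<forall>m. x \<in> ball y (real (Suc m)) \<longrightarrow>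
      riesz \<gamma> (\<lambda>z. g z * indicator (ball y (2 * real (Suc m))) z) x < \<infinity>"
    unfolding AE_all_countable by (intro allI riesz_near_finite_AE g loc) simp
  then show ?thesis
  proof eventually_elim
    case (elim x)
    obtain m where "dist y x < real m" using reals_Archimedean2 by blast
    then have x: "x \<in> ball y (real (Suc m))" by simp
    have "riesz \<gamma> g x = riesz \<gamma> (\<lambda>z. g z * indicator (ball y (2 * real (Suc m))) z) x +
        riesz \<gamma> (\<lambda>z. g z * indicator (- ball y (2 * real (Suc m))) z) x"
      by (rule riesz_split[OF g]) simp
    moreover have "riesz \<gamma> (\<lambda>z. g z * indicator (- ball y (2 * real (Suc m))) z) x \<le> far_sum g y (real (Suc m))"
      unfolding far_sum_def by (rule riesz_far_le[OF _ \<gamma>(2) g x]) simp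
    ultimately show ?case using elim x far_fin[of m] by (auto intro: le_less_trans)
  qed
qed

end

text \<open>The degenerate weight is treated apart because its balls have mass \<open>0\<close>,
  whose power may be infinite when the exponent is negative. The product with the vanishing weak
  norm is \<open>0\<close> by the convention \<open>0 * top = 0\<close>.\<close>

lemma weak_amalgam_norm_null:
  assumes p: "0 < p" and s: "0 < s" and w: "weight w" and null: "AE x in lebesgue. w x = 0"
  shows "weak_amalgam_norm p s \<alpha> w \<mu> F = 0"
proof -
  note [measurable] = weight_measurable[OF w]
  have zero: "emeasure (wmeasure w) A = 0" for A
  proof (cases "A \<in> sets lebesgue")
    case True
    then have "emeasure (wmeasure w) A = (\<integral>\<^sup>+x\<in>A. ennreal (w x) \<partial>lebesgue)"
      by (simp add: wmeasure_def emeasure_density)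
    also have "\<dots> = 0"
    proof (subst nn_integral_0_iff_AE)
      show "(\<lambda>x. ennreal (w x) * indicator A x) \<in> borel_measurable lebesgue" using True by measurable
      show "AE x in lebesgue. ennreal (w x) * indicator A x = 0" using null by eventually_elim simp
    qed
    finally show ?thesis .
  qed (simp add: emeasure_notin_sets)
  have WL: "WLnorm p (wmeasure w) G = 0" for G
    using p by (simp add: WLnorm_def zero)
  have "Lnorm s (wmeasure \<mu>) (\<lambda>_. 0) = 0"
  proof (cases s)
    case top
    have "esssup (wmeasure \<mu>) (\<lambda>_. 0::ennreal) \<le> 0" by (rule esssup_I) auto
    then show ?thesis using top by (simp add: Lnorm_def)
  next
    case (real S)
    then have "0 < S" using s by auto
    then show ?thesis using real by (simp add: Lnorm_ennreal)
  qed
  then show ?thesis by (simp add: weak_amalgam_norm_def WL)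
qed

text \<open>The factor \<open>w (ball y \<rho>)\<close> to the power \<open>1 / \<alpha> - 1 / p - 1 / s\<close> absorbs the geometric growth
  of the dilated balls, since \<open>1 / \<alpha> - 1 / s > 0\<close>.\<close>

lemma doubling_bump_exponent:
  assumes p: "1 < p" "p \<le> \<alpha>" and s: "ennreal \<alpha> < s"
  shows "1 / \<alpha> - 1 / p - enn2real (1 / s) \<le> 0" "0 < 1 / \<alpha> - 1 / p - enn2real (1 / s) + 1 / p"
proof -
  have "1 / \<alpha> \<le> 1 / p" using p by (simp add: frac_le)
  then show "1 / \<alpha> - 1 / p - enn2real (1 / s) \<le> 0" using enn2real_nonneg[of "1 / s"] by linarith
  have "enn2real (1 / s) < 1 / \<alpha>"
  proof (cases s)
    case top
    then show ?thesis using p by simp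
  next
    case (real S)
    then have "\<alpha> < S" using s p by (simp add: ennreal_less_iff)
    moreover have "1 / s = ennreal (1 / S)" using real \<open>\<alpha> < S\<close> p divide_ennreal[of 1 S] by simp
    ultimately show ?thesis using p by (simp add: divide_strict_left_mono)
  qed
  then show "0 < 1 / \<alpha> - 1 / p - enn2real (1 / s) + 1 / p" by simp
qed

text \<open>Each dilated radius \<open>2 ^ (j + 1) * \<rho>\<close> is again admissible in the
  supremum over radii, so every \<open>\<Phi>\<close> in the series has norm at most the amalgam
  norm of \<open>g\<close>, whatever \<open>j\<close> is. Both operators will enter only through
  their domination by the potential.\<close>

lemma weak_amalgam_norm_le:
  fixes \<gamma> p r C\<^sub>0 \<alpha> c :: real and w \<nu> \<mu> :: "real^'n \<Rightarrow> real"
  assumes \<gamma>: "0 < \<gamma>" "\<gamma> < CARD('n)" and p: "1 < p" "p \<le> \<alpha>" and s: "ennreal \<alpha> < s"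
    and \<mu>: "weight \<mu>" and w: "weight w" and \<nu>: "weight \<nu>"
    and r: "1 < r" and bump: "bump_condition \<gamma> p r C\<^sub>0 w \<nu>" and D: "Delta2 w" and c: "0 < c"
  shows "\<exists>C>0. \<forall>g\<in>borel_measurable borel. \<forall>F\<in>borel_measurable lebesgue.
    (AE x in lebesgue. F x \<le> ennreal c * riesz \<gamma> g x) \<longrightarrow>
      weak_amalgam_norm p s \<alpha> w \<mu> F \<le> ennreal C * amalgam_norm p s \<alpha> \<nu> w \<mu> g"
proof (cases "AE x in lebesgue. w x = 0")
  case True
  have "0 < p" using p by simp
  moreover have "0 < s" using s by (rule le_less_trans[rotated]) simp
  ultimately have "weak_amalgam_norm p s \<alpha> w \<mu> F = 0" for F
    using w True by (rule weak_amalgam_norm_null)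
  then show ?thesis by (intro exI[of _ 1]) auto
next
  case False
  define e where "e = 1 / \<alpha> - 1 / p - enn2real (1 / s)"
  interpret doubling_bump \<gamma> p r C\<^sub>0 w \<nu> e
    using doubling_bump_exponent[OF p s] by unfold_locales (use assms False in \<open>auto simp: e_def\<close>)
  obtain K q where q: "0 < K" "0 < q" "q < 1" and bound: "\<And>g F y \<rho>. g \<in> borel_measurable borel \<Longrightarrow>
      F \<in> borel_measurable lebesgue \<Longrightarrow> (AE x in lebesgue. F x \<le> ennreal c * riesz \<gamma> g x) \<Longrightarrow> 0 < \<rho> \<Longrightarrow>
      enn_powr (W (ball y \<rho>)) e * WLnorm p (wmeasure w) (\<lambda>x. F x * indicator (ball y \<rho>) x) \<le>
        ennreal K * (\<Sum>j. ennreal (q ^ j) * \<Phi> g y (2 ^ (j + 1) * \<rho>))"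
    using WLnorm_ball_le[OF c] by blast
  show ?thesis
  proof (intro exI[of _ "K / (1 - q)"] conjI ballI impI)
    show "0 < K / (1 - q)" using q by simp
    fix g F :: "real^'n \<Rightarrow> ennreal"
    assume g: "g \<in> borel_measurable borel" and F: "F \<in> borel_measurable lebesgue"
      and le: "AE x in lebesgue. F x \<le> ennreal c * riesz \<gamma> g x"
    have g': "g \<in> borel_measurable lebesgue" using g by (intro measurable_completion) simp
    have \<Phi>: "Lnorm s (wmeasure \<mu>) (\<lambda>y. \<Phi> g y \<rho>) \<le> amalgam_norm p s \<alpha> \<nu> w \<mu> g" if "0 < \<rho>" for \<rho>
    proof -
      have "Lnorm s (wmeasure \<mu>) (\<lambda>y. enn_powr (W (ball y \<rho>)) e *
          Lnorm (ennreal p) (wmeasure \<nu>) (\<lambda>x. g x * indicator (ball y \<rho>) x)) \<le> amalgam_norm p s \<alpha> \<nu> w \<mu> g"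
        unfolding amalgam_norm_def e_def using that by (intro SUP_upper) simp
      then show ?thesis
        using p by (simp add: Lnorm_ball_eq_local_norm[OF _ \<nu> g'] \<Phi>_def)
    qed
    show "weak_amalgam_norm p s \<alpha> w \<mu> F \<le> ennreal (K / (1 - q)) * amalgam_norm p s \<alpha> \<nu> w \<mu> g"
      unfolding weak_amalgam_norm_def e_def[symmetric]
    proof (rule SUP_least)
      fix \<rho> :: real assume "\<rho> \<in> {0<..}"
      then have \<rho>: "0 < \<rho>" by simp
      have "1 < s"
      proof -
        have "1 < \<alpha>" using assms(3,4) by linarith
        then have "1 < ennreal \<alpha>" by (simp add: ennreal_less_iff flip: ennreal_1)
        then show ?thesis using s by (rule less_trans)
      qed
      then show "Lnorm s (wmeasure \<mu>) (\<lambda>y. enn_powr (W (ball y \<rho>)) e *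
          WLnorm p (wmeasure w) (\<lambda>x. F x * indicator (ball y \<rho>) x)) \<le>
        ennreal (K / (1 - q)) * amalgam_norm p s \<alpha> \<nu> w \<mu> g"
      proof (rule Lnorm_geometric_le[OF q(2,3)])
        show "(\<lambda>y. \<Phi> g y (2 ^ (j + 1) * \<rho>)) \<in> borel_measurable (wmeasure \<mu>)" for j
          by (intro measurable_wmeasure measurable_\<Phi> g)
        have F': "F \<in> borel_measurable (wmeasure w)" using F by (simp add: measurable_def)
        have [measurable]: "(\<lambda>y. WLnorm p (wmeasure w) (\<lambda>x. F x * indicator (ball y \<rho>) x)) \<in> borel_measurable borel"
          by (rule measurable_WLnorm_ball[OF _ _ F']) (use p in auto)
        have [measurable]: "(\<lambda>y. W (ball y \<rho>)) \<in> borel_measurable borel"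
          by (rule measurable_emeasure_ball) simp
        show "(\<lambda>y. enn_powr (W (ball y \<rho>)) e * WLnorm p (wmeasure w) (\<lambda>x. F x * indicator (ball y \<rho>) x))
            \<in> borel_measurable (wmeasure \<mu>)"
          by (rule measurable_wmeasure) measurable
        show "Lnorm s (wmeasure \<mu>) (\<lambda>y. \<Phi> g y (2 ^ (j + 1) * \<rho>)) \<le> amalgam_norm p s \<alpha> \<nu> w \<mu> g" for j
          by (rule \<Phi>) (use \<rho> in simp)
        show "enn_powr (W (ball y \<rho>)) e * WLnorm p (wmeasure w) (\<lambda>x. F x * indicator (ball y \<rho>) x) \<le>
          ennreal K * (\<Sum>j. ennreal (q ^ j) * \<Phi> g y (2 ^ (j + 1) * \<rho>))" for y
          by (rule bound[OF g F le \<rho>])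
      qed (use q in simp)
    qed
  qed
qed

lemma riesz_finite_AE_amalgam:
  fixes \<gamma> p r C\<^sub>0 \<alpha> :: real and w \<nu> \<mu> :: "real^'n \<Rightarrow> real"
  assumes \<gamma>: "0 < \<gamma>" "\<gamma> < CARD('n)" and p: "1 < p" "p \<le> \<alpha>" and s: "ennreal \<alpha> < s"
    and \<mu>: "weight \<mu>" and w: "weight w" and \<nu>: "weight \<nu>"
    and r: "1 < r" and bump: "bump_condition \<gamma> p r C\<^sub>0 w \<nu>" and D: "Delta2 w"
    and w0: "\<not> (AE x in lebesgue. w x = 0)" and \<mu>0: "\<not> (AE x in lebesgue. \<mu> x = 0)"
    and g: "g \<in> borel_measurable borel" and loc: "\<And>y R. (\<integral>\<^sup>+z\<in>ball y R. g z \<partial>lborel) < \<infinity>"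
    and fin: "amalgam_norm p s \<alpha> \<nu> w \<mu> g < \<infinity>"
  shows "AE x in lborel. riesz \<gamma> g x < \<infinity>"
proof -
  define e where "e = 1 / \<alpha> - 1 / p - enn2real (1 / s)"
  interpret doubling_bump \<gamma> p r C\<^sub>0 w \<nu> e
    using doubling_bump_exponent[OF p s] by unfold_locales (use assms in \<open>auto simp: e_def\<close>)
  have g': "g \<in> borel_measurable lebesgue" using g by (intro measurable_completion) simp
  have "1 < \<alpha>" using assms(3,4) by linarith
  then have "1 < ennreal \<alpha>" by (simp add: ennreal_less_iff flip: ennreal_1)
  then have s1: "1 < s" using s by (rule less_trans)
  show ?thesis
  proof (rule riesz_finite_AE[OF g loc \<mu> \<mu>0 s1 fin])
    fix \<rho> :: real assume \<rho>: "0 < \<rho>"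
    have "Lnorm s (wmeasure \<mu>) (\<lambda>y. enn_powr (W (ball y \<rho>)) e *
        Lnorm (ennreal p) (wmeasure \<nu>) (\<lambda>x. g x * indicator (ball y \<rho>) x)) \<le> amalgam_norm p s \<alpha> \<nu> w \<mu> g"
      unfolding amalgam_norm_def e_def using \<rho> by (intro SUP_upper) simp
    then show "Lnorm s (wmeasure \<mu>) (\<lambda>y. \<Phi> g y \<rho>) \<le> amalgam_norm p s \<alpha> \<nu> w \<mu> g"
      using p by (simp add: Lnorm_ball_eq_local_norm[OF _ \<nu> g'] \<Phi>_def)
  qed
qed

section \<open>Domination by the Riesz potential\<close>

text \<open>The supremum runs over all balls containing the point, wherever centred, so a ball with
  a value above \<open>a\<close> lies entirely in the superlevel set.\<close>

lemma open_fractional_maximal_gt: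
  fixes f :: "real^'n \<Rightarrow> complex"
  shows "open {x. a < fractional_maximal \<gamma> f x}"
proof -
  define v where "v y \<rho> = ennreal (1 / measure lebesgue (ball y \<rho>) powr (1 - \<gamma> / real CARD('n)))
        * (\<integral>\<^sup>+z\<in>ball y \<rho>. modulus f z \<partial>lebesgue)" for y :: "real^'n" and \<rho>
  have "{x. a < fractional_maximal \<gamma> f x} = (\<Union>(y, \<rho>)\<in>{(y, \<rho>). 0 < \<rho> \<and> a < v y \<rho>}. ball y \<rho>)"
  proof -
    have "fractional_maximal \<gamma> f x = (SUP (y, \<rho>)\<in>{(y, \<rho>). 0 < \<rho> \<and> x \<in> ball y \<rho>}. v y \<rho>)" for x
      unfolding fractional_maximal_def v_def ..
    then have "a < fractional_maximal \<gamma> f x \<longleftrightarrow> (\<exists>y \<rho>. 0 < \<rho> \<and> x \<in> ball y \<rho> \<and> a < v y \<rho>)" for x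
      by (auto simp: less_SUP_iff)
    then show ?thesis unfolding set_eq_iff by (simp add: split_beta) blast
  qed
  also have "open \<dots>" by auto
  finally show ?thesis .
qed

lemma measurable_fractional_maximal: "fractional_maximal \<gamma> f \<in> borel_measurable lebesgue"
proof -
  have "fractional_maximal \<gamma> f \<in> borel_measurable borel"
    using open_fractional_maximal_gt[of _ \<gamma> f] by (intro borel_measurableI_greater) (simp add: borel_open)
  then show ?thesis by (intro measurable_completion) simp
qed

text \<open>Two points of a ball of radius \<open>\<rho>\<close> are at distance below
  \<open>2 * \<rho>\<close>, so off the diagonal the kernel is at least
  \<open>(2 * \<rho>) powr (\<gamma> - n)\<close> there; \<open>C\<close> converts this into the
  power of the volume of the ball.\<close>

lemma fractional_maximal_le_riesz:
  fixes \<gamma> :: real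
  assumes \<gamma>: "\<gamma> < CARD('n)"
  shows "\<exists>C>0. \<forall>f g. g \<in> borel_measurable borel \<longrightarrow> (AE x in lborel. modulus f x = g x) \<longrightarrow>
    (\<forall>x::real^'n. fractional_maximal \<gamma> f x \<le> ennreal C * riesz \<gamma> g x)"
proof -
  define n where "n = real CARD('n)"
  define b where "b = unit_ball_vol n"
  have n: "0 < n" by (simp add: n_def)
  have b: "0 < b" using n by (simp add: b_def)
  define C where "C = 2 powr (n - \<gamma>) / b powr (1 - \<gamma> / n)"
  have C: "0 < C" using b by (simp add: C_def)
  show ?thesis
  proof (intro exI[of _ C] conjI C allI impI)
    fix f and g :: "real^'n \<Rightarrow> ennreal" and x :: "real^'n"
    assume [measurable]: "g \<in> borel_measurable borel" and AE: "AE x in lborel. modulus f x = g x"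
    show "fractional_maximal \<gamma> f x \<le> ennreal C * riesz \<gamma> g x"
      unfolding fractional_maximal_def
    proof (rule SUP_least, clarify)
      fix y :: "real^'n" and \<rho> :: real assume \<rho>: "0 < \<rho>" and x: "x \<in> ball y \<rho>"
      have "measure lebesgue (ball y \<rho>) = b * \<rho> powr n"
        using \<rho> by (simp add: content_ball b_def n_def powr_realpow)
      then have "measure lebesgue (ball y \<rho>) powr (1 - \<gamma> / n) = b powr (1 - \<gamma> / n) * (\<rho> powr n) powr (1 - \<gamma> / n)"
        by (simp only: powr_mult)
      also have "(\<rho> powr n) powr (1 - \<gamma> / n) = \<rho> powr (n - \<gamma>)"
      proof -
        have "n * (1 - \<gamma> / n) = n - \<gamma>" using n by (simp add: field_simps)
        then show ?thesis by (simp add: powr_powr)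
      qed
      finally have vol: "1 / measure lebesgue (ball y \<rho>) powr (1 - \<gamma> / n) = C * (2 * \<rho>) powr (\<gamma> - n)"
        using \<rho> b by (simp add: C_def powr_mult powr_diff field_simps)
      have "ennreal ((2 * \<rho>) powr (\<gamma> - n)) * (\<integral>\<^sup>+z\<in>ball y \<rho>. modulus f z \<partial>lebesgue) =
          ennreal ((2 * \<rho>) powr (\<gamma> - n)) * (\<integral>\<^sup>+z\<in>ball y \<rho>. g z \<partial>lborel)"
        unfolding nn_integral_completion
        by (intro arg_cong2[where f="(*)"] refl nn_integral_cong_AE) (use AE in \<open>auto elim: eventually_mono\<close>)
      also have "\<dots> = (\<integral>\<^sup>+z. ennreal ((2 * \<rho>) powr (\<gamma> - n)) * (g z * indicator (ball y \<rho>) z) \<partial>lborel)"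
      proof -
        have [measurable]: "ball y \<rho> \<in> sets borel" by simp
        show ?thesis by (rule nn_integral_cmult[symmetric]) measurable
      qed
      also have "\<dots> \<le> riesz \<gamma> g x"
        unfolding riesz_def
      proof (rule nn_integral_mono_AE)
        \<comment> \<open>On the diagonal the kernel has the value \<open>0\<close> and the lower
          bound fails; a point is a null set.\<close>
        have "AE z in lborel. z \<noteq> x" by (rule AE_lborel_singleton)
        then show "AE z in lborel. ennreal ((2 * \<rho>) powr (\<gamma> - n)) * (g z * indicator (ball y \<rho>) z) \<le>
            ennreal (norm (x - z) powr (\<gamma> - real CARD('n))) * g z"
        proof eventually_elim
          case (elim z)
          show ?case
          proof (cases "z \<in> ball y \<rho>")
            case True
            then have "norm (x - z) \<le> 2 * \<rho>"
              using x dist_triangle[of x z y] by (simp add: dist_norm norm_minus_commute)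
            then have "(2 * \<rho>) powr (\<gamma> - n) \<le> norm (x - z) powr (\<gamma> - n)"
              using elim \<gamma> by (intro powr_mono2') (auto simp: n_def)
            then show ?thesis using True by (simp add: n_def mult_right_mono ennreal_leI)
          qed simp
        qed
      qed
      finally have "ennreal C * (ennreal ((2 * \<rho>) powr (\<gamma> - n)) * (\<integral>\<^sup>+z\<in>ball y \<rho>. modulus f z \<partial>lebesgue)) \<le>
          ennreal C * riesz \<gamma> g x"
        by (rule mult_left_mono) simp
      then show "ennreal (1 / measure lebesgue (ball y \<rho>) powr (1 - \<gamma> / real CARD('n))) *
          (\<integral>\<^sup>+z\<in>ball y \<rho>. modulus f z \<partial>lebesgue) \<le> ennreal C * riesz \<gamma> g x"
        using C unfolding n_def[symmetric] vol by (simp add: ennreal_mult mult.assoc)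
    qed
  qed
qed

text \<open>A power of \<open>x / m \<le> exp (x / m)\<close>. It lets the Gaussian factor absorb a
  negative power of \<open>t\<close> near \<open>0\<close>.\<close>

lemma exp_minus_le_powr:
  assumes "0 < x" "0 < (m::real)"
  shows "exp (- x) \<le> (m / x) powr m"
proof -
  have "x / m \<le> exp (x / m)" using exp_ge_add_one_self[of "x / m"] by linarith
  then have "exp (- (x / m)) \<le> m / x"
    using assms by (simp add: exp_minus field_simps)
  then have "exp (- (x / m)) powr m \<le> (m / x) powr m"
    using assms by (intro powr_mono2) auto
  then show ?thesis using assms by (simp add: powr_def)
qed

lemma nn_integral_powr_tail:
  assumes a: "0 < a" and c: "0 < (c::real)"
  shows "(\<integral>\<^sup>+t. ennreal (t powr (- a - 1)) * indicator {c..} t \<partial>lborel) = ennreal (c powr - a / a)"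
proof -
  have "(\<integral>\<^sup>+t. ennreal (t powr (- a - 1)) * indicator {c..} t \<partial>lborel) = ennreal (0 - (- (c powr - a / a)))"
  proof (rule nn_integral_FTC_atLeast)
    show "((\<lambda>t. - (t powr - a / a)) has_real_derivative t powr (- a - 1)) (at t)" if "c \<le> t" for t
      using that a c by (auto intro!: derivative_eq_intros)
    have "((\<lambda>t. t powr - a) \<longlongrightarrow> 0) at_top"
      by (rule tendsto_neg_powr) (use a in \<open>auto intro: filterlim_ident\<close>)
    then have "((\<lambda>t. - (t powr - a / a)) \<longlongrightarrow> - (0 / a)) at_top"
      using a by (intro tendsto_intros) auto
    then show "((\<lambda>t. - (t powr - a / a)) \<longlongrightarrow> 0) at_top" by simp
  qed auto
  then show ?thesis by simp
qed

text \<open>The integral is split at \<open>t = d\<^sup>2\<close>. Below, the exponential absorbs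
  the singular power of \<open>t\<close> and the integrand is at most \<open>M\<close>; above, the
  exponential is dropped and the remaining power is integrable. Both parts scale as
  \<open>d powr (\<gamma> - n)\<close>.\<close>

lemma nn_integral_gaussian_time_le:
  fixes \<gamma> n A :: real
  assumes \<gamma>: "0 < \<gamma>" "\<gamma> < n" and A: "0 < A"
  shows "\<exists>K>0. \<forall>d>0. (\<integral>\<^sup>+t\<in>{0<..}. ennreal (t powr (- n / 2) * exp (- A * d\<^sup>2 / t) * t powr (\<gamma> / 2 - 1)) \<partial>lborel)
    \<le> ennreal (K * d powr (\<gamma> - n))"
proof -
  define a where "a = (n - \<gamma>) / 2"
  \<comment> \<open>Chosen so that \<open>t powr (- a - 1) * t powr m = 1\<close>, which leaves a
    bound independent of \<open>t\<close>.\<close>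
  define m where "m = a + 1"
  have "0 < a" using \<gamma> by (simp add: a_def)
  then have a: "0 < a" "0 < m" by (simp_all add: m_def)
  define K where "K = (m / A) powr m + 1 / a"
  have K: "0 < K" using a A by (simp add: K_def add_nonneg_pos)
  show ?thesis
  proof (intro exI[of _ K] conjI K allI impI)
    fix d :: real assume d: "0 < d"
    define M where "M = (m / (A * d\<^sup>2)) powr m"
    have pt: "t powr (- n / 2) * exp (- A * d\<^sup>2 / t) * t powr (\<gamma> / 2 - 1) = t powr (- a - 1) * exp (- (A * d\<^sup>2 / t))"
      if "0 < t" for t
    proof -
      have "t powr (- n / 2) * t powr (\<gamma> / 2 - 1) = t powr (- a - 1)"
      proof -
        have "- n / 2 + (\<gamma> / 2 - 1) = - a - 1" by (simp add: a_def field_simps)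
        then show ?thesis by (simp only: powr_add[symmetric])
      qed
      then show ?thesis by (simp add: mult_ac)
    qed
    have le_M: "t powr (- a - 1) * exp (- (A * d\<^sup>2 / t)) \<le> M" if t: "0 < t" for t
    proof -
      have "exp (- (A * d\<^sup>2 / t)) \<le> (m / (A * d\<^sup>2 / t)) powr m"
        using t A d a by (intro exp_minus_le_powr) auto
      also have "m / (A * d\<^sup>2 / t) = m / (A * d\<^sup>2) * t" using t by simp
      also have "(m / (A * d\<^sup>2) * t) powr m = M * t powr m" unfolding M_def by (rule powr_mult)
      finally have "t powr (- a - 1) * exp (- (A * d\<^sup>2 / t)) \<le> t powr (- a - 1) * (M * t powr m)"
        by (rule mult_left_mono) simp
      also have "\<dots> = M * (t powr (- a - 1) * t powr m)" by simp
      also have "t powr (- a - 1) * t powr m = 1" using t by (simp add: powr_add[symmetric] m_def)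
      finally show ?thesis by simp
    qed
    have "(\<integral>\<^sup>+t\<in>{0<..}. ennreal (t powr (- n / 2) * exp (- A * d\<^sup>2 / t) * t powr (\<gamma> / 2 - 1)) \<partial>lborel) \<le>
      (\<integral>\<^sup>+t. ennreal M * indicator {0..d\<^sup>2} t + ennreal (t powr (- a - 1)) * indicator {d\<^sup>2..} t \<partial>lborel)"
    proof (rule nn_integral_mono)
      fix t :: real
      consider "t \<le> 0" | "0 < t" "t \<le> d\<^sup>2" | "d\<^sup>2 < t" "0 < t" by linarith
      then show "ennreal (t powr (- n / 2) * exp (- A * d\<^sup>2 / t) * t powr (\<gamma> / 2 - 1)) * indicator {0<..} t \<le>
        ennreal M * indicator {0..d\<^sup>2} t + ennreal (t powr (- a - 1)) * indicator {d\<^sup>2..} t"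
      proof cases
        case 1
        then show ?thesis by simp
      next
        case 2
        then have "ennreal (t powr (- n / 2) * exp (- A * d\<^sup>2 / t) * t powr (\<gamma> / 2 - 1)) \<le> ennreal M"
          using le_M[of t] unfolding pt[OF 2(1)] by (intro ennreal_leI)
        then show ?thesis using 2 by (simp add: add_increasing2)
      next
        case 3
        have "0 \<le> A * d\<^sup>2 / t" using 3 A by simp
        then have "t powr (- a - 1) * exp (- (A * d\<^sup>2 / t)) \<le> t powr (- a - 1) * 1"
          by (intro mult_left_mono) auto
        then have "ennreal (t powr (- n / 2) * exp (- A * d\<^sup>2 / t) * t powr (\<gamma> / 2 - 1)) \<le> ennreal (t powr (- a - 1))"
          unfolding pt[OF 3(2)] by (intro ennreal_leI) simp
        then show ?thesis using 3 by simp
      qed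
    qed
    also have "\<dots> = ennreal (M * d\<^sup>2) + ennreal ((d\<^sup>2) powr - a / a)"
      using nn_integral_powr_tail[of a "d\<^sup>2"] a d
      by (subst nn_integral_add) (auto simp: nn_integral_cmult ennreal_mult M_def)
    also have "\<dots> = ennreal (M * d\<^sup>2 + (d\<^sup>2) powr - a / a)"
      using a by (intro ennreal_plus[symmetric]) (auto simp: M_def)
    also have "M * d\<^sup>2 + (d\<^sup>2) powr - a / a = K * d powr (\<gamma> - n)"
    proof -
      have d2: "d\<^sup>2 = d powr 2" using d by (simp add: powr_realpow[of d 2, simplified])
      have e: "(d\<^sup>2) powr - a = d powr (\<gamma> - n)" unfolding d2 powr_powr by (rule arg_cong[where f="(powr) d"]) (simp add: a_def field_simps)
      have "M = (m / A * (1 / d\<^sup>2)) powr m" by (simp add: M_def)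
      also have "\<dots> = (m / A) powr m * (1 / d\<^sup>2) powr m" by (rule powr_mult)
      also have "(1 / d\<^sup>2) powr m = (d\<^sup>2) powr - m" using d by (simp add: powr_minus_divide powr_divide)
      finally have "M * d\<^sup>2 = (m / A) powr m * ((d\<^sup>2) powr - m * (d\<^sup>2) powr 1)" using d by simp
      also have "(d\<^sup>2) powr - m * (d\<^sup>2) powr 1 = (d\<^sup>2) powr - a"
        by (simp only: powr_add[symmetric]) (simp add: m_def)
      finally show ?thesis by (simp add: K_def e distrib_right)
    qed
    finally show "(\<integral>\<^sup>+t\<in>{0<..}. ennreal (t powr (- n / 2) * exp (- A * d\<^sup>2 / t) * t powr (\<gamma> / 2 - 1)) \<partial>lborel)
      \<le> ennreal (K * d powr (\<gamma> - n))" .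
  qed
qed

section \<open>From the Gaussian bound to the Riesz potential\<close>

definition gaussian :: "real \<Rightarrow> real \<Rightarrow> real \<Rightarrow> real^'n \<Rightarrow> real^'n \<Rightarrow> real" where
  "gaussian C A t x y = C * t powr (- real CARD('n) / 2) * exp (- A * (norm (x - y))\<^sup>2 / t)"

lemma nn_integral_gaussian_le_riesz:
  fixes \<gamma> C A :: real
  assumes \<gamma>: "0 < \<gamma>" "\<gamma> < CARD('n)" and C: "0 < C" and A: "0 < A"
  shows "\<exists>K>0. \<forall>g\<in>borel_measurable borel. \<forall>x::real^'n.
    (\<integral>\<^sup>+t. (\<integral>\<^sup>+y. ennreal (gaussian C A t x y * t powr (\<gamma> / 2 - 1)) * g y * indicator {0<..} t \<partial>lborel) \<partial>lborel) \<le>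
      ennreal K * riesz \<gamma> g x"
proof -
  obtain K where K: "0 < K" and time: "\<And>d. 0 < d \<Longrightarrow>
    (\<integral>\<^sup>+t\<in>{0<..}. ennreal (t powr (- real CARD('n) / 2) * exp (- A * d\<^sup>2 / t) * t powr (\<gamma> / 2 - 1)) \<partial>lborel)
      \<le> ennreal (K * d powr (\<gamma> - real CARD('n)))"
    using nn_integral_gaussian_time_le[OF \<gamma> A] by blast
  show ?thesis
  proof (intro exI[of _ "C * K"] conjI ballI allI)
    show "0 < C * K" using C K by simp
    fix g :: "real^'n \<Rightarrow> ennreal" and x :: "real^'n"
    assume [measurable]: "g \<in> borel_measurable borel"
    have "(\<integral>\<^sup>+t. (\<integral>\<^sup>+y. ennreal (gaussian C A t x y * t powr (\<gamma> / 2 - 1)) * g y * indicator {0<..} t \<partial>lborel) \<partial>lborel) =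
      (\<integral>\<^sup>+y. (\<integral>\<^sup>+t. ennreal (gaussian C A t x y * t powr (\<gamma> / 2 - 1)) * g y * indicator {0<..} t \<partial>lborel) \<partial>lborel)"
      unfolding gaussian_def by (rule lborel_pair.Fubini') measurable
    also have "\<dots> \<le> (\<integral>\<^sup>+y. ennreal (C * K) * (ennreal (norm (x - y) powr (\<gamma> - CARD('n))) * g y) \<partial>lborel)"
    proof (rule nn_integral_mono_AE)
      have "AE y in lborel. y \<noteq> x" by (rule AE_lborel_singleton)
      then show "AE y in lborel. (\<integral>\<^sup>+t. ennreal (gaussian C A t x y * t powr (\<gamma> / 2 - 1)) * g y * indicator {0<..} t \<partial>lborel) \<le>
          ennreal (C * K) * (ennreal (norm (x - y) powr (\<gamma> - CARD('n))) * g y)"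
      proof eventually_elim
        case (elim y)
        define d where "d = norm (x - y)"
        have d: "0 < d" using elim by (simp add: d_def)
        have "(\<integral>\<^sup>+t. ennreal (gaussian C A t x y * t powr (\<gamma> / 2 - 1)) * g y * indicator {0<..} t \<partial>lborel) =
          (\<integral>\<^sup>+t. (ennreal C * g y) * (ennreal (t powr (- real CARD('n) / 2) * exp (- A * d\<^sup>2 / t) * t powr (\<gamma> / 2 - 1)) * indicator {0<..} t) \<partial>lborel)"
          using C by (intro nn_integral_cong) (simp add: gaussian_def d_def[symmetric] ennreal_mult mult_ac)
        also have "\<dots> = (ennreal C * g y) * (\<integral>\<^sup>+t\<in>{0<..}. ennreal (t powr (- real CARD('n) / 2) * exp (- A * d\<^sup>2 / t) * t powr (\<gamma> / 2 - 1)) \<partial>lborel)"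
          by (rule nn_integral_cmult) measurable
        also have "\<dots> \<le> (ennreal C * g y) * ennreal (K * d powr (\<gamma> - real CARD('n)))"
          by (intro mult_left_mono time d) simp
        also have "\<dots> = ennreal (C * K) * (ennreal (norm (x - y) powr (\<gamma> - CARD('n))) * g y)"
          using C K by (simp add: ennreal_mult d_def mult_ac)
        finally show ?case .
      qed
    qed
    also have "\<dots> = ennreal (C * K) * riesz \<gamma> g x"
      unfolding riesz_def by (rule nn_integral_cmult) measurable
    finally show "(\<integral>\<^sup>+t. (\<integral>\<^sup>+y. ennreal (gaussian C A t x y * t powr (\<gamma> / 2 - 1)) * g y * indicator {0<..} t \<partial>lborel) \<partial>lborel) \<le>
      ennreal (C * K) * riesz \<gamma> g x" .
  qed
qed

text \<open>Freezes the middle variable of \<open>(t, x, y)\<close>: the exceptional set is enlarged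
  to a Borel null set, and Tonelli's theorem with \<open>t\<close> and \<open>x\<close> exchanged
  makes its sections null for almost every \<open>x\<close>.\<close>

lemma AE_sections:
  assumes "AE z in (lborel :: (real \<times> (real^'n) \<times> (real^'n)) measure). Q z"
  shows "AE x in lborel. AE z in (lborel :: (real \<times> (real^'n)) measure). Q (fst z, x, snd z)"
proof -
  obtain N where N: "{z. \<not> Q z} \<subseteq> N" "emeasure lborel N = 0" and N_sets [measurable]: "N \<in> sets borel"
    using AE_E[OF assms] by auto
  have N_prod [measurable]: "N \<in> sets (borel \<Otimes>\<^sub>M (borel \<Otimes>\<^sub>M borel))"
    unfolding borel_prod by (rule N_sets)
  have "0 = (\<integral>\<^sup>+z. indicator N z \<partial>(lborel \<Otimes>\<^sub>M (lborel \<Otimes>\<^sub>M lborel)))"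
    unfolding lborel_prod using N by simp
  also have "\<dots> = (\<integral>\<^sup>+t. \<integral>\<^sup>+z. indicator N (t, z) \<partial>(lborel \<Otimes>\<^sub>M lborel) \<partial>lborel)"
  proof -
    have "(\<lambda>z. indicator N z :: ennreal) \<in> borel_measurable (lborel \<Otimes>\<^sub>M (lborel :: ((real^'n) \<times> (real^'n)) measure))"
      unfolding lborel_prod by simp
    from lborel.nn_integral_fst[OF this] show ?thesis unfolding lborel_prod by simp
  qed
  also have "\<dots> = (\<integral>\<^sup>+t. \<integral>\<^sup>+x. \<integral>\<^sup>+y. indicator N (t, x, y) \<partial>lborel \<partial>lborel \<partial>lborel)"
    by (intro nn_integral_cong lborel.nn_integral_fst[symmetric]) measurable
  also have "\<dots> = (\<integral>\<^sup>+x. \<integral>\<^sup>+t. \<integral>\<^sup>+y. indicator N (t, x, y) \<partial>lborel \<partial>lborel \<partial>lborel)"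
    by (rule lborel_pair.Fubini') measurable
  finally have "AE x in lborel. (\<integral>\<^sup>+t. \<integral>\<^sup>+y. indicator N (t, x, y) \<partial>lborel \<partial>lborel) = 0"
    by (subst (asm) eq_commute, subst (asm) nn_integral_0_iff_AE) measurable
  then show ?thesis
  proof eventually_elim
    case (elim x)
    have "(\<integral>\<^sup>+z. indicator N (fst z, x, snd z) \<partial>(lborel \<Otimes>\<^sub>M lborel)) = 0"
      unfolding elim[symmetric] by (subst lborel.nn_integral_fst[symmetric]) auto
    then have "AE z in lborel \<Otimes>\<^sub>M lborel. indicator N (fst z, x, snd z) = (0::ennreal)"
      by (subst (asm) nn_integral_0_iff_AE) measurable
    then have "AE z in lborel. indicator N (fst z, x, snd z) = (0::ennreal)" unfolding lborel_prod .
    then show ?case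
      by eventually_elim (use N(1) in \<open>auto simp: indicator_def split: if_splits\<close>)
  qed
qed

lemma AE_snd_lborel:
  fixes P :: "'b::euclidean_space \<Rightarrow> bool"
  assumes "AE y in lborel. P y"
  shows "AE z in (lborel :: ('a::euclidean_space \<times> 'b) measure). P (snd z)"
proof -
  obtain N where N: "{z. \<not> P z} \<subseteq> N" "emeasure lborel N = 0" and [measurable]: "N \<in> sets borel"
    using AE_E[OF assms] by auto
  have "AE y in lborel. y \<notin> N" using N by (intro AE_not_in) (auto simp: null_sets_def)
  then have "AE z in (lborel :: 'a measure) \<Otimes>\<^sub>M (lborel :: 'b measure). snd z \<notin> N"
  proof (intro lborel_pair.AE_pair_measure)
    show "{z \<in> space ((lborel :: 'a measure) \<Otimes>\<^sub>M (lborel :: 'b measure)). snd z \<notin> N} \<in> sets (lborel \<Otimes>\<^sub>M lborel)"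
      by measurable
  qed simp
  then have "AE z in (lborel :: ('a \<times> 'b) measure). snd z \<notin> N" unfolding lborel_prod .
  then show ?thesis by eventually_elim (use N in auto)
qed

section \<open>Domination, measurability and convergence of the fractional integral\<close>

lemma complex_borel_version:
  fixes f :: "'a::euclidean_space \<Rightarrow> complex"
  assumes "f \<in> borel_measurable lebesgue"
  shows "\<exists>f'\<in>borel_measurable borel. AE x in lborel. f x = f' x"
proof -
  have "(\<lambda>x. Re (f x)) \<in> borel_measurable lebesgue" "(\<lambda>x. Im (f x)) \<in> borel_measurable lebesgue"
    using assms by (simp_all add: borel_measurable_complex_iff)
  from this[THEN completion_ex_borel_measurable_real] obtain u v
    where [measurable]: "u \<in> borel_measurable borel" "v \<in> borel_measurable borel"
      and AE: "AE x in lborel. Re (f x) = u x" "AE x in lborel. Im (f x) = v x"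
    by auto
  show ?thesis
  proof (intro bexI[of _ "\<lambda>x. Complex (u x) (v x)"])
    show "AE x in lborel. f x = Complex (u x) (v x)"
      using AE by eventually_elim (simp add: complex_eq_iff)
    show "(\<lambda>x. Complex (u x) (v x)) \<in> borel_measurable borel"
      by (subst borel_measurable_complex_iff) simp
  qed
qed

text \<open>Includes nonintegrable \<open>f\<close>, whose Bochner integral is \<open>0\<close> by
  default; domination by the potential can thus be asserted at every point, before convergence is
  known.\<close>

lemma ennreal_norm_integral_le:
  fixes f :: "'a \<Rightarrow> 'b::{banach, second_countable_topology}"
  shows "ennreal (norm (integral\<^sup>L M f)) \<le> (\<integral>\<^sup>+x. ennreal (norm (f x)) \<partial>M)"
  by (cases "integrable M f") (auto simp: integral_norm_bound_ennreal not_integrable_integral_eq)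

lemma gaussian_bound_gaussian:
  fixes k :: "real \<Rightarrow> real^'n \<Rightarrow> real^'n \<Rightarrow> complex"
  assumes "gaussian_bound k"
  shows "\<exists>C>0. \<exists>A>0. \<forall>t>0. \<forall>x y. cmod (k t x y) \<le> gaussian C A t x y"
  using assms by (auto simp: gaussian_bound_def gaussian_def)

lemma modulus_fractional_integral_le:
  fixes k :: "real \<Rightarrow> real^'n \<Rightarrow> real^'n \<Rightarrow> complex" and \<gamma> :: real
  assumes k: "gaussian_bound k" and \<gamma>: "0 < \<gamma>" "\<gamma> < CARD('n)"
  shows "\<exists>c>0. \<forall>f. \<forall>g\<in>borel_measurable borel. (AE x in lborel. modulus f x = g x) \<longrightarrow>
    (\<forall>x. modulus (fractional_integral k \<gamma> f) x \<le> ennreal c * riesz \<gamma> g x)"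
proof -
  obtain C A where CA: "0 < C" "0 < A" and kb: "\<And>t x y. 0 < t \<Longrightarrow> cmod (k t x y) \<le> gaussian C A t x y"
    using gaussian_bound_gaussian[OF k] by blast
  obtain K where K: "0 < K" and R: "\<And>g x. g \<in> borel_measurable borel \<Longrightarrow>
    (\<integral>\<^sup>+t. (\<integral>\<^sup>+y. ennreal (gaussian C A t x y * t powr (\<gamma> / 2 - 1)) * g y * indicator {0<..} t \<partial>lborel) \<partial>lborel) \<le>
      ennreal K * riesz \<gamma> g (x :: real^'n)"
    using nn_integral_gaussian_le_riesz[OF \<gamma> CA] by blast
  define G where "G = 1 / Gamma (\<gamma> / 2)"
  have G: "0 < G" using \<gamma> by (simp add: G_def)
  show ?thesis
  proof (intro exI[of _ "G * K"] conjI allI ballI impI)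
    show "0 < G * K" using G K by simp
    fix f and g :: "real^'n \<Rightarrow> ennreal" and x :: "real^'n"
    assume g [measurable]: "g \<in> borel_measurable borel" and AE: "AE x in lborel. modulus f x = g x"
    have inner: "ennreal (norm (indicator {0<..} t *\<^sub>R (semigroup_action k t f x * complex_of_real (t powr (\<gamma> / 2 - 1))))) \<le>
        (\<integral>\<^sup>+y. ennreal (gaussian C A t x y * t powr (\<gamma> / 2 - 1)) * g y * indicator {0<..} t \<partial>lborel)" for t
    proof (cases "0 < t")
      case True
      have "ennreal (cmod (semigroup_action k t f x)) \<le> (\<integral>\<^sup>+y. ennreal (cmod (k t x y * f y)) \<partial>lebesgue)"
        unfolding semigroup_action_def by (rule ennreal_norm_integral_le)
      also have "\<dots> = (\<integral>\<^sup>+y. ennreal (cmod (k t x y * f y)) \<partial>lborel)"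
        by (rule nn_integral_completion)
      also have "\<dots> \<le> (\<integral>\<^sup>+y. ennreal (gaussian C A t x y) * g y \<partial>lborel)"
      proof (rule nn_integral_mono_AE)
        show "AE y in lborel. ennreal (cmod (k t x y * f y)) \<le> ennreal (gaussian C A t x y) * g y"
          using AE
        proof eventually_elim
          case (elim y)
          have "ennreal (cmod (k t x y * f y)) = ennreal (cmod (k t x y)) * modulus f y"
            by (simp add: norm_mult ennreal_mult modulus_def)
          also have "\<dots> \<le> ennreal (gaussian C A t x y) * modulus f y"
            by (intro mult_right_mono ennreal_leI kb True) simp
          finally show ?case using elim by simp
        qed
      qed
      finally have "ennreal (cmod (semigroup_action k t f x)) * ennreal (t powr (\<gamma> / 2 - 1)) \<le>
          (\<integral>\<^sup>+y. ennreal (gaussian C A t x y) * g y \<partial>lborel) * ennreal (t powr (\<gamma> / 2 - 1))"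
        by (rule mult_right_mono) simp
      also have "\<dots> = (\<integral>\<^sup>+y. ennreal (gaussian C A t x y) * g y * ennreal (t powr (\<gamma> / 2 - 1)) \<partial>lborel)"
        unfolding gaussian_def by (rule nn_integral_multc[symmetric]) measurable
      also have "\<dots> = (\<integral>\<^sup>+y. ennreal (gaussian C A t x y * t powr (\<gamma> / 2 - 1)) * g y * indicator {0<..} t \<partial>lborel)"
        using True CA by (intro nn_integral_cong) (simp add: gaussian_def ennreal_mult mult_ac)
      finally show ?thesis using True by (simp add: norm_mult ennreal_mult)
    qed simp
    have "modulus (fractional_integral k \<gamma> f) x =
        ennreal G * ennreal (norm (LINT t:{0<..}|lebesgue. semigroup_action k t f x * complex_of_real (t powr (\<gamma> / 2 - 1))))"
      using G by (simp add: modulus_def fractional_integral_def norm_mult ennreal_mult[symmetric] G_def[symmetric] del: of_real_divide)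
    also have "\<dots> \<le> ennreal G * (\<integral>\<^sup>+t. ennreal (norm (indicator {0<..} t *\<^sub>R (semigroup_action k t f x * complex_of_real (t powr (\<gamma> / 2 - 1))))) \<partial>lebesgue)"
      unfolding set_lebesgue_integral_def by (intro mult_left_mono ennreal_norm_integral_le) simp
    also have "\<dots> \<le> ennreal G * (\<integral>\<^sup>+t. (\<integral>\<^sup>+y. ennreal (gaussian C A t x y * t powr (\<gamma> / 2 - 1)) * g y * indicator {0<..} t \<partial>lborel) \<partial>lborel)"
      unfolding nn_integral_completion by (intro mult_left_mono nn_integral_mono inner) simp
    also have "\<dots> \<le> ennreal G * (ennreal K * riesz \<gamma> g x)"
      by (intro mult_left_mono R g) simp
    also have "\<dots> = ennreal (G * K) * riesz \<gamma> g x" using G K by (simp add: ennreal_mult mult.assoc)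
    finally show "modulus (fractional_integral k \<gamma> f) x \<le> ennreal (G * K) * riesz \<gamma> g x" .
  qed
qed

text \<open>Sections of a Lebesgue measurable function need not be measurable. All sections of a
  Borel version are, and it agrees with the kernel in \<open>(t, y)\<close> almost everywhere for
  almost every \<open>x\<close>.\<close>

lemma kernel_borel_version:
  fixes k :: "real \<Rightarrow> real^'n \<Rightarrow> real^'n \<Rightarrow> complex"
  assumes "semigroup_kernel T k"
  shows "\<exists>k'. (\<lambda>(t, x, y). k' t x y) \<in> borel_measurable (borel :: (real \<times> (real^'n) \<times> (real^'n)) measure) \<and>
    (AE x in lborel. AE z in (lborel :: (real \<times> (real^'n)) measure).
      0 < fst z \<longrightarrow> k (fst z) x (snd z) = k' (fst z) x (snd z))"
proof -
  have "(\<lambda>z. indicator ({0<..} \<times> UNIV) z *\<^sub>R (case z of (t, x, y) \<Rightarrow> k t x y)) \<in> borel_measurable lebesgue"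
    using assms by (simp add: semigroup_kernel_def set_borel_measurable_def)
  from complex_borel_version[OF this] obtain h where h: "h \<in> borel_measurable borel"
    and AE: "AE z in lborel. indicator ({0<..} \<times> UNIV) z *\<^sub>R (case z of (t, x, y) \<Rightarrow> k t x y) = h z"
    by blast
  show ?thesis
  proof (intro exI[of _ "\<lambda>t x y. h (t, x, y)"] conjI)
    show "(\<lambda>(t, x, y). h (t, x, y)) \<in> borel_measurable borel" using h by (simp add: split_beta)
    show "AE x in lborel. AE z in lborel. 0 < fst z \<longrightarrow> k (fst z) x (snd z) = h (fst z, x, snd z)"
      using AE_sections[OF AE]
    proof eventually_elim
      case (elim x)
      then show ?case by eventually_elim (auto simp: indicator_def split: if_splits)
    qed
  qed
qed

lemma measurable_compose3:
  assumes "(\<lambda>(t, x, y). k t x y) \<in> borel_measurable (A \<Otimes>\<^sub>M (B \<Otimes>\<^sub>M C))"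
    and "a \<in> M \<rightarrow>\<^sub>M A" "b \<in> M \<rightarrow>\<^sub>M B" "c \<in> M \<rightarrow>\<^sub>M C"
  shows "(\<lambda>z. k (a z) (b z) (c z)) \<in> borel_measurable M"
proof -
  have "(\<lambda>z. (a z, b z, c z)) \<in> M \<rightarrow>\<^sub>M A \<Otimes>\<^sub>M (B \<Otimes>\<^sub>M C)"
    using assms(2-4) by (intro measurable_Pair)
  from measurable_compose[OF this assms(1)] show ?thesis by simp
qed

text \<open>With Borel versions of kernel and function the iterated integral is Borel in
  \<open>x\<close>, as an integral depending on a parameter. It agrees with the operator almost
  everywhere, since a divergent integral takes the same default value on both sides, and
  completeness of Lebesgue measure transfers measurability.\<close>

lemma measurable_fractional_integral:
  fixes k :: "real \<Rightarrow> real^'n \<Rightarrow> real^'n \<Rightarrow> complex"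
  assumes k: "semigroup_kernel T k" and f: "f \<in> borel_measurable lebesgue"
  shows "fractional_integral k \<gamma> f \<in> borel_measurable lebesgue"
proof -
  obtain k' where k': "(\<lambda>(t, x, y). k' t x y) \<in> borel_measurable (borel :: (real \<times> (real^'n) \<times> (real^'n)) measure)"
    and kAE: "AE x in lborel. AE z in (lborel :: (real \<times> (real^'n)) measure). 0 < fst z \<longrightarrow> k (fst z) x (snd z) = k' (fst z) x (snd z)"
    using kernel_borel_version[OF k] by blast
  obtain f' where f' [measurable]: "f' \<in> borel_measurable borel" and fAE: "AE x in lborel. f x = f' x"
    using complex_borel_version[OF f] by blast
  have k'_prod: "(\<lambda>(t, x, y). k' t x y) \<in> borel_measurable (borel \<Otimes>\<^sub>M (borel \<Otimes>\<^sub>M borel))"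
    using k' unfolding borel_prod .
  define S where "S t x = (\<integral>y. k' t x y * f' y \<partial>lborel)" for t x
  have S_meas [measurable]: "(\<lambda>(x, t). S t x) \<in> borel_measurable (borel \<Otimes>\<^sub>M borel)"
  proof -
    have "(\<lambda>z. k' (snd (fst z)) (fst (fst z)) (snd z)) \<in>
        borel_measurable (((borel :: (real^'n) measure) \<Otimes>\<^sub>M (borel :: real measure)) \<Otimes>\<^sub>M (lborel :: (real^'n) measure))"
      by (rule measurable_compose3[OF k'_prod]) measurable
    moreover have "(\<lambda>z. f' (snd z)) \<in>
        borel_measurable (((borel :: (real^'n) measure) \<Otimes>\<^sub>M (borel :: real measure)) \<Otimes>\<^sub>M (lborel :: (real^'n) measure))"
      by measurable
    ultimately have "(\<lambda>z. k' (snd (fst z)) (fst (fst z)) (snd z) * f' (snd z)) \<in>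
        borel_measurable (((borel :: (real^'n) measure) \<Otimes>\<^sub>M (borel :: real measure)) \<Otimes>\<^sub>M (lborel :: (real^'n) measure))"
      by (rule borel_measurable_times)
    then show ?thesis
      unfolding S_def split_beta by (intro lborel.borel_measurable_lebesgue_integral) (simp add: split_beta)
  qed
  define F where "F x = complex_of_real (1 / Gamma (\<gamma> / 2)) *
     (\<integral>t. indicator {0<..} t *\<^sub>R (S t x * complex_of_real (t powr (\<gamma> / 2 - 1))) \<partial>lborel)" for x
  have "F \<in> borel_measurable borel" unfolding F_def by measurable
  then have F_meas: "F \<in> borel_measurable lebesgue" by (intro measurable_completion) simp
  have "AE x in lborel. fractional_integral k \<gamma> f x = F x"
    using kAE
  proof eventually_elim
    case (elim x)
    have "AE z in (lborel :: real measure) \<Otimes>\<^sub>M (lborel :: (real^'n) measure). 0 < fst z \<longrightarrow> k (fst z) x (snd z) = k' (fst z) x (snd z)"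
      using elim unfolding lborel_prod .
    from lborel_pair.AE_pair[OF this]
    have AEt: "AE t in lborel. AE y in lborel. 0 < t \<longrightarrow> k t x y = k' t x y" by simp
    let ?h = "\<lambda>t. indicator {0<..} t *\<^sub>R (semigroup_action k t f x * complex_of_real (t powr (\<gamma> / 2 - 1)))"
    let ?h' = "\<lambda>t. indicator {0<..} t *\<^sub>R (S t x * complex_of_real (t powr (\<gamma> / 2 - 1)))"
    have h'_borel: "?h' \<in> borel_measurable lborel"
      by measurable
    then have h'_leb: "?h' \<in> borel_measurable lebesgue" by (rule measurable_completion)
    have hh': "AE t in lborel. ?h t = ?h' t"
      using AEt
    proof eventually_elim
      case (elim t)
      show ?case
      proof (cases "0 < t")
        case True
        let ?u' = "\<lambda>y. k' t x y * f' y"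
        have "(\<lambda>y. k' t x y) \<in> borel_measurable lborel"
          by (rule measurable_compose3[OF k'_prod]) simp_all
        then have u'_borel: "?u' \<in> borel_measurable lborel"
          using f' by (intro borel_measurable_times) simp_all
        then have u'_leb: "?u' \<in> borel_measurable lebesgue" by (rule measurable_completion)
        have AEy: "AE y in lborel. ?u' y = k t x y * f y"
          using elim fAE by eventually_elim (use True in simp)
        have u_leb: "(\<lambda>y. k t x y * f y) \<in> borel_measurable lebesgue"
          by (rule borel_measurable_AE[OF u'_leb]) (use AEy in \<open>simp add: AE_completion_iff\<close>)
        have "semigroup_action k t f x = integral\<^sup>L lebesgue ?u'"
          unfolding semigroup_action_def
          by (rule integral_cong_AE[OF u_leb u'_leb]) (use AE_completion[OF AEy] in \<open>auto elim: eventually_mono\<close>)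
        also have "\<dots> = S t x" unfolding S_def by (rule integral_completion[OF u'_borel])
        finally show ?thesis by simp
      qed simp
    qed
    have h'h: "AE t in lborel. ?h' t = ?h t"
      using hh' by eventually_elim (rule sym)
    have h_leb: "?h \<in> borel_measurable lebesgue"
      by (rule borel_measurable_AE[OF h'_leb AE_completion[OF h'h]])
    have "integral\<^sup>L lebesgue ?h = integral\<^sup>L lebesgue ?h'"
      by (rule integral_cong_AE[OF h_leb h'_leb AE_completion[OF hh']])
    also have "\<dots> = integral\<^sup>L lborel ?h'" by (rule integral_completion[OF h'_borel])
    finally show ?case by (simp only: fractional_integral_def set_lebesgue_integral_def F_def)
  qed
  then have "AE x in lborel. F x = fractional_integral k \<gamma> f x"
    by eventually_elim (rule sym)
  then have "AE x in lebesgue. F x = fractional_integral k \<gamma> f x" by (rule AE_completion)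
  then show ?thesis by (rule borel_measurable_AE[OF F_meas])
qed

text \<open>By Tonelli's theorem the integral of the modulus over \<open>(t, y)\<close> is at most a
  multiple of the potential of \<open>|f|\<close> at \<open>x\<close>, and the latter is finite for
  almost every \<open>x\<close>.\<close>

lemma fractional_integral_converges_AE:
  fixes k :: "real \<Rightarrow> real^'n \<Rightarrow> real^'n \<Rightarrow> complex" and \<gamma> :: real
  assumes k: "semigroup_kernel T k" "gaussian_bound k" and \<gamma>: "0 < \<gamma>" "\<gamma> < CARD('n)"
    and f: "f \<in> borel_measurable lebesgue" and g [measurable]: "g \<in> borel_measurable borel"
    and AE: "AE x in lborel. modulus f x = g x" and fin: "AE x in lborel. riesz \<gamma> g x < \<infinity>"
  shows "AE x in lebesgue. fractional_integral_converges k \<gamma> f x"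
proof -
  obtain C A where CA: "0 < C" "0 < A" and kb: "\<And>t x y. 0 < t \<Longrightarrow> cmod (k t x y) \<le> gaussian C A t x y"
    using gaussian_bound_gaussian[OF k(2)] by blast
  obtain K where K: "0 < K" and R: "\<And>g x. g \<in> borel_measurable borel \<Longrightarrow>
    (\<integral>\<^sup>+t. (\<integral>\<^sup>+y. ennreal (gaussian C A t x y * t powr (\<gamma> / 2 - 1)) * g y * indicator {0<..} t \<partial>lborel) \<partial>lborel) \<le>
      ennreal K * riesz \<gamma> g (x :: real^'n)"
    using nn_integral_gaussian_le_riesz[OF \<gamma> CA] by blast
  obtain k' where k': "(\<lambda>(t, x, y). k' t x y) \<in> borel_measurable (borel :: (real \<times> (real^'n) \<times> (real^'n)) measure)"
    and kAE: "AE x in lborel. AE z in (lborel :: (real \<times> (real^'n)) measure). 0 < fst z \<longrightarrow> k (fst z) x (snd z) = k' (fst z) x (snd z)"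
    using kernel_borel_version[OF k(1)] by blast
  obtain f' where f' [measurable]: "f' \<in> borel_measurable borel" and fAE: "AE x in lborel. f x = f' x"
    using complex_borel_version[OF f] by blast
  have k'_prod: "(\<lambda>(t, x, y). k' t x y) \<in> borel_measurable (borel \<Otimes>\<^sub>M (borel \<Otimes>\<^sub>M borel))"
    using k' unfolding borel_prod .
  have "AE x in lborel. fractional_integral_converges k \<gamma> f x"
    using kAE fin
  proof eventually_elim
    case (elim x)
    define h where "h z = indicator ({0<..} \<times> UNIV) z *\<^sub>R
        (case z of (t, y) \<Rightarrow> k t x y * f y * complex_of_real (t powr (\<gamma> / 2 - 1)))" for z :: "real \<times> (real^'n)"
    define h' where "h' z = indicator {0<..} (fst z) *\<^sub>R
        (k' (fst z) x (snd z) * f' (snd z) * complex_of_real (fst z powr (\<gamma> / 2 - 1)))" for z :: "real \<times> (real^'n)"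
    define b where "b z = ennreal (gaussian C A (fst z) x (snd z) * fst z powr (\<gamma> / 2 - 1)) * g (snd z) * indicator {0<..} (fst z)"
      for z :: "real \<times> (real^'n)"
    have [measurable]: "(\<lambda>z. k' (fst z) x (snd z)) \<in> borel_measurable ((borel :: real measure) \<Otimes>\<^sub>M (borel :: (real^'n) measure))"
      by (rule measurable_compose3[OF k'_prod]) measurable
    have h'_prod: "h' \<in> borel_measurable (borel \<Otimes>\<^sub>M borel)" unfolding h'_def by measurable
    then have "h' \<in> borel_measurable borel" unfolding borel_prod .
    then have h'_leb: "h' \<in> borel_measurable lebesgue" by (intro measurable_completion) simp
    have "AE z in lborel. h' z = h z"
      using elim(1) AE_snd_lborel[OF fAE]
      by eventually_elim (auto simp: h_def h'_def indicator_def)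
    then have h_leb: "h \<in> borel_measurable lebesgue"
      by (intro borel_measurable_AE[OF h'_leb]) (simp add: AE_completion_iff)
    have "(\<integral>\<^sup>+z. ennreal (norm (h z)) \<partial>lebesgue) \<le> (\<integral>\<^sup>+z. b z \<partial>lborel)"
      unfolding nn_integral_completion
    proof (rule nn_integral_mono_AE)
      show "AE z in lborel. ennreal (norm (h z)) \<le> b z"
        using AE_snd_lborel[OF AE]
      proof eventually_elim
        case (elim z)
        obtain t y where z: "z = (t, y)" by (cases z)
        show ?case
        proof (cases "0 < t")
          case True
          have "ennreal (norm (h z)) = ennreal (cmod (k t x y) * t powr (\<gamma> / 2 - 1)) * modulus f y"
            using True by (simp add: h_def z norm_mult modulus_def ennreal_mult mult_ac)
          also have "\<dots> \<le> ennreal (gaussian C A t x y * t powr (\<gamma> / 2 - 1)) * modulus f y"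
            by (intro mult_right_mono ennreal_leI kb True) auto
          finally show ?thesis using True elim by (simp add: b_def z)
        qed (simp add: h_def z)
      qed
    qed
    also have "(\<integral>\<^sup>+z. b z \<partial>lborel) = (\<integral>\<^sup>+t. (\<integral>\<^sup>+y. b (t, y) \<partial>lborel) \<partial>lborel)"
    proof -
      have "b \<in> borel_measurable (lborel \<Otimes>\<^sub>M lborel)"
        unfolding b_def gaussian_def by measurable
      from lborel.nn_integral_fst[OF this] show ?thesis unfolding lborel_prod by simp
    qed
    also have "\<dots> \<le> ennreal K * riesz \<gamma> g x" using R[OF g, of x] by (simp add: b_def)
    also have "\<dots> < \<infinity>" using elim(2) by (simp add: ennreal_mult_less_top)
    finally have "integrable lebesgue h" by (intro integrableI_bounded h_leb)
    then show ?case by (simp add: fractional_integral_converges_def set_integrable_def h_def[abs_def])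
  qed
  then show ?thesis by (rule AE_completion)
qed

lemma amalgam_norm_cong_AE:
  fixes \<nu> :: "real^'n \<Rightarrow> real"
  assumes p: "0 < p" and \<nu>: "weight \<nu>" and AE: "AE x in lebesgue. F x = G x"
  shows "amalgam_norm p s \<alpha> \<nu> w \<mu> F = amalgam_norm p s \<alpha> \<nu> w \<mu> G"
proof -
  have "AE x in wmeasure \<nu>. F x = G x"
    unfolding wmeasure_def using AE weight_measurable[OF \<nu>]
    by (subst AE_density) (auto elim: eventually_mono)
  then have "Lnorm (ennreal p) (wmeasure \<nu>) (\<lambda>x. F x * indicator (ball y \<rho>) x) =
      Lnorm (ennreal p) (wmeasure \<nu>) (\<lambda>x. G x * indicator (ball y \<rho>) x)" for y \<rho>
    unfolding Lnorm_ennreal[OF p]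
    by (intro arg_cong2[where f=enn_powr] refl nn_integral_cong_AE) (auto elim: eventually_mono)
  then show ?thesis by (simp add: amalgam_norm_def)
qed

theorem corollary6p1:
  fixes L :: "(real^'n \<Rightarrow> complex) \<Rightarrow> real^'n \<Rightarrow> complex"
    and D :: "(real^'n \<Rightarrow> complex) set"
    and T :: "complex \<Rightarrow> (real^'n \<Rightarrow> complex) \<Rightarrow> real^'n \<Rightarrow> complex"
    and k :: "real \<Rightarrow> real^'n \<Rightarrow> real^'n \<Rightarrow> complex"
    and \<gamma> p \<alpha> r C\<^sub>0 :: real
    and s :: ennreal
    and w \<nu> \<mu> :: "real^'n \<Rightarrow> real"
  assumes "L2_linear D L" and "analytic_semigroup T" and "generates_semigroup D L T"
    and "semigroup_kernel T k" and "gaussian_bound k"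
    and "0 < \<gamma>" and "\<gamma> < real CARD('n)"
    and "1 < p" and "p \<le> \<alpha>" and "ennreal \<alpha> < s"
    and "weight \<mu>" and "Delta2 \<mu>"
    and "weight w" and "weight \<nu>"
    and "1 < r" and "bump_condition \<gamma> p r C\<^sub>0 w \<nu>"
    and "Delta2 w"
  shows "(\<exists>C>0. \<forall>f\<in>amalgam p s \<alpha> \<nu> w \<mu>.
            fractional_maximal \<gamma> f \<in> borel_measurable lebesgue \<and>
            weak_amalgam_norm p s \<alpha> w \<mu> (fractional_maximal \<gamma> f)
              \<le> ennreal C * amalgam_norm p s \<alpha> \<nu> w \<mu> (modulus f)) \<and>
         (\<exists>C>0. \<forall>f\<in>amalgam p s \<alpha> \<nu> w \<mu>.
            (\<not> (AE x in lebesgue. w x = 0) \<longrightarrow> \<not> (AE x in lebesgue. \<mu> x = 0) \<longrightarrow>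
               (AE x in lebesgue. fractional_integral_converges k \<gamma> f x)) \<and>
            fractional_integral k \<gamma> f \<in> borel_measurable lebesgue \<and>
            weak_amalgam_norm p s \<alpha> w \<mu> (modulus (fractional_integral k \<gamma> f))
              \<le> ennreal C * amalgam_norm p s \<alpha> \<nu> w \<mu> (modulus f))"
proof -
  note kernel = assms(4,5) and \<gamma> = assms(6,7) and p = assms(8,9) and s = assms(10)
    and weights = assms(11,13,14) and bump = assms(15,16,17)
  have p0: "0 < p" using p by simp
  obtain c\<^sub>1 where c1: "0 < c\<^sub>1" and max_le: "\<And>f g x. g \<in> borel_measurable borel \<Longrightarrow>
      (AE x in lborel. modulus f x = g x) \<Longrightarrow> fractional_maximal \<gamma> f (x :: real^'n) \<le> ennreal c\<^sub>1 * riesz \<gamma> g x"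
    using fractional_maximal_le_riesz[OF \<gamma>(2)] by blast
  obtain c\<^sub>2 where c2: "0 < c\<^sub>2" and int_le: "\<And>f g x. g \<in> borel_measurable borel \<Longrightarrow>
      (AE x in lborel. modulus f x = g x) \<Longrightarrow> modulus (fractional_integral k \<gamma> f) x \<le> ennreal c\<^sub>2 * riesz \<gamma> g x"
    using modulus_fractional_integral_le[OF kernel(2) \<gamma>] by blast
  \<comment> \<open>The estimates for the potential concern Borel functions, while
    \<open>modulus f\<close> is only Lebesgue measurable. A Borel function equal to it almost
    everywhere has the same amalgam norm and is locally integrable as well.\<close>
  have borel_version: "\<exists>g\<in>borel_measurable borel. (AE x in lborel. modulus f x = g x) \<and>
      (\<forall>y R. (\<integral>\<^sup>+z\<in>ball y R. g z \<partial>lborel) < \<infinity>) \<and>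
      amalgam_norm p s \<alpha> \<nu> w \<mu> (modulus f) = amalgam_norm p s \<alpha> \<nu> w \<mu> g"
    if f: "locally_integrable f" for f :: "real^'n \<Rightarrow> complex"
  proof -
    have [measurable]: "f \<in> borel_measurable lebesgue" by (rule locally_integrable_measurable[OF f])
    have "modulus f \<in> borel_measurable lebesgue" unfolding modulus_def by measurable
    then obtain g where g: "g \<in> borel_measurable borel" and AE: "AE x in lborel. modulus f x = g x"
      using completion_ex_borel_measurable[of "modulus f" lborel] by auto
    have "(\<integral>\<^sup>+z\<in>ball y R. g z \<partial>lborel) < \<infinity>" for y R
    proof -
      have "set_integrable lebesgue (cball y R) f" using f by (auto simp: locally_integrable_def)
      then have fin: "(\<integral>\<^sup>+z. ennreal (norm (indicator (cball y R) z *\<^sub>R f z)) \<partial>lebesgue) < \<infinity>"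
        unfolding set_integrable_def integrable_iff_bounded by simp
      have "(\<integral>\<^sup>+z\<in>ball y R. g z \<partial>lborel) \<le> (\<integral>\<^sup>+z. ennreal (norm (indicator (cball y R) z *\<^sub>R f z)) \<partial>lborel)"
      proof (rule nn_integral_mono_AE)
        show "AE z in lborel. g z * indicator (ball y R) z \<le> ennreal (norm (indicator (cball y R) z *\<^sub>R f z))"
          using AE by eventually_elim (auto simp: indicator_def modulus_def)
      qed
      also have "\<dots> = (\<integral>\<^sup>+z. ennreal (norm (indicator (cball y R) z *\<^sub>R f z)) \<partial>lebesgue)"
        by (rule nn_integral_completion[symmetric])
      finally show ?thesis using fin by (rule le_less_trans)
    qed
    moreover have "amalgam_norm p s \<alpha> \<nu> w \<mu> (modulus f) = amalgam_norm p s \<alpha> \<nu> w \<mu> g"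
      by (rule amalgam_norm_cong_AE[OF p0 weights(3) AE_completion[OF AE]])
    ultimately show ?thesis using g AE by blast
  qed
  obtain C\<^sub>1 where C1: "0 < C\<^sub>1" and weak1: "\<And>g F. g \<in> borel_measurable borel \<Longrightarrow> F \<in> borel_measurable lebesgue \<Longrightarrow>
      (AE x in lebesgue. F x \<le> ennreal c\<^sub>1 * riesz \<gamma> g x) \<Longrightarrow>
      weak_amalgam_norm p s \<alpha> w \<mu> F \<le> ennreal C\<^sub>1 * amalgam_norm p s \<alpha> \<nu> w \<mu> g"
    using weak_amalgam_norm_le[OF \<gamma> p s weights bump c1] by blast
  obtain C\<^sub>2 where C2: "0 < C\<^sub>2" and weak2: "\<And>g F. g \<in> borel_measurable borel \<Longrightarrow> F \<in> borel_measurable lebesgue \<Longrightarrow>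
      (AE x in lebesgue. F x \<le> ennreal c\<^sub>2 * riesz \<gamma> g x) \<Longrightarrow>
      weak_amalgam_norm p s \<alpha> w \<mu> F \<le> ennreal C\<^sub>2 * amalgam_norm p s \<alpha> \<nu> w \<mu> g"
    using weak_amalgam_norm_le[OF \<gamma> p s weights bump c2] by blast
  show ?thesis
  proof (intro conjI)
    show "\<exists>C>0. \<forall>f\<in>amalgam p s \<alpha> \<nu> w \<mu>. fractional_maximal \<gamma> f \<in> borel_measurable lebesgue \<and>
        weak_amalgam_norm p s \<alpha> w \<mu> (fractional_maximal \<gamma> f) \<le> ennreal C * amalgam_norm p s \<alpha> \<nu> w \<mu> (modulus f)"
    proof (intro exI[of _ C\<^sub>1] conjI C1 ballI measurable_fractional_maximal)
      fix f assume "f \<in> amalgam p s \<alpha> \<nu> w \<mu>"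
      then have "locally_integrable f" by (simp add: amalgam_def)
      then obtain g where g: "g \<in> borel_measurable borel" "AE x in lborel. modulus f x = g x"
        and eq: "amalgam_norm p s \<alpha> \<nu> w \<mu> (modulus f) = amalgam_norm p s \<alpha> \<nu> w \<mu> g"
        using borel_version by blast
      show "weak_amalgam_norm p s \<alpha> w \<mu> (fractional_maximal \<gamma> f) \<le> ennreal C\<^sub>1 * amalgam_norm p s \<alpha> \<nu> w \<mu> (modulus f)"
        unfolding eq by (intro weak1 g measurable_fractional_maximal AE_I2 max_le)
    qed
    show "\<exists>C>0. \<forall>f\<in>amalgam p s \<alpha> \<nu> w \<mu>.
            (\<not> (AE x in lebesgue. w x = 0) \<longrightarrow> \<not> (AE x in lebesgue. \<mu> x = 0) \<longrightarrow>
               (AE x in lebesgue. fractional_integral_converges k \<gamma> f x)) \<and>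
            fractional_integral k \<gamma> f \<in> borel_measurable lebesgue \<and>
            weak_amalgam_norm p s \<alpha> w \<mu> (modulus (fractional_integral k \<gamma> f))
              \<le> ennreal C * amalgam_norm p s \<alpha> \<nu> w \<mu> (modulus f)"
    proof (intro exI[of _ C\<^sub>2] conjI C2 ballI impI)
      fix f assume f: "f \<in> amalgam p s \<alpha> \<nu> w \<mu>"
      then have li: "locally_integrable f" by (simp add: amalgam_def)
      have f_meas: "f \<in> borel_measurable lebesgue" by (rule locally_integrable_measurable[OF li])
      obtain g where g: "g \<in> borel_measurable borel" "AE x in lborel. modulus f x = g x"
        and loc: "\<And>y R. (\<integral>\<^sup>+z\<in>ball y R. g z \<partial>lborel) < \<infinity>"
        and eq: "amalgam_norm p s \<alpha> \<nu> w \<mu> (modulus f) = amalgam_norm p s \<alpha> \<nu> w \<mu> g"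
        using borel_version[OF li] by blast
      show int_meas: "fractional_integral k \<gamma> f \<in> borel_measurable lebesgue"
        by (rule measurable_fractional_integral[OF kernel(1) f_meas])
      have "modulus (fractional_integral k \<gamma> f) \<in> borel_measurable lebesgue"
        unfolding modulus_def using int_meas by measurable
      then show "weak_amalgam_norm p s \<alpha> w \<mu> (modulus (fractional_integral k \<gamma> f)) \<le>
          ennreal C\<^sub>2 * amalgam_norm p s \<alpha> \<nu> w \<mu> (modulus f)"
        unfolding eq by (intro weak2 g AE_I2 int_le)
      \<comment> \<open>Convergence is claimed for nondegenerate weights only: if \<mu> is null,
        finiteness of the amalgam norm says nothing about \<open>f\<close>, and if \<open>w\<close>
        is null, the bump condition says nothing about \<nu>.\<close>
      assume nz: "\<not> (AE x in lebesgue. w x = 0)" "\<not> (AE x in lebesgue. \<mu> x = 0)"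
      have "amalgam_norm p s \<alpha> \<nu> w \<mu> g < \<infinity>" using f by (simp add: amalgam_def eq)
      then have "AE x in lborel. riesz \<gamma> g x < \<infinity>"
        by (rule riesz_finite_AE_amalgam[OF \<gamma> p s weights bump nz g(1) loc])
      then show "AE x in lebesgue. fractional_integral_converges k \<gamma> f x"
        by (rule fractional_integral_converges_AE[OF kernel \<gamma> f_meas g])
    qed
  qed
qed

end
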